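(* Let $n\in\mathbb{N}$, $n\ge 2$, $1<p<n$, $\frac{1}{p^*}=\frac1p-\frac1n$, and $R>0$. Then $$ S_{n,p}\left(\frac{n-p}{p-1}\right)^{-\frac{n-1}{n}}\left(\int_{B_R}\frac{|u(x)|^{p^*}}{\left[\log_{\frac{n-1}{p-1}}\frac{R}{|x|}\right]^{\frac{p(n-1)}{n-p}}}\,dx\right)^{\frac1{p^*}}\le\left(\int_{B_R}|L_pu(x)|^p\,dx\right)^{\frac1p} $$ for all $u\in C_0^\infty(B_R)$. The constant on the left-hand side is optimal (it cannot be replaced by a larger one), and it is attained by the function $$ U_R(x)=\left[a+b\left\{\frac{1}{|x|^{\frac{n-p}{p-1}}}-\frac{1}{R^{\frac{n-p}{p-1}}}\right\}^{-\frac{p}{n-p}}\right]^{1-\frac np},\qquad a,b>0, $$ in the sense that equality holds for $u=U_R$. Furthermore, the inequality is invariant under the scaling, for $\lambda>0$, $$ u_\lambda(x):=\lambda^{-\frac{p-1}{p}}u(x_\lambda),\qquad x_\lambda:=\left[\lambda|x|^{-\frac{n-p}{p-1}}+(1-\lambda)R^{-\frac{n-p}{p-1}}\right]^{-\frac{p-1}{n-p}}\frac{x}{|x|}, $$ that is, for every $u\in C_0^\infty(B_R)$ and every $\lambda>0$, each of the two sides of the inequality takes the same value for $u_\lambda$ as for $u$.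
   Context: $B_R$ is the open ball in $\mathbb{R}^n$ centered at the origin with radius $R>0$; $C_0^\infty(B_R)$ is the space of smooth functions with compact support in $B_R$. For $q>0$, $q\ne1$ and $r>0$, the $q$-logarithm is $\log_q r:=\frac{r^{1-q}-1}{1-q}$. For $x\ne0$ the radial and tangential derivatives are $$\nabla_ru(x):=\left(\frac{x}{|x|}\cdot\nabla u(x)\right)\frac{x}{|x|},\qquad \nabla_{\mathbb{S}^{n-1}}u(x):=\nabla u(x)-\nabla_ru(x),$$ and the operator $L_p$ is defined by $$L_pu(x):=\frac{\nabla_{\mathbb{S}^{n-1}}u(x)}{\frac{n-p}{p-1}\log_{\frac{n-1}{p-1}}\frac{R}{|x|}}+\nabla_ru(x).$$ $S_{n,p}$ is the best constant of the Sobolev inequality $S_{n,p}\|u\|_{L^{p^*}(\mathbb{R}^n)}\le\|\nabla u\|_{L^p(\mathbb{R}^n)}$, $u\in W^{1,p}(\mathbb{R}^n)$, given explicitly by $$S_{n,p}=\sqrt{\pi}\,n^{\frac1p}\left(\frac{n-p}{p-1}\right)^{\frac{p-1}{p}}\left[\frac{\Gamma\left(\frac np\right)\Gamma\left(n+1-\frac np\right)}{\Gamma(n)\Gamma\left(1+\frac n2\right)}\right]^{\frac1n},$$ where $\Gamma$ is the gamma function. *)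

theory Defs
  imports "HOL-Analysis.Analysis"
begin

text \<open>\<open>k\<close>-fold continuous differentiability on the whole space, via iterated directional derivatives.\<close>

primrec Ck :: "nat \<Rightarrow> (real ^ 'n \<Rightarrow> real) \<Rightarrow> bool" where
  "Ck 0 f \<longleftrightarrow> continuous_on UNIV f"
| "Ck (Suc k) f \<longleftrightarrow>
     (\<forall>x. f differentiable (at x)) \<and> (\<forall>v. Ck k (\<lambda>x. frechet_derivative f (at x) v))"

definition smooth :: "(real ^ 'n \<Rightarrow> real) \<Rightarrow> bool" where
  "smooth f \<longleftrightarrow> (\<forall>k. Ck k f)"

text \<open>Elements of \<open>C\<^sub>0\<^sup>\<infinity>(B\<^sub>R)\<close> are represented by their extensions by zero to the whole space.\<close>

definition test_functions :: "real \<Rightarrow> (real ^ 'n \<Rightarrow> real) set" where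
  "test_functions R =
     {u. smooth u \<and> compact (closure {x. u x \<noteq> 0}) \<and> closure {x. u x \<noteq> 0} \<subseteq> ball 0 R}"

definition grad :: "(real ^ 'n \<Rightarrow> real) \<Rightarrow> real ^ 'n \<Rightarrow> real ^ 'n" where
  "grad u x = (\<chi> i. frechet_derivative u (at x) (axis i 1))"

definition logq :: "real \<Rightarrow> real \<Rightarrow> real" where
  "logq q r = (r powr (1 - q) - 1) / (1 - q)"

text \<open>The following operators are only meaningful for \<open>x \<noteq> 0\<close>; at the origin, a null set, they
  take irrelevant default values.\<close>

definition grad_rad :: "(real ^ 'n \<Rightarrow> real) \<Rightarrow> real ^ 'n \<Rightarrow> real ^ 'n" where
  "grad_rad u x = ((x /\<^sub>R norm x) \<bullet> grad u x) *\<^sub>R (x /\<^sub>R norm x)"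

definition grad_tan :: "(real ^ 'n \<Rightarrow> real) \<Rightarrow> real ^ 'n \<Rightarrow> real ^ 'n" where
  "grad_tan u x = grad u x - grad_rad u x"

definition Lp :: "real \<Rightarrow> real \<Rightarrow> (real ^ 'n \<Rightarrow> real) \<Rightarrow> real ^ 'n \<Rightarrow> real ^ 'n" where
  "Lp p R u x =
     (let n = real CARD('n) in
      grad_tan u x /\<^sub>R ((n - p) / (p - 1) * logq ((n - 1) / (p - 1)) (R / norm x))
      + grad_rad u x)"

text \<open>The best constant of the Sobolev inequality
  \<open>S \<parallel>u\<parallel>\<^bsub>p*\<^esub> \<le> \<parallel>\<nabla>u\<parallel>\<^bsub>p\<^esub>\<close> on the whole space of dimension \<open>n\<close>,
  by its explicit value (Aubin, Talenti).\<close>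

definition sobolev_const :: "real \<Rightarrow> real \<Rightarrow> real" where
  "sobolev_const n p =
     sqrt pi * n powr (1 / p) * ((n - p) / (p - 1)) powr ((p - 1) / p)
     * (Gamma (n / p) * Gamma (n + 1 - n / p) / (Gamma n * Gamma (1 + n / 2))) powr (1 / n)"

definition lhs_integrand ::
    "real \<Rightarrow> real \<Rightarrow> real \<Rightarrow> (real ^ 'n \<Rightarrow> real) \<Rightarrow> real ^ 'n \<Rightarrow> real" where
  "lhs_integrand p pstar R u x =
     (let n = real CARD('n) in
      \<bar>u x\<bar> powr pstar
      / logq ((n - 1) / (p - 1)) (R / norm x) powr (p * (n - 1) / (n - p)))"

definition rhs_integrand :: "real \<Rightarrow> real \<Rightarrow> (real ^ 'n \<Rightarrow> real) \<Rightarrow> real ^ 'n \<Rightarrow> real" where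
  "rhs_integrand p R u x = norm (Lp p R u x) powr p"

definition lhs_norm :: "real \<Rightarrow> real \<Rightarrow> real \<Rightarrow> (real ^ 'n \<Rightarrow> real) \<Rightarrow> real" where
  "lhs_norm p pstar R u =
     (LINT x : ball 0 R | lebesgue. lhs_integrand p pstar R u x) powr (1 / pstar)"

definition rhs_norm :: "real \<Rightarrow> real \<Rightarrow> (real ^ 'n \<Rightarrow> real) \<Rightarrow> real" where
  "rhs_norm p R u = (LINT x : ball 0 R | lebesgue. rhs_integrand p R u x) powr (1 / p)"

text \<open>\<open>U\<^sub>R\<close>, given its continuous extension at the origin, where the formula reads
  \<open>1 / 0\<close>.\<close>

definition U_fun :: "real \<Rightarrow> real \<Rightarrow> real \<Rightarrow> real \<Rightarrow> real ^ 'n \<Rightarrow> real" where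
  "U_fun p R a b x =
     (let n = real CARD('n) in
      if x = 0 then a powr (1 - n / p)
      else (a + b * (1 / norm x powr ((n - p) / (p - 1)) - 1 / R powr ((n - p) / (p - 1)))
                    powr (- (p / (n - p)))) powr (1 - n / p))"

text \<open>At \<open>x = 0\<close> the last factor vanishes, so the origin is mapped to itself, which is the continuous
  extension.\<close>

definition scale_pt :: "real \<Rightarrow> real \<Rightarrow> real \<Rightarrow> real ^ 'n \<Rightarrow> real ^ 'n" where
  "scale_pt p R l x =
     (let n = real CARD('n) in
      (l * norm x powr (- ((n - p) / (p - 1))) + (1 - l) * R powr (- ((n - p) / (p - 1))))
        powr (- ((p - 1) / (n - p))) *\<^sub>R (x /\<^sub>R norm x))"

definition scale_fun ::
    "real \<Rightarrow> real \<Rightarrow> real \<Rightarrow> (real ^ 'n \<Rightarrow> real) \<Rightarrow> real ^ 'n \<Rightarrow> real" where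
  "scale_fun p R l u x = l powr (- ((p - 1) / p)) * u (scale_pt p R l x)"

end

theory Submission
  imports Defs
begin

text \<open>
  With \<open>\<alpha> = (n - p) / (p - 1)\<close>, the radial map \<open>r \<mapsto> s\<close> given by \<open>s\<^bsup>-\<alpha>\<^esup> = r\<^bsup>-\<alpha>\<^esup> - R\<^bsup>-\<alpha>\<^esup>\<close> carries the ball onto
  the whole space. It turns the weighted norm of \<open>u\<close> into the \<open>L\<^bsup>p*\<^esup>\<close>-norm and the norm of \<open>L\<^sub>p u\<close> into the
  norm of the gradient of the transformed function, \<open>U\<^sub>R\<close> into the Aubin-Talenti function, and
  \<open>x \<mapsto> x\<^sub>\<lambda>\<close> into a dilation. The inequality is thus the sharp Sobolev inequality.

  The latter is proved by mass transport (Cordero-Erausquin, Nazaret, Villani), with the Knothe map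
  \<open>T\<close> in place of the Brenier map. If \<open>T\<close> pushes the density \<open>F\<close>, a multiple of \<open>|v|\<^bsup>p*\<^esup>\<close>, to the extremal
  density \<open>G\<close>, the arithmetic-geometric mean inequality for the diagonal of the triangular Jacobian
  matrix gives \<open>n \<integral> G\<^bsup>1-1/n\<^esup> \<le> \<integral> F\<^bsup>1-1/n\<^esup> div T\<close>; integration by parts along each coordinate and the
  Hoelder inequality bound the right-hand side by the gradient norm, with equality if \<open>F = G\<close>. Only
  the diagonal derivatives of \<open>T\<close> enter, and these are quotients of conditional densities. On a cube all
  densities are continuous and positive, so \<open>T\<close> is elementary; the general case follows by limits.

  Polar coordinates come from the product of a radial measure with the direction distribution in the
  unit ball, which replaces both the surface measure and the Jacobian determinant of radial maps.
  Optimality is tested on smooth truncations \<open>H\<^sub>k \<circ> U\<^sub>R\<close> with \<open>0 \<le> H\<^sub>k' \<le> 1\<close> and \<open>H\<^sub>k' \<longlonglongrightarrow> 1\<close>.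
\<close>

subsection \<open>Averages over the unit cube\<close>

hide_const (open) Polynomial.content

text \<open>The change of variables is an isometry for the following reason. If s^(-\<alpha>) =
  r^(-\<alpha>) - R^(-\<alpha>), then ds/dr = (s/r)^(\<alpha>+1), while tangential directions are
  stretched by s/r only. The quotient (s/r)^\<alpha> of the two rates is 1/w with w = 1 -
  (r/R)^\<alpha>, and w is \<alpha> times the logarithm in the theorem, that is, the divisor of the
  tangential part in \<open>Lp\<close>. So \<open>Lp\<close> of u has the length of the transformed
  gradient times (s/r)^(\<alpha>+1). The Jacobian is (s/r)^(n+\<alpha>); since (\<alpha>+1) p = n +
  \<alpha>, it is absorbed by the p-th power of that factor, and since \<alpha> e = n + \<alpha> for
  e = p (n-1)/(n-p), it equals the weight w^(-e) on the left-hand side. The power of (n-p)/(p-1) in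
  the theorem only pays for replacing the logarithm by w.

  Equality for the extremal function is not traced back through the transport argument. Both of its
  norms are computed from two Beta integrals, the mass and a moment of the extremal density, and the
  same two numbers produce the gamma factors of the constant.\<close>

definition upd :: "real ^ 'n \<Rightarrow> 'n \<Rightarrow> real \<Rightarrow> real ^ 'n" where
  "upd x j s = (\<chi> i. if i = j then s else x $ i)"

lemma upd_nth [simp]: "upd x j s $ i = (if i = j then s else x $ i)"
  by (simp add: upd_def)

lemma upd_same [simp]: "upd x j (x $ j) = x"
  by (simp add: vec_eq_iff)

lemma upd_upd [simp]: "upd (upd x j s) j t = upd x j t"
  by (simp add: vec_eq_iff)

lemma continuous_on_upd [continuous_intros]:
  assumes "continuous_on S f" "continuous_on S g"
  shows "continuous_on S (\<lambda>z. upd (f z) j (g z))"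
  unfolding upd_def
proof (intro continuous_on_vec_lambda)
  fix i show "continuous_on S (\<lambda>z. if i = j then g z else f z $ i)"
    using assms by (cases "i = j") (auto intro: continuous_intros)
qed

abbreviation unit_cube :: "(real ^ 'n) set" where
  "unit_cube \<equiv> cbox 0 1"

lemma mem_unit_cube: "x \<in> unit_cube \<longleftrightarrow> (\<forall>i. 0 \<le> x $ i \<and> x $ i \<le> 1)"
  by (auto simp: mem_box_cart)

lemma content_unit_cube [simp]: "content (unit_cube :: (real ^ 'n) set) = 1"
proof -
  have "(0::real^'n) \<in> unit_cube" by (simp add: mem_unit_cube)
  then show ?thesis by (subst content_cbox_cart) auto
qed

lemma continuous_on_integral_upd:
  fixes \<phi> :: "real ^ 'n \<Rightarrow> real"
  assumes "continuous_on UNIV \<phi>"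
  shows "continuous_on UNIV (\<lambda>x. integral {0..1} (\<lambda>s. \<phi> (upd x j s)))"
proof -
  have "continuous_on (UNIV \<times> cbox 0 1) (\<lambda>(x, s). \<phi> (upd x j s))"
    unfolding case_prod_beta by (auto intro!: continuous_on_compose2[OF assms] continuous_intros)
  from integral_continuous_on_param[OF this] show ?thesis by simp
qed

text \<open>Fubini in a single coordinate. Averaging over \<open>x $ j\<close> leaves a function on
  the same cube, so marginals need no space of lower dimension and the induction over coordinates
  stays within one type.\<close>

lemma integral_average:
  fixes \<phi> :: "real ^ 'n \<Rightarrow> real"
  assumes cont: "continuous_on UNIV \<phi>"
  shows "integral unit_cube (\<lambda>x. integral {0..1} (\<lambda>s. \<phi> (upd x j s))) = integral unit_cube \<phi>"
proof -
  \<comment> \<open>\<open>g\<close> exchanges the coordinate \<open>x $ j\<close> with the additional variable; it preserves volume.\<close>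
  define g :: "(real ^ 'n) \<times> real \<Rightarrow> (real ^ 'n) \<times> real" where
    "g = (\<lambda>(x, s). (upd x j s, x $ j))"
  have gg: "g (g z) = z" for z
    by (cases z) (simp add: g_def)
  have contg: "continuous_on UNIV g"
    unfolding g_def case_prod_beta by (intro continuous_intros)
  have img: "g ` cbox (u, c) (v, d) = cbox (upd u j c, u $ j) (upd v j d, v $ j)" for u v c d
  proof -
    have sub: "g ` cbox (u, c) (v, d) \<subseteq> cbox (upd u j c, u $ j) (upd v j d, v $ j)" for u v c d
      by (auto simp: g_def cbox_Pair_eq mem_box_cart)
    have "z \<in> g ` cbox (u, c) (v, d)" if "z \<in> cbox (upd u j c, u $ j) (upd v j d, v $ j)" for z
    proof -
      have "g z \<in> cbox (u, c) (v, d)"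
        using that sub[of "upd u j c" "u $ j" "upd v j d" "v $ j"] by auto
      then show ?thesis using gg by (metis imageI)
    qed
    with sub show ?thesis by blast
  qed
  have img': "\<exists>w z. g ` cbox u v = cbox w z" for u v
    using img by (metis surj_pair)
  have cont_img: "content (g ` cbox u v) = 1 * content (cbox u v)" for u v
  proof -
    obtain u1 u2 v1 v2 where [simp]: "u = (u1, u2)" "v = (v1, v2)" by (metis surj_pair)
    show ?thesis
    proof (cases "cbox u v = {}")
      case False
      then have "g ` cbox u v \<noteq> {}" by simp
      then have "cbox (upd u1 j u2) (upd v1 j v2) \<times> cbox (u1 $ j) (v1 $ j) \<noteq> {}"
        unfolding \<open>u = _\<close> \<open>v = _\<close> img unfolding cbox_Pair_eq .
      then have ne': "cbox (upd u1 j u2) (upd v1 j v2) \<noteq> {}" "cbox (u1 $ j) (v1 $ j) \<noteq> {}"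
        by blast+
      have ne: "cbox u1 v1 \<noteq> {}" "cbox u2 v2 \<noteq> {}"
        using False by (auto simp: cbox_Pair_eq)
      have "(\<Prod>i\<in>UNIV. upd v1 j v2 $ i - upd u1 j u2 $ i) * (v1 $ j - u1 $ j)
          = (\<Prod>i\<in>UNIV. v1 $ i - u1 $ i) * (v2 - u2)"
        by (simp add: prod.remove[of UNIV j])
      then show ?thesis
        using ne ne' by (simp add: img content_Pair content_cbox_cart)
    qed (simp add: img)
  qed
  let ?f = "\<lambda>z::(real ^ 'n) \<times> real. \<phi> (fst z)"
  have contf: "continuous_on S ?f" for S
    by (intro continuous_on_compose2[OF cont] continuous_intros) auto
  have int: "(?f has_integral integral (cbox (0,0) (1,1)) ?f) (cbox (0,0) (1,1))"
    using contf by (intro integrable_integral integrable_continuous)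
  have "((\<lambda>z. ?f (g z)) has_integral (1/1) *\<^sub>R integral (cbox (0,0) (1,1)) ?f) (g ` cbox (0,0) (1,1))"
  proof (rule has_integral_twiddle[OF _ gg gg _ img' img' cont_img int])
    show "continuous (at x) g" for x
      using continuous_on_eq_continuous_at[OF open_UNIV, THEN iffD1, OF contg] by (rule bspec) simp
  qed simp
  moreover have "g ` cbox (0,0) (1,1) = cbox (0,0) (1,1)"
  proof -
    have "upd (0::real^'n) j 0 = 0" "upd (1::real^'n) j 1 = 1" by (simp_all add: vec_eq_iff)
    then show ?thesis by (simp add: img)
  qed
  ultimately have "integral (cbox (0,0) (1,1)) (\<lambda>z. ?f (g z)) = integral (cbox (0,0) (1,1)) ?f"
    by (simp add: integral_unique)
  moreover have "integral (cbox (0,0) (1,1)) (\<lambda>z. ?f (g z))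
      = integral unit_cube (\<lambda>x. integral (cbox 0 1) (\<lambda>s. \<phi> (upd x j s)))"
    by (subst integral_prod_continuous)
      (auto simp: g_def case_prod_beta intro!: continuous_on_compose2[OF cont] continuous_intros)
  moreover have "integral (cbox (0,0) (1,1)) ?f
      = integral unit_cube (\<lambda>x. integral (cbox 0 1) (\<lambda>s::real. \<phi> x))"
    by (subst integral_prod_continuous) (auto intro!: contf)
  ultimately show ?thesis by simp
qed

section \<open>Continuity and derivatives of implicitly given functions\<close>

text \<open>Stretching \<open>{0..1}\<close> onto \<open>{0..c z}\<close> moves the variable limit
  into the integrand, where continuity in a parameter applies.\<close>

lemma continuous_on_integral_upper_limit:
  fixes \<Gamma> :: "'a::euclidean_space \<Rightarrow> real \<Rightarrow> real"
  assumes \<Gamma>: "continuous_on UNIV (\<lambda>z. \<Gamma> (fst z) (snd z))"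
    and c: "continuous_on UNIV c" "\<And>z. 0 \<le> c z"
  shows "continuous_on UNIV (\<lambda>z. integral {0..c z} (\<Gamma> z))"
proof -
  have eq: "integral {0..c z} (\<Gamma> z) = c z * integral {0..1} (\<lambda>t. \<Gamma> z (c z * t))" for z
  proof (cases "c z = 0")
    case False
    with c(2)[of z] have pos: "0 < c z" by simp
    have "(\<lambda>x. x / c z) ` {0..c z} = {0..1}"
      using pos by simp
    then show ?thesis
      using integral_stretch_real[of "c z" 0 "c z" "\<Gamma> z"] pos by (simp add: mult.commute)
  qed simp
  show ?thesis
    unfolding eq
  proof (intro continuous_intros c)
    show "continuous_on UNIV (\<lambda>z. integral {0..1} (\<lambda>t. \<Gamma> z (c z * t)))"
    proof -
      have "continuous_on (UNIV \<times> cbox 0 1) (\<lambda>(z, t). \<Gamma> z (c z * t))"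
        unfolding case_prod_beta
        by (rule continuous_on_compose2[OF \<Gamma>, of _ "\<lambda>z. (fst z, c (fst z) * snd z)", simplified])
          (auto intro!: continuous_intros continuous_on_compose2[OF c(1)])
      from integral_continuous_on_param[OF this] show ?thesis by simp
    qed
  qed
qed

text \<open>Only continuity of \<tau> is asked for. In Caratheodory's form of the derivative, the
  increment of \<Gamma> along \<tau> is a continuous factor times the increment of \<tau>; the
  factor is nonzero near \<open>s0\<close>, so the equation can be solved for the increment of
  \<tau>.\<close>

lemma DERIV_implicit:
  fixes \<Gamma> p \<tau> :: "real \<Rightarrow> real"
  assumes \<Gamma>: "DERIV \<Gamma> (\<tau> s0) :> D" and D: "D \<noteq> 0" and p: "DERIV p s0 :> E"
    and \<tau>: "isCont \<tau> s0" and eq: "\<forall>\<^sub>F s in nhds s0. \<Gamma> (\<tau> s) = p s"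
  shows "DERIV \<tau> s0 :> E / D"
proof -
  obtain \<phi> where \<phi>: "\<And>t. \<Gamma> t - \<Gamma> (\<tau> s0) = \<phi> t * (t - \<tau> s0)" "isCont \<phi> (\<tau> s0)" "\<phi> (\<tau> s0) = D"
    using \<Gamma> unfolding CARAT_DERIV by blast
  obtain \<psi> where \<psi>: "\<And>t. p t - p s0 = \<psi> t * (t - s0)" "isCont \<psi> s0" "\<psi> s0 = E"
    using p unfolding CARAT_DERIV by blast
  have cont: "isCont (\<lambda>s. \<phi> (\<tau> s)) s0"
    using isCont_o2[OF \<tau> \<phi>(2)] .
  then have "\<forall>\<^sub>F s in at s0. \<phi> (\<tau> s) \<noteq> 0"
    using D \<phi>(3) unfolding isCont_def by (intro tendsto_imp_eventually_ne) auto
  then have nz: "\<forall>\<^sub>F s in nhds s0. \<phi> (\<tau> s) \<noteq> 0"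
    using D \<phi>(3) by (auto simp: eventually_at_filter elim!: eventually_mono)
  define \<theta> where "\<theta> s = (\<psi> s / \<phi> (\<tau> s)) * (s - s0) + \<tau> s0" for s
  have "DERIV \<theta> s0 :> E / D"
    unfolding CARAT_DERIV
  proof (intro exI[of _ "\<lambda>s. \<psi> s / \<phi> (\<tau> s)"] conjI allI)
    show "isCont (\<lambda>s. \<psi> s / \<phi> (\<tau> s)) s0"
      using \<psi>(2) cont \<phi>(3) D by (intro continuous_intros) auto
  qed (auto simp: \<theta>_def \<phi>(3) \<psi>(3))
  moreover have "\<forall>\<^sub>F s in nhds s0. \<tau> s = \<theta> s"
    using nz eq
  proof eventually_elim
    case (elim s)
    have "\<Gamma> (\<tau> s0) = p s0" using eq eventually_nhds_x_imp_x by blast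
    then have "\<phi> (\<tau> s) * (\<tau> s - \<tau> s0) = \<psi> s * (s - s0)"
      using \<phi>(1)[of "\<tau> s"] \<psi>(1)[of s] elim by simp
    then show ?case using elim by (simp add: \<theta>_def field_simps)
  qed
  ultimately show ?thesis
    using DERIV_cong_ev[OF refl _ refl] by blast
qed

subsection \<open>Monotone transport along a coordinate\<close>

text \<open>Functions of fewer variables are kept as functions on the full space, with the set of
  relevant coordinates as an explicit parameter for the induction.\<close>

definition depends_on :: "'n set \<Rightarrow> (real ^ 'n \<Rightarrow> 'b) \<Rightarrow> bool" where
  "depends_on I f \<longleftrightarrow> (\<forall>x y. (\<forall>i\<in>I. x $ i = y $ i) \<longrightarrow> f x = f y)"

lemma depends_onD: "depends_on I f \<Longrightarrow> (\<And>i. i \<in> I \<Longrightarrow> x $ i = y $ i) \<Longrightarrow> f x = f y"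
  by (auto simp: depends_on_def)

lemma depends_on_upd: "depends_on I f \<Longrightarrow> j \<notin> I \<Longrightarrow> f (upd x j s) = f x"
  by (erule depends_onD) auto

text \<open>Not normalised: at \<open>t = 1\<close> this is the marginal density of \<open>F\<close>
  with coordinate \<open>j\<close> integrated out, and quotients by that value are conditional
  distribution functions.\<close>

definition cdf :: "'n \<Rightarrow> (real ^ 'n \<Rightarrow> real) \<Rightarrow> real ^ 'n \<Rightarrow> real \<Rightarrow> real" where
  "cdf j F x t = integral {0..t} (\<lambda>s. F (upd x j s))"

lemma cdf_upd [simp]: "cdf j F (upd x j s) = cdf j F x"
  by (simp add: cdf_def fun_eq_iff)

lemma depends_on_cdf: "depends_on (insert j I) F \<Longrightarrow> depends_on I (\<lambda>x. cdf j F x t)"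
  unfolding depends_on_def[of I] cdf_def
  by (intro allI impI arg_cong[where f = "integral _"] ext) (auto elim!: depends_onD)

context
  fixes F :: "real ^ 'n \<Rightarrow> real" and j :: 'n
  assumes cont: "continuous_on UNIV F" and pos: "\<And>x. 0 < F x"
begin

lemma continuous_on_line: "continuous_on S (\<lambda>s. F (upd x j s))"
  by (intro continuous_on_compose2[OF cont] continuous_intros) auto

lemma integrable_line: "(\<lambda>s. F (upd x j s)) integrable_on {a..b}"
  by (intro integrable_continuous_real continuous_on_line)

lemma cdf_0 [simp]: "cdf j F x 0 = 0"
  by (simp add: cdf_def)

lemma cdf_deriv: "0 < t \<Longrightarrow> t < 1 \<Longrightarrow> DERIV (cdf j F x) t :> F (upd x j t)"
  using integral_has_real_derivative[OF continuous_on_line[of "{0..1}" x], of t]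
  by (simp add: cdf_def[abs_def] at_within_Icc_at)

lemma cdf_strict_mono:
  assumes "0 \<le> s" "s < t" shows "cdf j F x s < cdf j F x t"
proof -
  have "integral {0..s} (\<lambda>s. F (upd x j s)) + integral {s..t} (\<lambda>s. F (upd x j s)) = cdf j F x t"
    unfolding cdf_def using assms by (intro Henstock_Kurzweil_Integration.integral_combine integrable_line) auto
  moreover have "0 < integral {s..t} (\<lambda>s. F (upd x j s))"
    using integral_less_real[of s t "\<lambda>_. 0" "\<lambda>s. F (upd x j s)"] continuous_on_line pos assms
    by auto
  ultimately show ?thesis by (simp add: cdf_def)
qed

lemma cdf_pos: "0 < t \<Longrightarrow> 0 < cdf j F x t"
  using cdf_strict_mono[of 0 t x] by simp

lemma continuous_on_cdf:
  assumes "continuous_on UNIV c" "\<And>z. 0 \<le> c z" "continuous_on UNIV y"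
  shows "continuous_on UNIV (\<lambda>z::'b::euclidean_space. cdf j F (y z) (c z))"
  unfolding cdf_def
proof (rule continuous_on_integral_upper_limit)
  show "continuous_on UNIV (\<lambda>z::'b \<times> real. F (upd (y (fst z)) j (snd z)))"
    by (intro continuous_on_compose2[OF cont] continuous_intros continuous_on_compose2[OF assms(3)]) auto
qed (use assms in auto)

lemma continuous_on_cdf_real: "continuous_on {0..} (cdf j F x)"
proof -
  have "continuous_on UNIV (\<lambda>t::real. cdf j F x (max 0 t))"
    by (intro continuous_on_cdf continuous_intros) auto
  then have "continuous_on {0..} (\<lambda>t::real. cdf j F x (max 0 t))"
    by (rule continuous_on_subset) auto
  then show ?thesis
    by (rule continuous_on_eq) auto
qed

end

text \<open>Clamping \<open>x $ j\<close> to \<open>[0, 1]\<close> makes the transport continuous on the whole space.\<close>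

definition transport1 :: "'n \<Rightarrow> (real ^ 'n \<Rightarrow> real) \<Rightarrow> (real ^ 'n \<Rightarrow> real) \<Rightarrow> real ^ 'n \<Rightarrow> real ^ 'n \<Rightarrow> real" where
  "transport1 j F G y x = (THE t. 0 \<le> t \<and> t \<le> 1 \<and>
     cdf j G y t / cdf j G y 1 = cdf j F x (min 1 (max 0 (x $ j))) / cdf j F x 1)"

context
  fixes F G :: "real ^ 'n \<Rightarrow> real" and j :: 'n
  assumes F: "continuous_on UNIV F" "\<And>x. 0 < F x" and G: "continuous_on UNIV G" "\<And>x. 0 < G x"
begin

lemma transport1_unique:
  assumes "0 \<le> t" "t \<le> 1" "0 \<le> t'" "t' \<le> 1" "cdf j G y t / cdf j G y 1 = cdf j G y t' / cdf j G y 1"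
  shows "t = t'"
proof -
  have "cdf j G y t = cdf j G y t'"
    using assms(5) cdf_pos[OF G, of 1 j y] by simp
  then show ?thesis
    using cdf_strict_mono[OF G, of t t' j y] cdf_strict_mono[OF G, of t' t j y] assms by (cases t t' rule: linorder_cases) auto
qed

lemma transport1_ex1:
  "\<exists>!t. 0 \<le> t \<and> t \<le> 1 \<and>
     cdf j G y t / cdf j G y 1 = cdf j F x (min 1 (max 0 (x $ j))) / cdf j F x 1"
proof -
  let ?c = "min 1 (max 0 (x $ j))"
  have p: "0 < cdf j F x 1" "0 < cdf j G y 1" using cdf_pos[OF F] cdf_pos[OF G] by auto
  have nonneg: "0 \<le> cdf j F x c" if "0 \<le> c" for c
    using cdf_pos[OF F, of c j x] cdf_0[OF F, of j x] that by (cases "c = 0") auto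
  have "0 \<le> cdf j F x ?c" by (rule nonneg) simp
  moreover have le: "cdf j F x c \<le> cdf j F x 1" if "0 \<le> c" "c \<le> 1" for c
    using cdf_strict_mono[OF F, of c 1 j x] that by (cases "c = 1") auto
  have "cdf j F x ?c \<le> cdf j F x 1" by (rule le) auto
  ultimately have P: "0 \<le> cdf j F x ?c / cdf j F x 1" "cdf j F x ?c / cdf j F x 1 \<le> 1" using p by auto
  have "continuous_on {0..1} (\<lambda>t. cdf j G y t / cdf j G y 1)"
    using p by (intro continuous_intros continuous_on_subset[OF continuous_on_cdf_real[OF G]]) auto
  then obtain t where "0 \<le> t" "t \<le> 1" "cdf j G y t / cdf j G y 1 = cdf j F x ?c / cdf j F x 1"
    using IVT'[of "\<lambda>t. cdf j G y t / cdf j G y 1" 0 "cdf j F x ?c / cdf j F x 1" 1] P p cdf_0[OF G] by auto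
  then show ?thesis
    by (intro ex1I[of _ t] conjI)
      (auto intro: transport1_unique[where y = y] elim!: trans dest: sym simp del: divide_cancel_right)
qed

lemma transport1:
  shows transport1_ge_0: "0 \<le> transport1 j F G y x"
    and transport1_le_1: "transport1 j F G y x \<le> 1"
    and transport1_eq: "cdf j G y (transport1 j F G y x) / cdf j G y 1
      = cdf j F x (min 1 (max 0 (x $ j))) / cdf j F x 1"
  using theI'[OF transport1_ex1[of y x]] by (simp_all only: transport1_def[symmetric])

lemma transport1_eqI:
  "0 \<le> t \<Longrightarrow> t \<le> 1 \<Longrightarrow> cdf j G y t / cdf j G y 1 = cdf j F x (min 1 (max 0 (x $ j))) / cdf j F x 1
    \<Longrightarrow> transport1 j F G y x = t"
  by (rule transport1_unique[where y = y, OF transport1_ge_0 transport1_le_1 _ _ trans[OF transport1_eq sym]])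

text \<open>A map into a compact set is continuous as soon as its graph is closed. Here the graph is
  cut out by one continuous equation, because the defining equation has a unique solution in the
  unit interval.\<close>

lemma continuous_on_transport1:
  assumes y: "continuous_on UNIV y"
  shows "continuous_on UNIV (\<lambda>x. transport1 j F G (y x) x)"
proof (rule continuous_from_closed_graph)
  show "compact {0..1::real}" by simp
  show "(\<lambda>x. transport1 j F G (y x) x) \<in> UNIV \<rightarrow> {0..1}"
    using transport1_ge_0 transport1_le_1 by auto
  \<comment> \<open>The clamp on \<open>snd z\<close> changes nothing for values in the unit
    interval, but it supplies the nonnegative upper limit that \<open>continuous_on_cdf\<close> asks
    for.\<close>
  define L where "L z = cdf j G (y (fst z)) (min 1 (max 0 (snd z))) / cdf j G (y (fst z)) 1
      - cdf j F (fst z) (min 1 (max 0 (fst z $ j))) / cdf j F (fst z) 1" for z :: "(real ^ 'n) \<times> real"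
  have nz: "cdf j F x 1 \<noteq> 0" "cdf j G x 1 \<noteq> 0" for x
    using cdf_pos[OF F, of 1 j x] cdf_pos[OF G, of 1 j x] by auto
  have "continuous_on UNIV L"
    unfolding L_def
    by (intro continuous_intros continuous_on_cdf[OF G] continuous_on_cdf[OF F]
        continuous_on_compose2[OF y]) (auto simp: nz)
  then have "closed (L -` {0} \<inter> (UNIV \<times> {0..1}))"
    by (intro closed_Int closed_vimage closed_Times) auto
  moreover have "(\<lambda>x. (x, transport1 j F G (y x) x)) ` UNIV = L -` {0} \<inter> (UNIV \<times> {0..1})"
  proof (intro equalityI subsetI)
    fix z assume "z \<in> L -` {0} \<inter> (UNIV \<times> {0..1})"
    then have "transport1 j F G (y (fst z)) (fst z) = snd z"
      by (intro transport1_eqI) (auto simp: L_def)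
    then show "z \<in> (\<lambda>x. (x, transport1 j F G (y x) x)) ` UNIV"
      by (intro image_eqI[of _ _ "fst z"]) auto
  next
    fix z assume "z \<in> (\<lambda>x. (x, transport1 j F G (y x) x)) ` UNIV"
    then obtain x where z: "z = (x, transport1 j F G (y x) x)" by auto
    show "z \<in> L -` {0} \<inter> (UNIV \<times> {0..1})"
      using transport1[of "y x" x] by (simp add: z L_def)
  qed
  ultimately show "closed ((\<lambda>x. (x, transport1 j F G (y x) x)) ` UNIV)" by simp
qed

lemma transport1_line:
  assumes "0 \<le> s" "s \<le> 1"
  shows "cdf j G y (transport1 j F G y (upd x j s)) / cdf j G y 1 = cdf j F x s / cdf j F x 1"
  using transport1_eq[of y "upd x j s"] assms by simp

lemma transport1_ends: "transport1 j F G y (upd x j 0) = 0" "transport1 j F G y (upd x j 1) = 1"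
  using cdf_pos[OF F, of 1 j x] cdf_pos[OF G, of 1 j y]
  by (auto intro!: transport1_eqI simp: cdf_0[OF F] cdf_0[OF G])

lemma transport1_inner:
  assumes "0 < s" "s < 1"
  shows "0 < transport1 j F G y (upd x j s)" "transport1 j F G y (upd x j s) < 1"
proof -
  let ?t = "transport1 j F G y (upd x j s)"
  have p: "0 < cdf j F x 1" "0 < cdf j G y 1" "0 < cdf j F x s" "cdf j F x s < cdf j F x 1"
    using cdf_pos[OF F] cdf_pos[OF G] cdf_strict_mono[OF F] assms by auto
  have eq: "cdf j G y ?t / cdf j G y 1 = cdf j F x s / cdf j F x 1"
    using transport1_line assms by simp
  have "?t \<noteq> 0"
  proof
    assume "?t = 0"
    then show False using eq p cdf_0[OF G] by simp
  qed
  moreover have "?t \<noteq> 1"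
  proof
    assume "?t = 1"
    then show False using eq p by simp
  qed
  ultimately show "0 < ?t" "?t < 1"
    using transport1_ge_0[of y "upd x j s"] transport1_le_1[of y "upd x j s"] by auto
qed

text \<open>Source and target lines are decoupled: the conditional density of \<open>F\<close> is
  taken along the line through \<open>x\<close>, that of \<open>G\<close> along the line through
  \<open>y\<close>. In the Knothe map \<open>y\<close> is the image of \<open>x\<close> under the
  part of the map already built.\<close>

lemma transport1_deriv:
  assumes "0 < s" "s < 1"
  shows "DERIV (\<lambda>s. transport1 j F G y (upd x j s)) s :>
    (F (upd x j s) / cdf j F x 1) / (G (upd y j (transport1 j F G y (upd x j s))) / cdf j G y 1)"
proof (rule DERIV_implicit)
  let ?\<tau> = "\<lambda>s. transport1 j F G y (upd x j s)"
  show "DERIV (\<lambda>t. cdf j G y t / cdf j G y 1) (?\<tau> s) :> G (upd y j (?\<tau> s)) / cdf j G y 1"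
    by (intro DERIV_cdivide cdf_deriv[OF G] transport1_inner assms)
  show "G (upd y j (?\<tau> s)) / cdf j G y 1 \<noteq> 0"
    using G(2)[of "upd y j (?\<tau> s)"] cdf_pos[OF G, of 1 j y] by simp
  show "DERIV (\<lambda>s. cdf j F x s / cdf j F x 1) s :> F (upd x j s) / cdf j F x 1"
    by (intro DERIV_cdivide cdf_deriv[OF F] assms)
  have "continuous_on UNIV ?\<tau>"
    by (rule continuous_on_compose2[OF continuous_on_transport1[of "\<lambda>_. y"]]) (auto intro!: continuous_intros)
  then show "isCont ?\<tau> s" by (simp add: continuous_on_eq_continuous_at)
  have "\<forall>\<^sub>F s in nhds s. s \<in> {0<..<1}"
    using assms by (intro eventually_nhds_in_open) auto
  then show "\<forall>\<^sub>F s in nhds s. cdf j G y (?\<tau> s) / cdf j G y 1 = cdf j F x s / cdf j F x 1"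
    by eventually_elim (simp add: transport1_line)
qed

text \<open>A primitive \<open>W\<close> of the right-hand integrand, composed with the transport,
  has the left-hand integrand as derivative up to the ratio of the marginals, and the transport
  fixes 0 and 1. The fundamental theorem with derivatives at interior points then suffices.\<close>

lemma transport1_push:
  assumes k: "continuous_on UNIV k"
  shows "integral {0..1} (\<lambda>s. k (transport1 j F G y (upd x j s)) * F (upd x j s))
    = cdf j F x 1 / cdf j G y 1 * integral {0..1} (\<lambda>t. k t * G (upd y j t))"
proof -
  let ?\<tau> = "\<lambda>s. transport1 j F G y (upd x j s)"
  let ?w = "\<lambda>t. k t * G (upd y j t)"
  let ?c = "cdf j F x 1 / cdf j G y 1"
  define W where "W t = integral {0..t} ?w" for t
  have p: "0 < cdf j F x 1" "0 < cdf j G y 1" using cdf_pos[OF F] cdf_pos[OF G] by auto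
  have contw: "continuous_on {0..1} ?w"
    by (intro continuous_intros continuous_on_line[OF G] continuous_on_subset[OF k]) auto
  have cont\<tau>: "continuous_on {0..1} ?\<tau>"
    by (rule continuous_on_compose2[OF continuous_on_transport1[of "\<lambda>_. y"]]) (auto intro!: continuous_intros)
  have contW: "continuous_on {0..1} W"
    unfolding W_def by (intro indefinite_integral_continuous_1 integrable_continuous_real contw)
  have "((\<lambda>s. k (?\<tau> s) * F (upd x j s)) has_integral ?c * W (?\<tau> 1) - ?c * W (?\<tau> 0)) {0..1}"
  proof (rule fundamental_theorem_of_calculus_interior)
    show "continuous_on {0..1} (\<lambda>s. ?c * W (?\<tau> s))"
      by (intro continuous_intros continuous_on_compose2[OF contW cont\<tau>])
         (use transport1_ge_0 transport1_le_1 in auto)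
    fix s :: real assume s: "s \<in> {0<..<1}"
    have t: "0 < ?\<tau> s" "?\<tau> s < 1" using s transport1_inner by auto
    have "DERIV W (?\<tau> s) :> ?w (?\<tau> s)"
      using integral_has_real_derivative[OF contw, of "?\<tau> s"] t
      by (simp add: W_def[abs_def] at_within_Icc_at)
    from DERIV_chain2[OF this transport1_deriv] s
    have "DERIV (\<lambda>s. ?c * W (?\<tau> s)) s :> ?c * (?w (?\<tau> s) *
        ((F (upd x j s) / cdf j F x 1) / (G (upd y j (?\<tau> s)) / cdf j G y 1)))"
      by (intro DERIV_cmult) auto
    also have "?c * (?w (?\<tau> s) * ((F (upd x j s) / cdf j F x 1) / (G (upd y j (?\<tau> s)) / cdf j G y 1)))
        = k (?\<tau> s) * F (upd x j s)"
      using p G(2)[of "upd y j (?\<tau> s)"] by (simp add: field_simps)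
    finally show "((\<lambda>s. ?c * W (?\<tau> s)) has_vector_derivative k (?\<tau> s) * F (upd x j s)) (at s)"
      by (simp add: has_real_derivative_iff_has_vector_derivative)
  qed simp
  then show ?thesis
    by (simp add: integral_unique transport1_ends W_def)
qed

end

subsection \<open>The Knothe map\<close>

text \<open>The \<open>D i\<close> are the diagonal entries of the Jacobian matrix of the triangular map \<open>T\<close>.\<close>

definition knothe_map ::
    "'n set \<Rightarrow> (real ^ 'n \<Rightarrow> real) \<Rightarrow> (real ^ 'n \<Rightarrow> real) \<Rightarrow> (real ^ 'n \<Rightarrow> real ^ 'n) \<Rightarrow> ('n \<Rightarrow> real ^ 'n \<Rightarrow> real) \<Rightarrow> bool"
where
  "knothe_map I F G T D \<longleftrightarrow>
     continuous_on UNIV T \<and> (\<forall>x. T x \<in> unit_cube) \<and> depends_on I T \<and>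
     (\<forall>i\<in>I. continuous_on UNIV (D i) \<and> (\<forall>x. 0 < D i x) \<and>
        (\<forall>x. 0 < x $ i \<longrightarrow> x $ i < 1 \<longrightarrow> DERIV (\<lambda>s. T (upd x i s) $ i) (x $ i) :> D i x)) \<and>
     (\<forall>x. G (T x) * (\<Prod>i\<in>I. D i x) = F x) \<and>
     (\<forall>h. continuous_on UNIV h \<longrightarrow> depends_on I h \<longrightarrow>
        integral unit_cube (\<lambda>x. h (T x) * F x) = integral unit_cube (\<lambda>y. h y * G y))"

lemma integrable_unit_cube:
  "continuous_on UNIV (h :: real ^ 'n \<Rightarrow> real) \<Longrightarrow> h integrable_on unit_cube"
  by (rule integrable_continuous, rule continuous_on_subset) auto

lemma integral_unit_cube_pos:
  fixes h :: "real ^ 'n \<Rightarrow> real"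
  assumes "continuous_on UNIV h" "\<And>x. 0 < h x"
  shows "0 < integral unit_cube h"
  using integral_less[of "0::real^'n" 1 "\<lambda>_. 0" h] assms continuous_on_subset[OF assms(1)]
  by (auto simp: mem_box_cart interval_ne_empty_cart)

lemma integral_marginal:
  assumes "continuous_on UNIV (F :: real ^ 'n \<Rightarrow> real)"
  shows "integral unit_cube (\<lambda>x. cdf j F x 1) = integral unit_cube F"
  unfolding cdf_def by (rule integral_average[OF assms])

lemma continuous_on_marginal:
  assumes "continuous_on UNIV (F :: real ^ 'n \<Rightarrow> real)"
  shows "continuous_on UNIV (\<lambda>x. cdf j F x 1)"
  unfolding cdf_def by (rule continuous_on_integral_upd[OF assms])

text \<open>\<open>T'\<close> transports the marginals; the new coordinate transports the
  conditional density of \<open>F\<close> on the line through \<open>x\<close> to that of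
  \<open>G\<close> on the line through \<open>T' x\<close>. Since \<open>T'\<close> ignores
  \<open>x $ j\<close>, that line has a single target line, and the coordinates of \<open>I\<close>
  keep their diagonal derivatives.\<close>

lemma knothe_map_step:
  fixes F G :: "real ^ 'n \<Rightarrow> real"
  assumes j: "j \<notin> I" and fin: "finite I"
    and F: "continuous_on UNIV F" "\<And>x. 0 < F x" and G: "continuous_on UNIV G" "\<And>x. 0 < G x"
    and dep: "depends_on (insert j I) F" "depends_on (insert j I) G"
    and T': "knothe_map I (\<lambda>x. cdf j F x 1) (\<lambda>x. cdf j G x 1) T' D'"
  shows "\<exists>T D. knothe_map (insert j I) F G T D"
proof -
  define \<tau> where "\<tau> x = transport1 j F G (T' x) x" for x
  define T where "T x = upd (T' x) j (\<tau> x)" for x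
  define D where "D i x = (if i = j then (F x / cdf j F x 1) / (G (T x) / cdf j G (T' x) 1) else D' i x)" for i x
  have T'c: "continuous_on UNIV T'" and T'box: "\<And>x. T' x \<in> unit_cube" and T'dep: "depends_on I T'"
    and D'c: "\<And>i. i \<in> I \<Longrightarrow> continuous_on UNIV (D' i)" and D'pos: "\<And>i x. i \<in> I \<Longrightarrow> 0 < D' i x"
    and D'der: "\<And>i x. i \<in> I \<Longrightarrow> 0 < x $ i \<Longrightarrow> x $ i < 1 \<Longrightarrow> DERIV (\<lambda>s. T' (upd x i s) $ i) (x $ i) :> D' i x"
    and D'prod: "\<And>x. cdf j G (T' x) 1 * (\<Prod>i\<in>I. D' i x) = cdf j F x 1"
    and T'push: "\<And>h. continuous_on UNIV h \<Longrightarrow> depends_on I h \<Longrightarrow>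
        integral unit_cube (\<lambda>x. h (T' x) * cdf j F x 1) = integral unit_cube (\<lambda>y. h y * cdf j G y 1)"
    using T' unfolding knothe_map_def by blast+
  have pos: "0 < cdf j F x 1" "0 < cdf j G x 1" for x
    using cdf_pos[OF F] cdf_pos[OF G] by auto
  have nz: "cdf j F x 1 \<noteq> 0" "cdf j G x 1 \<noteq> 0" "G x \<noteq> 0" for x
    using pos[of x] G(2)[of x] by auto
  have T'upd: "T' (upd x j s) = T' x" for x s
    by (rule depends_on_upd[OF T'dep j])
  have \<tau>c: "continuous_on UNIV \<tau>"
    unfolding \<tau>_def by (rule continuous_on_transport1[OF F G T'c])
  have Tc: "continuous_on UNIV T"
    unfolding T_def by (intro continuous_intros T'c \<tau>c)
  have dj: "D j x = (F x / cdf j F x 1) / (G (T x) / cdf j G (T' x) 1)" for x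
    by (simp add: D_def)
  have box: "T x \<in> unit_cube" for x
    using T'box[of x] transport1_ge_0[OF F G] transport1_le_1[OF F G]
    unfolding mem_unit_cube by (auto simp: T_def \<tau>_def)
  have "depends_on (insert j I) T"
    unfolding depends_on_def
  proof (intro allI impI)
    fix x y :: "real ^ 'n" assume *: "\<forall>i\<in>insert j I. x $ i = y $ i"
    have 1: "T' x = T' y" using * by (intro depends_onD[OF T'dep]) auto
    have 2: "cdf j F x t = cdf j F y t" for t
      using * by (intro depends_onD[OF depends_on_cdf[OF dep(1)]]) auto
    show "T x = T y"
      using * unfolding T_def \<tau>_def transport1_def 1 2 by simp
  qed
  moreover have "continuous_on UNIV (D i) \<and> (\<forall>x. 0 < D i x) \<and>
        (\<forall>x. 0 < x $ i \<longrightarrow> x $ i < 1 \<longrightarrow> DERIV (\<lambda>s. T (upd x i s) $ i) (x $ i) :> D i x)"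
    if "i \<in> insert j I" for i
  proof (cases "i = j")
    case True
    have "continuous_on UNIV (D j)"
      unfolding dj
      by (intro continuous_intros F continuous_on_compose2[OF G(1) Tc]
          continuous_on_marginal[OF F(1)] continuous_on_compose2[OF continuous_on_marginal[OF G(1)] T'c])
        (auto simp: nz)
    moreover have "0 < D j x" for x
      unfolding dj using F(2)[of x] G(2)[of "T x"] pos by simp
    moreover have "DERIV (\<lambda>s. T (upd x j s) $ j) (x $ j) :> D j x" if "0 < x $ j" "x $ j < 1" for x
      using transport1_deriv[OF F G that, where j = j and y = "T' x" and x = x]
      by (simp add: T_def T'upd \<tau>_def dj)
    ultimately show ?thesis using True by simp
  next
    case False
    then have i: "i \<in> I" using that by simp
    have "D i = D' i" by (simp add: D_def False fun_eq_iff)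
    moreover have "T x $ i = T' x $ i" for x by (simp add: T_def False)
    ultimately show ?thesis using D'c[OF i] D'pos[OF i] D'der[OF i] by simp
  qed
  \<comment> \<open>The marginals in the new factor \<open>D j\<close> cancel against those in the
    product identity for \<open>T'\<close>.\<close>
  moreover have "G (T x) * (\<Prod>i\<in>insert j I. D i x) = F x" for x
  proof -
    have "(\<Prod>i\<in>insert j I. D i x) = D j x * (\<Prod>i\<in>I. D' i x)"
      using j fin by (auto simp: D_def intro!: prod.cong)
    then show ?thesis
      using nz(1)[of x] nz(2)[of "T' x"] nz(3)[of "T x"] D'prod[of x, symmetric]
      by (simp add: dj field_simps)
  qed
  moreover have "integral unit_cube (\<lambda>x. h (T x) * F x) = integral unit_cube (\<lambda>y. h y * G y)"
    if h: "continuous_on UNIV h" "depends_on (insert j I) h" for h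
  proof -
    \<comment> \<open>The conditional expectation of \<open>h\<close> under \<open>G\<close>, given
      the coordinates in \<open>I\<close>. It no longer depends on coordinate \<open>j\<close>, so
      the push-forward identity of \<open>T'\<close> applies to it.\<close>
    define h' where "h' y = cdf j (\<lambda>y. h y * G y) y 1 / cdf j G y 1" for y
    have hG: "continuous_on UNIV (\<lambda>y. h y * G y)" by (intro continuous_intros h G)
    have h'c: "continuous_on UNIV h'"
      unfolding h'_def by (intro continuous_intros continuous_on_marginal hG G) (auto simp: nz)
    have "depends_on (insert j I) (\<lambda>y. h y * G y)"
      using h(2) dep(2) unfolding depends_on_def by metis
    then have "depends_on I (\<lambda>y. cdf j (\<lambda>y. h y * G y) y 1)" "depends_on I (\<lambda>y. cdf j G y 1)"
      using dep(2) by (auto intro: depends_on_cdf)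
    then have h'd: "depends_on I h'"
      unfolding h'_def depends_on_def by (intro allI impI arg_cong2[where f = "(/)"]) blast+
    have line: "integral {0..1} (\<lambda>s. h (T (upd x j s)) * F (upd x j s)) = h' (T' x) * cdf j F x 1" for x
    proof -
      have "continuous_on UNIV (\<lambda>t. h (upd (T' x) j t))"
        by (intro continuous_on_compose2[OF h(1)] continuous_intros) auto
      from transport1_push[OF F G this, where j = j and y = "T' x" and x = x] show ?thesis
        by (simp add: T_def T'upd \<tau>_def h'_def cdf_def)
    qed
    have "integral unit_cube (\<lambda>x. h (T x) * F x)
        = integral unit_cube (\<lambda>x. integral {0..1} (\<lambda>s. h (T (upd x j s)) * F (upd x j s)))"
      by (intro integral_average[symmetric] continuous_intros F continuous_on_compose2[OF h(1) Tc]) auto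
    also have "\<dots> = integral unit_cube (\<lambda>y. h' y * cdf j G y 1)"
      unfolding line by (rule T'push[OF h'c h'd])
    also have "\<dots> = integral unit_cube (\<lambda>y. cdf j (\<lambda>y. h y * G y) y 1)"
      by (simp add: h'_def nz)
    also have "\<dots> = integral unit_cube (\<lambda>y. h y * G y)"
      by (rule integral_marginal[OF hG])
    finally show ?thesis .
  qed
  ultimately have "knothe_map (insert j I) F G T D"
    unfolding knothe_map_def using Tc box by blast
  then show ?thesis by blast
qed

lemma knothe_map_exists:
  fixes F G :: "real ^ 'n \<Rightarrow> real"
  assumes "finite I"
    and "continuous_on UNIV F" "\<And>x. 0 < F x" "continuous_on UNIV G" "\<And>x. 0 < G x"
    and "depends_on I F" "depends_on I G"
    and "integral unit_cube F = integral unit_cube G"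
  shows "\<exists>T D. knothe_map I F G T D"
  using assms
proof (induction I arbitrary: F G rule: finite_induct)
  case empty
  then have const: "F x = F 0" "G x = G 0" for x
    by (auto simp: depends_on_def)
  have "integral (unit_cube :: (real ^ 'n) set) (\<lambda>x. F 0) = integral (unit_cube :: (real ^ 'n) set) (\<lambda>x. G 0)"
    using empty.prems(7) by (metis (no_types, lifting) Henstock_Kurzweil_Integration.integral_cong const)
  then have eq: "F 0 = G 0" by simp
  have "integral unit_cube (\<lambda>x. h 0 * F x) = integral unit_cube (\<lambda>y. h y * G y)"
    if "depends_on {} h" for h :: "real ^ 'n \<Rightarrow> real"
  proof -
    have "h x * G x = h 0 * F x" for x
      using depends_onD[OF that, of x 0] const[of x] eq by simp
    then show ?thesis by simp
  qed
  \<comment> \<open>Without coordinates both densities are constant, and equal mass makes them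
    equal; the product of derivatives is empty, and a constant map into the cube will do.\<close>
  then have "knothe_map {} F G (\<lambda>x. 0) (\<lambda>i x. 0)"
    unfolding knothe_map_def using const eq by (auto simp: mem_unit_cube depends_on_def)
  then show ?case by blast
next
  case (insert j I)
  note F = insert.prems(1,2) and G = insert.prems(3,4)
  have "\<exists>T D. knothe_map I (\<lambda>x. cdf j F x 1) (\<lambda>x. cdf j G x 1) T D"
  proof (rule insert.IH)
    show "integral unit_cube (\<lambda>x. cdf j F x 1) = integral unit_cube (\<lambda>x. cdf j G x 1)"
      using insert.prems(7) by (simp add: integral_marginal F G)
  qed (use insert.prems in \<open>auto intro: continuous_on_marginal cdf_pos depends_on_cdf\<close>)
  then show ?case
    using knothe_map_step[OF insert.hyps(2,1) F G insert.prems(5,6)] by blast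
qed

subsection \<open>The sharp Sobolev inequality\<close>

lemma depends_on_UNIV: "depends_on UNIV f"
  unfolding depends_on_def by (metis UNIV_I vec_eq_iff)

text \<open>Young's inequality is applied to the functions divided by their norms. Since a norm may
  vanish, \<open>d > 0\<close> is first added to both integrals and then sent to 0.\<close>

lemma Holder_cbox:
  fixes a b :: "'a::euclidean_space \<Rightarrow> real"
  assumes p: "1 < p" "1 < q" "1 / p + 1 / q = 1"
    and a: "continuous_on (cbox u v) a" "\<And>x. x \<in> cbox u v \<Longrightarrow> 0 \<le> a x"
    and b: "continuous_on (cbox u v) b" "\<And>x. x \<in> cbox u v \<Longrightarrow> 0 \<le> b x"
  shows "integral (cbox u v) (\<lambda>x. a x * b x)
    \<le> integral (cbox u v) (\<lambda>x. a x powr p) powr (1 / p) * integral (cbox u v) (\<lambda>x. b x powr q) powr (1 / q)"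
proof -
  define A where "A = integral (cbox u v) (\<lambda>x. a x powr p)"
  define B where "B = integral (cbox u v) (\<lambda>x. b x powr q)"
  have inta: "(\<lambda>x. a x powr p) integrable_on cbox u v" and intb: "(\<lambda>x. b x powr q) integrable_on cbox u v"
    using p a b by (auto intro!: integrable_continuous continuous_on_powr' continuous_on_const)
  have nonneg: "0 \<le> A" "0 \<le> B"
    unfolding A_def B_def by (intro integral_nonneg inta intb; simp)+
  have le: "integral (cbox u v) (\<lambda>x. a x * b x) \<le> (A + d) powr (1 / p) * (B + d) powr (1 / q)" if d: "0 < d" for d
  proof -
    let ?s = "(A + d) powr (1 / p)" and ?t = "(B + d) powr (1 / q)"
    have pos: "0 < A + d" "0 < B + d" "0 < ?s" "0 < ?t" using nonneg d by auto
    have st: "?s powr p = A + d" "?t powr q = B + d"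
      using p pos by (auto simp: powr_powr)
    have "integral (cbox u v) (\<lambda>x. a x * b x)
        \<le> integral (cbox u v) (\<lambda>x. ?s * ?t * (a x powr p * (1 / (A + d) / p) + b x powr q * (1 / (B + d) / q)))"
    proof (intro integral_le integrable_on_mult_right integrable_add integrable_on_mult_left inta intb)
      show "(\<lambda>x. a x * b x) integrable_on cbox u v"
        using a b by (intro integrable_continuous continuous_intros)
      fix x assume x: "x \<in> cbox u v"
      have "a x / ?s * (b x / ?t) \<le> (a x / ?s) powr p / p + (b x / ?t) powr q / q"
        using p a(2)[OF x] b(2)[OF x] pos by (intro Youngs_inequality) auto
      also have "\<dots> = a x powr p * (1 / (A + d) / p) + b x powr q * (1 / (B + d) / q)"
        using a(2)[OF x] b(2)[OF x] pos by (simp add: powr_divide st)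
      finally show "a x * b x \<le> ?s * ?t * (a x powr p * (1 / (A + d) / p) + b x powr q * (1 / (B + d) / q))"
        using pos by (simp add: field_simps)
    qed
    also have "\<dots> = ?s * ?t * (A * (1 / (A + d) / p) + B * (1 / (B + d) / q))"
      by (simp only: integral_mult_right integral_add[OF integrable_on_mult_left[OF inta] integrable_on_mult_left[OF intb]]
          integral_mult_left A_def[symmetric] B_def[symmetric])
    also have "\<dots> \<le> ?s * ?t * (1 / p + 1 / q)"
    proof (intro mult_left_mono add_mono)
      show "A * (1 / (A + d) / p) \<le> 1 / p"
        using nonneg d p by (simp add: divide_le_eq)
      show "B * (1 / (B + d) / q) \<le> 1 / q"
        using nonneg d p by (simp add: divide_le_eq)
    qed (use pos in auto)
    finally show ?thesis using p by simp
  qed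
  have "((\<lambda>d. (A + d) powr (1 / p) * (B + d) powr (1 / q)) \<longlongrightarrow> (A + 0) powr (1 / p) * (B + 0) powr (1 / q)) (at_right 0)"
    using p nonneg
    by (intro tendsto_mult tendsto_powr' tendsto_add tendsto_ident_at tendsto_const)
      (auto simp: eventually_at_right_less intro!: eventually_at_rightI[of 0 1])
  then have "integral (cbox u v) (\<lambda>x. a x * b x) \<le> (A + 0) powr (1 / p) * (B + 0) powr (1 / q)"
    by (rule tendsto_lowerbound) (auto intro!: eventually_at_rightI[of 0 1] le)
  then show ?thesis by (simp add: A_def B_def)
qed

lemma powr_geom_mean_le:
  fixes D :: "'n::finite \<Rightarrow> real"
  assumes "\<And>i. 0 < D i"
  shows "(\<Prod>i\<in>UNIV. D i) powr (1 / real CARD('n)) \<le> (\<Sum>i\<in>UNIV. D i) / real CARD('n)"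
proof -
  have "(\<Prod>i\<in>UNIV. D i) powr (1 / real CARD('n)) \<le> (\<Sum>i\<in>UNIV. D i / real CARD('n))"
    by (rule arith_geom_mean) (use assms in \<open>auto simp: less_imp_le\<close>)
  then show ?thesis by (simp add: sum_divide_distrib)
qed

lemma has_real_derivative_upd:
  fixes f :: "real ^ 'n \<Rightarrow> real"
  assumes "\<And>x. (f has_derivative (\<lambda>h. g x \<bullet> h)) (at x)"
  shows "DERIV (\<lambda>s. f (upd x i s)) s :> g (upd x i s) $ i"
proof -
  have eq: "upd x i = (\<lambda>s. x + (s - x $ i) *\<^sub>R axis i 1)"
    by (auto simp: fun_eq_iff vec_eq_iff axis_def)
  have "(upd x i has_derivative (\<lambda>h. h *\<^sub>R axis i 1)) (at s)"
    unfolding eq by (auto intro!: derivative_eq_intros)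
  from has_derivative_compose[OF this assms]
  show ?thesis
    by (simp add: has_field_derivative_def inner_axis mult_commute_abs)
qed

text \<open>The fundamental theorem along lines, averaged over the cube. The factor
  \<open>r * (2 * \<tau> x - 1)\<close> is the image coordinate after the target cube has been
  stretched to side \<open>2 * r\<close> and centred at the origin. As \<open>f\<close> equals
  \<epsilon> on both faces and \<tau> grows by at most 1 between them, the boundary term is at most
  \<open>2 * r * \<epsilon> powr m\<close>.\<close>

lemma parts_on_cube:
  fixes f \<tau> D :: "real ^ 'n \<Rightarrow> real" and g :: "real ^ 'n \<Rightarrow> real ^ 'n"
  assumes f: "\<And>x. (f has_derivative (\<lambda>h. g x \<bullet> h)) (at x)" "\<And>x. 0 < f x" "continuous_on UNIV g"
    and bdry: "\<And>x i. x \<in> unit_cube \<Longrightarrow> x $ i = 0 \<or> x $ i = 1 \<Longrightarrow> f x = \<epsilon>"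
    and \<tau>: "continuous_on UNIV \<tau>" "\<And>x. 0 \<le> \<tau> x" "\<And>x. \<tau> x \<le> 1"
      "\<And>x. 0 < x $ i \<Longrightarrow> x $ i < 1 \<Longrightarrow> DERIV (\<lambda>s. \<tau> (upd x i s)) (x $ i) :> D x"
    and D: "continuous_on UNIV D" and r: "0 \<le> r"
  shows "2 * r * integral unit_cube (\<lambda>x. f x powr m * D x)
    \<le> 2 * r * \<epsilon> powr m - m * integral unit_cube (\<lambda>x. f x powr (m - 1) * (g x $ i * (r * (2 * \<tau> x - 1))))"
proof -
  have fc: "continuous_on UNIV f"
    by (intro continuous_at_imp_continuous_on ballI has_derivative_continuous[OF f(1)])
  let ?a = "\<lambda>x. 2 * r * (f x powr m * D x)"
  let ?b = "\<lambda>x. m * (f x powr (m - 1) * (g x $ i * (r * (2 * \<tau> x - 1))))"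
  have pc: "continuous_on UNIV (\<lambda>x. f x powr k)" for k
    by (intro continuous_on_powr continuous_on_const fc) (use f(2) in \<open>metis less_irrefl\<close>)
  have ac: "continuous_on UNIV ?a" and bc: "continuous_on UNIV ?b"
    by (intro continuous_intros pc D f(3) \<tau>(1))+
  have abc: "continuous_on UNIV (\<lambda>x. ?a x + ?b x)"
    by (intro continuous_on_add ac bc)
  have int: "(\<lambda>x. h x) integrable_on cbox u v" if "continuous_on UNIV h" for h :: "real ^ 'n \<Rightarrow> real" and u v
    by (intro integrable_continuous continuous_on_subset[OF that]) auto
  have line: "integral {0..1} (\<lambda>s. ?a (upd x i s) + ?b (upd x i s)) \<le> 2 * r * \<epsilon> powr m"
    if x: "x \<in> unit_cube" for x
  proof -
    let ?F = "\<lambda>s. f (upd x i s) powr m * (r * (2 * \<tau> (upd x i s) - 1))"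
    have cont: "continuous_on {0..1} (\<lambda>s. h (upd x i s))" if "continuous_on UNIV h" for h :: "real ^ 'n \<Rightarrow> real"
      by (intro continuous_on_compose2[OF that] continuous_intros) auto
    have "((\<lambda>s. ?a (upd x i s) + ?b (upd x i s)) has_integral (?F 1 - ?F 0)) {0..1}"
    proof (rule fundamental_theorem_of_calculus_interior)
      show "continuous_on {0..1} ?F"
        by (rule cont[where h = "\<lambda>x. f x powr m * (r * (2 * \<tau> x - 1))"]) (intro continuous_intros pc \<tau>(1))
      fix s :: real assume s: "s \<in> {0<..<1}"
      have t: "DERIV (\<lambda>s. \<tau> (upd x i s)) s :> D (upd x i s)"
        using \<tau>(4)[of "upd x i s"] s by simp
      have "DERIV ?F s :> m * f (upd x i s) powr (m - of_nat 1) * g (upd x i s) $ i * (r * (2 * \<tau> (upd x i s) - 1))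
          + r * (2 * D (upd x i s)) * f (upd x i s) powr m"
        by (rule DERIV_mult DERIV_fun_powr has_real_derivative_upd f DERIV_cmult)+
          (auto intro!: derivative_eq_intros t)
      then have "DERIV ?F s :> ?a (upd x i s) + ?b (upd x i s)"
        by (rule DERIV_cong) (simp add: algebra_simps)
      then show "(?F has_vector_derivative ?a (upd x i s) + ?b (upd x i s)) (at s)"
        by (simp add: has_real_derivative_iff_has_vector_derivative)
    qed simp
    moreover have "f (upd x i 1) = \<epsilon>" "f (upd x i 0) = \<epsilon>"
      using x by (auto intro!: bdry[of _ i] simp: mem_unit_cube)
    moreover have "\<epsilon> powr m * (r * (2 * \<tau> (upd x i 1) - 1)) - \<epsilon> powr m * (r * (2 * \<tau> (upd x i 0) - 1))
        = \<epsilon> powr m * r * (2 * (\<tau> (upd x i 1) - \<tau> (upd x i 0)))"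
      by (simp add: algebra_simps)
    moreover have "\<dots> \<le> \<epsilon> powr m * r * (2 * 1)"
      using \<tau>(2)[of "upd x i 0"] \<tau>(3)[of "upd x i 1"] r by (intro mult_left_mono) auto
    ultimately show ?thesis by (simp add: integral_unique algebra_simps)
  qed
  have "integral unit_cube (\<lambda>x. ?a x + ?b x) = integral unit_cube (\<lambda>x. integral {0..1} (\<lambda>s. ?a (upd x i s) + ?b (upd x i s)))"
    by (rule integral_average[OF abc, symmetric])
  also have "\<dots> \<le> integral (unit_cube :: (real ^ 'n) set) (\<lambda>x. 2 * r * \<epsilon> powr m)"
    by (intro integral_le line int continuous_on_integral_upd[OF abc] continuous_intros) auto
  also have "integral unit_cube (\<lambda>x. ?a x + ?b x) = integral unit_cube ?a + integral unit_cube ?b"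
    by (intro integral_add int ac bc)
  finally show ?thesis by simp
qed

text \<open>This is applied to \<open>f = sqrt (v\<^sup>2 + \<epsilon>\<^sup>2)\<close>, which is positive and smooth, at the price of the boundary
  term containing \<open>\<epsilon>\<close>. The weight \<open>\<kappa>\<close> gives \<open>\<kappa> f\<^bsup>p*\<^esup>\<close> the mass of \<open>G\<close>.\<close>

theorem sobolev_cube_regularized:
  fixes f G :: "real ^ 'n \<Rightarrow> real" and g :: "real ^ 'n \<Rightarrow> real ^ 'n" and p r :: real
  defines "n \<equiv> real CARD('n)"
  defines "ps \<equiv> n * p / (n - p)" and "q \<equiv> p / (p - 1)" and "m \<equiv> p * (n - 1) / (n - p)"
  assumes p: "1 < p" "p < n"
    and f: "\<And>x. (f has_derivative (\<lambda>h. g x \<bullet> h)) (at x)" "\<And>x. 0 < f x" "continuous_on UNIV g"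
    and bdry: "\<And>x i. x \<in> unit_cube \<Longrightarrow> x $ i = 0 \<or> x $ i = 1 \<Longrightarrow> f x = \<epsilon>"
    and G: "continuous_on UNIV G" "\<And>x. 0 < G x" and r: "0 < r"
  defines "\<kappa> \<equiv> integral unit_cube G / integral unit_cube (\<lambda>x. f x powr ps)"
  shows "2 * r * n * integral unit_cube (\<lambda>y. G y powr (1 - 1 / n)) \<le>
    \<kappa> powr (1 - 1 / n) * (2 * r * n * \<epsilon> powr m + m * (integral unit_cube (\<lambda>x. norm (g x) powr p) powr (1 / p)
      * (integral unit_cube (\<lambda>y. norm (r *\<^sub>R (2 *\<^sub>R y - 1)) powr q * G y) / \<kappa>) powr (1 / q)))"
proof -
  have n: "1 < n" using p by simp
  have fc: "continuous_on UNIV f"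
    by (intro continuous_at_imp_continuous_on ballI has_derivative_continuous[OF f(1)])
  have fpc: "continuous_on UNIV (\<lambda>x. f x powr k)" for k
    by (intro continuous_on_powr continuous_on_const fc) (use f(2) in \<open>metis less_irrefl\<close>)
  have Gpc: "continuous_on UNIV (\<lambda>x. G x powr k)" for k
    by (intro continuous_on_powr continuous_on_const G) (use G(2) in \<open>metis less_irrefl\<close>)
  note int = integrable_unit_cube and int_pos = integral_unit_cube_pos
  have fpp: "0 < f x powr k" for x k using f(2)[of x] by simp
  have \<kappa>: "0 < \<kappa>"
    unfolding \<kappa>_def by (intro divide_pos_pos int_pos G fpc fpp)
  define F where "F x = \<kappa> * f x powr ps" for x
  have F: "continuous_on UNIV F" "\<And>x. 0 < F x"
    unfolding F_def by (intro continuous_intros fpc, intro mult_pos_pos \<kappa> fpp)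
  have "0 < integral unit_cube (\<lambda>x. f x powr ps)"
    by (intro int_pos fpc fpp)
  then have FG: "integral unit_cube F = integral unit_cube G"
    unfolding F_def by (simp add: \<kappa>_def)
  obtain T D where T: "knothe_map UNIV F G T D"
    using knothe_map_exists[OF finite F G depends_on_UNIV depends_on_UNIV FG] by blast
  have Tc: "continuous_on UNIV T" and Tbox: "\<And>x. T x \<in> unit_cube"
    and Dc: "\<And>i. continuous_on UNIV (D i)" and Dpos: "\<And>i x. 0 < D i x"
    and Dder: "\<And>i x. 0 < x $ i \<Longrightarrow> x $ i < 1 \<Longrightarrow> DERIV (\<lambda>s. T (upd x i s) $ i) (x $ i) :> D i x"
    and Dprod: "\<And>x. G (T x) * (\<Prod>i\<in>UNIV. D i x) = F x"
    and push: "\<And>h. continuous_on UNIV h \<Longrightarrow>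
        integral unit_cube (\<lambda>x. h (T x) * F x) = integral unit_cube (\<lambda>y. h y * G y)"
    using T depends_on_UNIV unfolding knothe_map_def by blast+
  define Y where "Y x = r *\<^sub>R (2 *\<^sub>R T x - 1)" for x
  have Yc: "continuous_on UNIV Y" unfolding Y_def by (intro continuous_intros Tc)
  have Ynth: "Y x $ i = r * (2 * T x $ i - 1)" for x i by (simp add: Y_def)
  \<comment> \<open>This is where \<open>m\<close> comes from: \<open>F powr (1 - 1 / n)\<close> is
    a multiple of \<open>f powr m\<close>.\<close>
  have m_ps: "ps * (1 - 1 / n) = m" unfolding ps_def m_def using n p by (simp add: field_simps)
  have q: "1 < q" "1 / p + 1 / q = 1" unfolding q_def using p by (auto simp: field_simps)
  \<comment> \<open>In Hoelder's inequality the factor \<open>f powr (m - 1)\<close> is raised to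
    the power \<open>q\<close>; by this identity it becomes \<open>F\<close> up to \<kappa>, which
    the push-forward turns into \<open>G\<close>.\<close>
  have m_q: "(m - 1) * q = ps"
  proof -
    have "m - 1 = n * (p - 1) / (n - p)" unfolding m_def using p by (simp add: field_simps)
    then show ?thesis unfolding q_def ps_def using p by simp
  qed
  have m: "0 < m" unfolding m_def using n p by simp
  have Fp: "F x powr (1 - 1 / n) = \<kappa> powr (1 - 1 / n) * f x powr m" for x
    unfolding F_def using \<kappa> f(2)[of x] by (simp add: powr_mult powr_powr m_ps)
  \<comment> \<open>Solving the Jacobian equation for \<open>G (T x)\<close> turns the left-hand
    side into \<open>F x powr (1 - 1 / n)\<close> times the geometric mean of the diagonal
    entries.\<close>
  have pointwise: "G (T x) powr (- (1 / n)) * F x \<le> \<kappa> powr (1 - 1 / n) * (\<Sum>i\<in>UNIV. f x powr m * D i x) / n" for x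
  proof -
    have P: "0 < (\<Prod>i\<in>UNIV. D i x)" using Dpos by (intro prod_pos) auto
    have GT: "G (T x) = F x / (\<Prod>i\<in>UNIV. D i x)" using Dprod[of x] P by (metis less_irrefl nonzero_eq_divide_eq)
    have "G (T x) powr (- (1 / n)) * F x = F x powr (1 - 1 / n) * (\<Prod>i\<in>UNIV. D i x) powr (1 / n)"
      unfolding GT using F(2)[of x] P by (simp add: powr_divide powr_minus powr_diff field_simps)
    also have "\<dots> \<le> F x powr (1 - 1 / n) * ((\<Sum>i\<in>UNIV. D i x) / n)"
      unfolding n_def by (intro mult_left_mono powr_geom_mean_le Dpos) auto
    finally show ?thesis by (simp add: Fp sum_distrib_left[symmetric] sum_distrib_right[symmetric] mult_ac)
  qed
  have "integral unit_cube (\<lambda>y. G y powr (1 - 1 / n)) = integral unit_cube (\<lambda>y. G y powr (- (1 / n)) * G y)"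
    using G(2) by (intro Henstock_Kurzweil_Integration.integral_cong) (simp add: powr_minus powr_diff field_simps less_imp_le)
  also have "\<dots> = integral unit_cube (\<lambda>x. G (T x) powr (- (1 / n)) * F x)"
    by (rule push[symmetric, OF Gpc])
  also have "\<dots> \<le> integral unit_cube (\<lambda>x. \<kappa> powr (1 - 1 / n) * (\<Sum>i\<in>UNIV. f x powr m * D i x) / n)"
    by (intro integral_le int pointwise continuous_intros F fpc Dc continuous_on_compose2[OF Gpc Tc]) (use n in auto)
  also have "\<dots> = \<kappa> powr (1 - 1 / n) * (\<Sum>i\<in>UNIV. integral unit_cube (\<lambda>x. f x powr m * D i x)) / n"
    by (simp add: integral_sum int continuous_intros fpc Dc)
  finally have "2 * r * n * integral unit_cube (\<lambda>y. G y powr (1 - 1 / n))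
      \<le> \<kappa> powr (1 - 1 / n) * (\<Sum>i\<in>UNIV. 2 * r * integral unit_cube (\<lambda>x. f x powr m * D i x))"
    using r n by (simp add: sum_distrib_left[symmetric] field_simps)
  also have "\<dots> \<le> \<kappa> powr (1 - 1 / n) * (\<Sum>i\<in>UNIV. 2 * r * \<epsilon> powr m
      - m * integral unit_cube (\<lambda>x. f x powr (m - 1) * (g x $ i * (r * (2 * T x $ i - 1)))))"
  proof (intro mult_left_mono sum_mono)
    fix i
    show "2 * r * integral unit_cube (\<lambda>x. f x powr m * D i x) \<le> 2 * r * \<epsilon> powr m
      - m * integral unit_cube (\<lambda>x. f x powr (m - 1) * (g x $ i * (r * (2 * T x $ i - 1))))"
      using Tbox r by (intro parts_on_cube f bdry Dc Dder continuous_intros Tc) (auto simp: mem_unit_cube)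
  qed simp
  also have "(\<Sum>i\<in>UNIV. 2 * r * \<epsilon> powr m
      - m * integral unit_cube (\<lambda>x. f x powr (m - 1) * (g x $ i * (r * (2 * T x $ i - 1)))))
      = 2 * r * n * \<epsilon> powr m - m * integral unit_cube (\<lambda>x. f x powr (m - 1) * (g x \<bullet> Y x))"
  proof -
    have "integral unit_cube (\<lambda>x. f x powr (m - 1) * (g x \<bullet> Y x))
        = integral unit_cube (\<lambda>x. \<Sum>i\<in>UNIV. f x powr (m - 1) * (g x $ i * (r * (2 * T x $ i - 1))))"
      by (simp add: inner_vec_def Ynth sum_distrib_left)
    also have "\<dots> = (\<Sum>i\<in>UNIV. integral unit_cube (\<lambda>x. f x powr (m - 1) * (g x $ i * (r * (2 * T x $ i - 1)))))"
      by (intro integral_sum int continuous_intros fpc f Tc) auto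
    finally show ?thesis
      by (simp add: sum_subtractf sum_distrib_left n_def)
  qed
  finally have main: "2 * r * n * integral unit_cube (\<lambda>y. G y powr (1 - 1 / n))
      \<le> \<kappa> powr (1 - 1 / n) * (2 * r * n * \<epsilon> powr m - m * integral unit_cube (\<lambda>x. f x powr (m - 1) * (g x \<bullet> Y x)))" .
  have gc: "continuous_on UNIV (\<lambda>x. norm (g x))"
    and fYc: "continuous_on UNIV (\<lambda>x. f x powr (m - 1) * norm (Y x))"
    by (intro continuous_on_mult continuous_on_norm fpc f Yc)+
  have "- integral unit_cube (\<lambda>x. f x powr (m - 1) * (g x \<bullet> Y x))
      \<le> integral unit_cube (\<lambda>x. norm (g x) * (f x powr (m - 1) * norm (Y x)))"
  proof -
    have "- integral unit_cube (\<lambda>x. f x powr (m - 1) * (g x \<bullet> Y x))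
        = integral unit_cube (\<lambda>x. - (f x powr (m - 1) * (g x \<bullet> Y x)))" by simp
    also have "\<dots> \<le> integral unit_cube (\<lambda>x. norm (g x) * (f x powr (m - 1) * norm (Y x)))"
    proof (intro integral_le int continuous_on_minus continuous_on_mult continuous_on_inner continuous_on_norm fpc f Yc)
      fix x
      have "- (g x \<bullet> Y x) \<le> norm (g x) * norm (Y x)"
        using norm_cauchy_schwarz[of "- g x" "Y x"] by simp
      from mult_left_mono[OF this, of "f x powr (m - 1)"]
      show "- (f x powr (m - 1) * (g x \<bullet> Y x)) \<le> norm (g x) * (f x powr (m - 1) * norm (Y x))"
        by (simp add: mult_ac)
    qed
    finally show ?thesis .
  qed
  also have "integral unit_cube (\<lambda>x. norm (g x) * (f x powr (m - 1) * norm (Y x)))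
      \<le> integral unit_cube (\<lambda>x. norm (g x) powr p) powr (1 / p)
        * integral unit_cube (\<lambda>x. (f x powr (m - 1) * norm (Y x)) powr q) powr (1 / q)"
    by (rule Holder_cbox[OF p(1) q continuous_on_subset[OF gc subset_UNIV] _ continuous_on_subset[OF fYc subset_UNIV]])
      simp_all
  also have "integral unit_cube (\<lambda>x. (f x powr (m - 1) * norm (Y x)) powr q)
      = integral unit_cube (\<lambda>y. norm (r *\<^sub>R (2 *\<^sub>R y - 1)) powr q * G y) / \<kappa>"
  proof -
    have hc: "continuous_on UNIV (\<lambda>y::real^'n. norm (r *\<^sub>R (2 *\<^sub>R y - 1)) powr q)"
      using q by (intro continuous_on_powr' continuous_intros) auto
    have "integral unit_cube (\<lambda>x. (f x powr (m - 1) * norm (Y x)) powr q)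
        = integral unit_cube (\<lambda>x. norm (Y x) powr q * F x / \<kappa>)"
      using \<kappa> f(2) by (intro Henstock_Kurzweil_Integration.integral_cong)
        (simp add: powr_mult powr_powr m_q F_def)
    also have "\<dots> = integral unit_cube (\<lambda>x. norm (Y x) powr q * F x) / \<kappa>" by simp
    also have "integral unit_cube (\<lambda>x. norm (Y x) powr q * F x)
        = integral unit_cube (\<lambda>y. norm (r *\<^sub>R (2 *\<^sub>R y - 1)) powr q * G y)"
      unfolding Y_def by (rule push[OF hc])
    finally show ?thesis .
  qed
  finally have "m * (- integral unit_cube (\<lambda>x. f x powr (m - 1) * (g x \<bullet> Y x)))
      \<le> m * (integral unit_cube (\<lambda>x. norm (g x) powr p) powr (1 / p)
      * (integral unit_cube (\<lambda>y. norm (r *\<^sub>R (2 *\<^sub>R y - 1)) powr q * G y) / \<kappa>) powr (1 / q))"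
    using m by (intro mult_left_mono) auto
  then show ?thesis
    by (intro order.trans[OF main] mult_left_mono) auto
qed

text \<open>The limit \<epsilon> to 0 of the regularized inequality. The gradient of
  \<open>sqrt (v\<^sup>2 + \<epsilon>\<^sup>2)\<close> is that of \<open>v\<close> times a factor of
  modulus at most 1, so the gradient norm never exceeds that of \<open>v\<close>, and the boundary
  term vanishes because \<open>m > 0\<close>.\<close>

theorem sobolev_cube:
  fixes v G :: "real ^ 'n \<Rightarrow> real" and g :: "real ^ 'n \<Rightarrow> real ^ 'n" and p r :: real
  defines "n \<equiv> real CARD('n)"
  defines "ps \<equiv> n * p / (n - p)" and "q \<equiv> p / (p - 1)" and "m \<equiv> p * (n - 1) / (n - p)"
  assumes p: "1 < p" "p < n"
    and v: "\<And>x. (v has_derivative (\<lambda>h. g x \<bullet> h)) (at x)" "continuous_on UNIV g"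
    and bdry: "\<And>x i. x \<in> unit_cube \<Longrightarrow> x $ i = 0 \<or> x $ i = 1 \<Longrightarrow> v x = 0"
    and G: "continuous_on UNIV G" "\<And>x. 0 < G x" and r: "0 < r"
  shows "2 * r * n * integral unit_cube (\<lambda>y. G y powr (1 - 1 / n)) * integral unit_cube (\<lambda>x. \<bar>v x\<bar> powr ps) powr (1 / ps)
    \<le> m * integral unit_cube (\<lambda>x. norm (g x) powr p) powr (1 / p) * integral unit_cube G powr (1 / ps)
      * integral unit_cube (\<lambda>y. norm (r *\<^sub>R (2 *\<^sub>R y - 1)) powr q * G y) powr (1 / q)"
proof -
  define f where "f \<epsilon> x = sqrt (v x ^ 2 + \<epsilon> ^ 2)" for \<epsilon> x
  define V where "V \<epsilon> = integral unit_cube (\<lambda>x. f \<epsilon> x powr ps)" for \<epsilon>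
  define N where "N = integral unit_cube (\<lambda>x. norm (g x) powr p) powr (1 / p)"
  define A where "A = integral unit_cube G"
  define W where "W = integral unit_cube (\<lambda>y. G y powr (1 - 1 / n))"
  define C where "C = integral unit_cube (\<lambda>y. norm (r *\<^sub>R (2 *\<^sub>R y - 1)) powr q * G y)"
  have n: "1 < n" using p by simp
  have ps: "0 < ps" unfolding ps_def using p n by simp
  have q: "1 < q" "1 / p + 1 / q = 1" unfolding q_def using p by (auto simp: field_simps)
  have m: "0 < m" unfolding m_def using p n by simp
  have ps_inv: "1 / ps = 1 / p - 1 / n" unfolding ps_def using p n by (simp add: field_simps)
  have vc: "continuous_on UNIV v"
    by (intro continuous_at_imp_continuous_on ballI has_derivative_continuous[OF v(1)])
  note int = integrable_unit_cube and int_pos = integral_unit_cube_pos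
  have A: "0 < A" unfolding A_def by (intro int_pos G)
  have C: "0 \<le> C"
    unfolding C_def using G q
    by (intro integral_nonneg int continuous_intros continuous_on_powr') (auto simp: less_imp_le)
  have N: "0 \<le> N" by (simp add: N_def)
  have V0: "V 0 = integral unit_cube (\<lambda>x. \<bar>v x\<bar> powr ps)"
    by (simp add: V_def f_def)
  have Vc: "continuous_on UNIV V"
  proof -
    have "continuous_on (UNIV \<times> unit_cube) (\<lambda>(\<epsilon>, x). f \<epsilon> x powr ps)"
      unfolding case_prod_beta f_def using ps
      by (intro continuous_on_powr' continuous_intros continuous_on_compose2[OF vc]) auto
    from integral_continuous_on_param[OF this] show ?thesis by (simp add: V_def)
  qed
  then have Vt: "(V \<longlongrightarrow> V 0) (at_right 0)"
    by (metis UNIV_I continuous_on_def tendsto_within_subset top_greatest)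
  have main: "2 * r * n * W * V \<epsilon> powr (1 - 1 / n)
      \<le> A powr (1 - 1 / n) * (2 * r * n * \<epsilon> powr m + m * (N * (C * V \<epsilon> / A) powr (1 / q)))"
    if e: "0 < \<epsilon>" for \<epsilon>
  proof -
    have f: "0 < f \<epsilon> x" for x using e by (simp add: f_def add_nonneg_pos)
    have fc: "continuous_on UNIV (f \<epsilon>)" unfolding f_def by (intro continuous_intros vc)
    have f': "(f \<epsilon> has_derivative (\<lambda>h. ((v x / f \<epsilon> x) *\<^sub>R g x) \<bullet> h)) (at x)" for x
    proof -
      have "(f \<epsilon> has_derivative (\<lambda>h. (2 * v x * (g x \<bullet> h)) * (inverse (sqrt (v x ^ 2 + \<epsilon> ^ 2)) / 2))) (at x)"
        unfolding f_def using e by (auto intro!: derivative_eq_intros v simp: add_nonneg_pos)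
      then show ?thesis by (rule has_derivative_eq_rhs) (auto simp: f_def fun_eq_iff field_simps)
    qed
    have gc: "continuous_on UNIV (\<lambda>x. (v x / f \<epsilon> x) *\<^sub>R g x)"
      using f by (intro continuous_intros vc fc v) (metis less_irrefl)
    have Vpos: "0 < V \<epsilon>"
    proof -
      have "0 < f \<epsilon> x powr ps" for x using f[of x] by simp
      moreover have "continuous_on UNIV (\<lambda>x. f \<epsilon> x powr ps)"
        using f ps by (intro continuous_on_powr' fc continuous_on_const) (auto simp: less_imp_le)
      ultimately show ?thesis unfolding V_def by (intro int_pos)
    qed
    have bd: "f \<epsilon> x = \<epsilon>" if "x \<in> unit_cube" "x $ i = 0 \<or> x $ i = 1" for x i
      using bdry[OF that] e by (simp add: f_def)
    have "2 * r * n * W \<le> (A / V \<epsilon>) powr (1 - 1 / n) * (2 * r * n * \<epsilon> powr m +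
        m * (integral unit_cube (\<lambda>x. norm ((v x / f \<epsilon> x) *\<^sub>R g x) powr p) powr (1 / p) * (C / (A / V \<epsilon>)) powr (1 / q)))"
      unfolding W_def A_def V_def C_def n_def m_def q_def ps_def
      by (rule sobolev_cube_regularized) (use p[unfolded n_def] f' f gc bd G r in auto)
    also have "\<dots> \<le> (A / V \<epsilon>) powr (1 - 1 / n) * (2 * r * n * \<epsilon> powr m + m * (N * (C / (A / V \<epsilon>)) powr (1 / q)))"
    proof (intro mult_left_mono add_left_mono mult_right_mono)
      show "integral unit_cube (\<lambda>x. norm ((v x / f \<epsilon> x) *\<^sub>R g x) powr p) powr (1 / p) \<le> N"
        unfolding N_def
      proof (intro powr_mono2 integral_le int integral_nonneg)
        show c1: "continuous_on UNIV (\<lambda>x. norm ((v x / f \<epsilon> x) *\<^sub>R g x) powr p)"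
          "continuous_on UNIV (\<lambda>x. norm (g x) powr p)"
          using p by (intro continuous_on_powr' continuous_on_norm continuous_on_const gc v; simp)+
        show "continuous_on UNIV (\<lambda>x. norm ((v x / f \<epsilon> x) *\<^sub>R g x) powr p)" by (rule c1)
        fix x
        have "\<bar>v x\<bar> \<le> f \<epsilon> x" by (simp add: f_def real_le_rsqrt)
        then have "\<bar>v x / f \<epsilon> x\<bar> \<le> 1" using f[of x] by simp
        then have "\<bar>v x / f \<epsilon> x\<bar> * norm (g x) \<le> 1 * norm (g x)" by (intro mult_right_mono) auto
        then show "norm ((v x / f \<epsilon> x) *\<^sub>R g x) \<le> norm (g x)"
          by simp
      qed (use p in auto)
    qed (use m in auto)
    finally have "2 * r * n * W * V \<epsilon> powr (1 - 1 / n)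
      \<le> (A / V \<epsilon>) powr (1 - 1 / n) * (2 * r * n * \<epsilon> powr m + m * (N * (C / (A / V \<epsilon>)) powr (1 / q))) * V \<epsilon> powr (1 - 1 / n)"
      by (intro mult_right_mono) auto
    also have "\<dots> = A powr (1 - 1 / n) * (2 * r * n * \<epsilon> powr m + m * (N * (C * V \<epsilon> / A) powr (1 / q)))"
      using A Vpos by (simp add: powr_divide)
    finally show ?thesis .
  qed
  have "2 * r * n * W * V 0 powr (1 - 1 / n)
      \<le> A powr (1 - 1 / n) * (2 * r * n * 0 powr m + m * (N * (C * V 0 / A) powr (1 / q)))"
  proof (rule tendsto_le[OF trivial_limit_at_right_real])
    have nn: "\<forall>\<^sub>F \<epsilon> in at_right 0. 0 \<le> V \<epsilon>"
      unfolding V_def f_def using ps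
      by (intro always_eventually allI integral_nonneg int continuous_on_powr' continuous_intros vc) auto
    show "((\<lambda>\<epsilon>. 2 * r * n * W * V \<epsilon> powr (1 - 1 / n)) \<longlongrightarrow> 2 * r * n * W * V 0 powr (1 - 1 / n)) (at_right 0)"
      using n by (intro tendsto_intros tendsto_powr' Vt nn) (auto intro: eventually_mono[OF nn])
    show "((\<lambda>\<epsilon>. A powr (1 - 1 / n) * (2 * r * n * \<epsilon> powr m + m * (N * (C * V \<epsilon> / A) powr (1 / q))))
      \<longlongrightarrow> A powr (1 - 1 / n) * (2 * r * n * 0 powr m + m * (N * (C * V 0 / A) powr (1 / q)))) (at_right 0)"
      using m q A C by (intro tendsto_mult tendsto_add tendsto_const tendsto_powr' tendsto_divide Vt tendsto_ident_at)
        (auto intro: eventually_mono[OF nn] eventually_at_rightI[of 0 1])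
    show "\<forall>\<^sub>F \<epsilon> in at_right 0. 2 * r * n * W * V \<epsilon> powr (1 - 1 / n)
      \<le> A powr (1 - 1 / n) * (2 * r * n * \<epsilon> powr m + m * (N * (C * V \<epsilon> / A) powr (1 / q)))"
      by (rule eventually_at_rightI[of 0 1]) (auto intro: main)
  qed
  then have lim: "2 * r * n * W * V 0 powr (1 - 1 / n) \<le> A powr (1 - 1 / n) * (m * (N * (C * V 0 / A) powr (1 / q)))"
    by simp
  have Vnn: "0 \<le> V 0"
    unfolding V0 using ps by (intro integral_nonneg int continuous_on_powr' continuous_intros vc) auto
  have "2 * r * n * W * V 0 powr (1 / ps) \<le> m * N * A powr (1 / ps) * C powr (1 / q)"
  proof (cases "V 0 = 0")
    case True
    then show ?thesis using m N by simp
  next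
    case False
    then have V: "0 < V 0" using Vnn by simp
    \<comment> \<open>\<open>V 0\<close> occurs on both sides, with exponents
      \<open>1 - 1 / n\<close> and \<open>1 / q\<close>; by this identity cancelling leaves the
      exponent \<open>1 / ps\<close> of the norm.\<close>
    have ex: "1 - 1 / n = 1 / ps + 1 / q" using q(2) ps_inv by simp
    have "2 * r * n * W * V 0 powr (1 / ps) * V 0 powr (1 / q)
        \<le> (m * N * A powr (1 / ps) * C powr (1 / q)) * V 0 powr (1 / q)"
      using lim A C V unfolding ex by (simp add: powr_add powr_divide powr_mult mult_ac)
    then show ?thesis using V by (simp add: mult_le_cancel_right)
  qed
  then show ?thesis by (simp add: W_def V0 N_def A_def C_def)
qed

section \<open>From cubes to the whole space\<close>

abbreviation sym_cube :: "real \<Rightarrow> (real ^ 'n) set" where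
  "sym_cube r \<equiv> cbox (- (r *\<^sub>R 1)) (r *\<^sub>R 1)"

lemma mem_sym_cube: "x \<in> sym_cube r \<longleftrightarrow> (\<forall>i. \<bar>x $ i\<bar> \<le> r)"
  by (simp add: mem_box_cart abs_le_iff minus_le_iff conj_commute)

text \<open>Besides the rescaling, this passes from the gauge integral, used for the transport, to
  the Lebesgue integral, used from here on.\<close>

lemma integral_unit_cube_affine:
  fixes \<phi> :: "real ^ 'n \<Rightarrow> real"
  assumes \<phi>: "continuous_on UNIV \<phi>" and r: "0 < r"
  shows "integral unit_cube (\<lambda>x. \<phi> (r *\<^sub>R (2 *\<^sub>R x - 1))) = (LINT x : sym_cube r | lborel. \<phi> x) / (2 * r) powr real CARD('n)"
proof -
  have si: "set_integrable lborel (sym_cube r) \<phi>"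
    unfolding set_integrable_def
    by (intro borel_integrable_compact compact_cbox continuous_on_subset[OF \<phi>]) auto
  have int: "(\<phi> has_integral (LINT x : sym_cube r | lborel. \<phi> x)) (sym_cube r)"
    unfolding set_borel_integral_eq_integral(2)[OF si]
    by (rule integrable_integral[OF set_borel_integral_eq_integral(1)[OF si]])
  have "((\<lambda>x. \<phi> ((2 * r) *\<^sub>R x + - (r *\<^sub>R 1))) has_integral
      ((LINT x : sym_cube r | lborel. \<phi> x) /\<^sub>R (2 * r) ^ DIM(real ^ 'n)))
      (cbox ((- (r *\<^sub>R 1) - - (r *\<^sub>R 1)) /\<^sub>R (2 * r)) ((r *\<^sub>R 1 - - (r *\<^sub>R 1)) /\<^sub>R (2 * r)))"
    by (rule has_integral_affinity'[OF int]) (use r in simp)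
  moreover have "(r *\<^sub>R 1 - - (r *\<^sub>R 1)) /\<^sub>R (2 * r) = (1 :: real ^ 'n)"
    using r by (simp add: vec_eq_iff)
  moreover have "(2 * r) *\<^sub>R x + - (r *\<^sub>R 1) = r *\<^sub>R (2 *\<^sub>R x - 1)" for x :: "real ^ 'n"
    by (simp add: vec_eq_iff algebra_simps)
  ultimately have "((\<lambda>x. \<phi> (r *\<^sub>R (2 *\<^sub>R x - 1))) has_integral
      ((LINT x : sym_cube r | lborel. \<phi> x) /\<^sub>R (2 * r) ^ CARD('n))) unit_cube"
    by simp
  then show ?thesis
    using r by (simp add: integral_unique powr_realpow divide_inverse mult.commute)
qed

lemma tendsto_integral_sym_cube:
  fixes h :: "real ^ 'n \<Rightarrow> real"
  assumes "integrable lborel h"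
  shows "(\<lambda>k. LINT x : sym_cube (real (Suc k)) | lborel. h x) \<longlonglongrightarrow> (LINT x | lborel. h x)"
  unfolding set_lebesgue_integral_def
proof (rule integral_dominated_convergence[where w = "\<lambda>x. norm (h x)"])
  show "AE x in lborel. (\<lambda>k. indicat_real (sym_cube (real (Suc k))) x *\<^sub>R h x) \<longlonglongrightarrow> h x"
  proof (intro AE_I2 tendsto_eventually)
    fix x :: "real ^ 'n"
    have "x \<in> sym_cube (real (Suc k))" if "nat \<lceil>norm x\<rceil> \<le> k" for k
    proof -
      have "norm x \<le> real (Suc k)" using that by linarith
      then have "\<bar>x $ i\<bar> \<le> real (Suc k)" for i using component_le_norm_cart[of x i] by linarith
      then show ?thesis unfolding mem_sym_cube by blast
    qed
    then show "\<forall>\<^sub>F k in sequentially. indicat_real (sym_cube (real (Suc k))) x *\<^sub>R h x = h x"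
      by (auto simp: eventually_sequentially intro!: exI[of _ "nat \<lceil>norm x\<rceil>"])
  qed
qed (use assms in \<open>auto simp: indicator_def\<close>)

lemma set_integral_le_integral:
  fixes h :: "'a \<Rightarrow> real"
  assumes "integrable M h" "\<And>x. 0 \<le> h x" "S \<in> sets M"
  shows "(LINT x : S | M. h x) \<le> (LINT x | M. h x)"
  unfolding set_lebesgue_integral_def
  by (rule integral_mono) (use assms in \<open>auto simp: indicator_def intro!: integrable_mult_indicator[where 'b = real, simplified]\<close>)

text \<open>Source and target cubes are scaled independently. The support of \<open>v\<close> lies
  in a fixed cube of half-side \<open>L\<close>, while \<open>G\<close> is restricted to cubes of
  half-side \<open>r\<close> that exhaust the space; all powers of \<open>L\<close> and
  \<open>r\<close> cancel. On the right the integrals over cubes are bounded by those over the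
  space, so only the integral on the left has to converge.\<close>

theorem sobolev_whole_space:
  fixes v G :: "real ^ 'n \<Rightarrow> real" and g :: "real ^ 'n \<Rightarrow> real ^ 'n" and p :: real
  defines "n \<equiv> real CARD('n)"
  defines "ps \<equiv> n * p / (n - p)" and "q \<equiv> p / (p - 1)" and "m \<equiv> p * (n - 1) / (n - p)"
  assumes p: "1 < p" "p < n"
    and v: "\<And>x. (v has_derivative (\<lambda>h. g x \<bullet> h)) (at x)" "continuous_on UNIV g"
    and supp: "\<And>x. v x \<noteq> 0 \<Longrightarrow> norm x < M"
    and G: "continuous_on UNIV G" "\<And>x. 0 < G x"
    and int: "integrable lborel G" "integrable lborel (\<lambda>y. G y powr (1 - 1 / n))"
      "integrable lborel (\<lambda>y. norm y powr q * G y)"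
  shows "n * (LINT y | lborel. G y powr (1 - 1 / n)) * (LINT x | lborel. \<bar>v x\<bar> powr ps) powr (1 / ps)
    \<le> m * (LINT x | lborel. norm (g x) powr p) powr (1 / p) * (LINT y | lborel. G y) powr (1 / ps)
      * (LINT y | lborel. norm y powr q * G y) powr (1 / q)"
proof -
  \<comment> \<open>The maximum with 1 ensures a positive half-side, whatever the sign of
    \<open>M\<close>.\<close>
  define L where "L = max 1 M"
  have L: "0 < L" by (simp add: L_def)
  have n: "1 < n" using p by simp
  have q: "1 < q" "1 / p + 1 / q = 1" unfolding q_def using p by (auto simp: field_simps)
  have ps: "0 < ps" unfolding ps_def using p n by simp
  have m: "0 < m" unfolding m_def using p n by simp
  have ps_inv: "1 / ps = 1 / p - 1 / n" unfolding ps_def using p n by (simp add: field_simps)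
  have vc: "continuous_on UNIV v"
    by (intro continuous_at_imp_continuous_on ballI has_derivative_continuous[OF v(1)])
  have g0: "g x = 0" if x: "M < norm x" for x
  proof -
    have "open {x :: real ^ 'n. M < norm x}" by (intro open_Collect_less continuous_intros)
    then have "((\<lambda>x. 0) has_derivative (\<lambda>h. g x \<bullet> h)) (at x)"
      by (rule has_derivative_transform_within_open[OF v(1)]) (use x supp in \<open>force+\<close>)
    from has_derivative_unique[OF this has_derivative_const] have "(\<lambda>h. g x \<bullet> h) = (\<lambda>h. 0)" .
    then have "g x \<bullet> g x = 0" by metis
    then show ?thesis by simp
  qed
  have outside: "M < norm x" if x: "x \<notin> sym_cube L" for x :: "real ^ 'n"
  proof -
    obtain i where "L < \<bar>x $ i\<bar>" using x unfolding mem_sym_cube by (auto simp: not_le)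
    then show ?thesis using component_le_norm_cart[of x i] by (simp add: L_def)
  qed
  define V where "V = (LINT x | lborel. \<bar>v x\<bar> powr ps)"
  define N where "N = (LINT x | lborel. norm (g x) powr p)"
  have V: "(LINT x : sym_cube L | lborel. \<bar>v x\<bar> powr ps) = V"
    unfolding V_def set_lebesgue_integral_def
    by (intro Bochner_Integration.integral_cong) (use outside supp in \<open>force simp: indicator_def\<close>)+
  have N: "(LINT x : sym_cube L | lborel. norm (g x) powr p) = N"
    unfolding N_def set_lebesgue_integral_def
    by (intro Bochner_Integration.integral_cong) (use outside g0 in \<open>auto simp: indicator_def\<close>)
  have VN: "0 \<le> V" "0 \<le> N" unfolding V_def N_def by (auto intro: integral_nonneg_AE)
  have vpc: "continuous_on UNIV (\<lambda>x. \<bar>v x\<bar> powr ps)"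
    using ps by (intro continuous_on_powr' continuous_intros vc) auto
  have gpc: "continuous_on UNIV (\<lambda>x. norm (g x) powr p)"
    using p by (intro continuous_on_powr' continuous_intros v) auto
  have Gpc: "continuous_on UNIV (\<lambda>x. G x powr k)" for k
    by (intro continuous_on_powr continuous_on_const G) (use G(2) in \<open>metis less_irrefl\<close>)
  have qc: "continuous_on UNIV (\<lambda>y. norm y powr q * G y)"
    using q by (intro continuous_on_mult continuous_on_powr' continuous_intros G) auto
  let ?aff = "\<lambda>x::real^'n. L *\<^sub>R (2 *\<^sub>R x - 1)"
  have cube: "n * (LINT y : sym_cube r | lborel. G y powr (1 - 1 / n)) * V powr (1 / ps)
    \<le> m * N powr (1 / p) * (LINT y : sym_cube r | lborel. G y) powr (1 / ps)
      * (LINT y : sym_cube r | lborel. norm y powr q * G y) powr (1 / q)" if r: "0 < r" for r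
  proof -
    define W A C where "W = (LINT y : sym_cube r | lborel. G y powr (1 - 1 / n))"
      and "A = (LINT y : sym_cube r | lborel. G y)"
      and "C = (LINT y : sym_cube r | lborel. norm y powr q * G y)"
    have AC: "0 \<le> A" "0 \<le> C"
      unfolding A_def C_def set_lebesgue_integral_def using G(2)
      by (auto intro!: integral_nonneg_AE AE_I2 mult_nonneg_nonneg simp: less_imp_le indicator_def)
    have Gr: "continuous_on UNIV (\<lambda>x. G (r *\<^sub>R (2 *\<^sub>R x - 1)))"
      by (intro continuous_on_compose2[OF G(1)] continuous_intros) auto
    have vL: "((\<lambda>x. v (?aff x)) has_derivative (\<lambda>h. ((2 * L) *\<^sub>R g (?aff x)) \<bullet> h)) (at x)" for x
    proof -
      have "(?aff has_derivative (\<lambda>h. (2 * L) *\<^sub>R h)) (at x)"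
        by (auto intro!: derivative_eq_intros simp: algebra_simps)
      from has_derivative_compose[OF this v(1)] show ?thesis by simp
    qed
    have gL: "continuous_on UNIV (\<lambda>x. (2 * L) *\<^sub>R g (?aff x))"
      by (intro continuous_on_scaleR continuous_on_const continuous_on_compose2[OF v(2)] continuous_intros) auto
    have bdry: "v (?aff x) = 0" if "x $ i = 0 \<or> x $ i = 1" for x i
    proof (rule ccontr)
      assume "v (?aff x) \<noteq> 0"
      from supp[OF this] have "\<bar>?aff x $ i\<bar> < M" using component_le_norm_cart[of "?aff x" i] by linarith
      moreover have "\<bar>?aff x $ i\<bar> = L" using that L by auto
      ultimately show False by (simp add: L_def)
    qed
    have "2 * r * n * integral unit_cube (\<lambda>y. G (r *\<^sub>R (2 *\<^sub>R y - 1)) powr (1 - 1 / n))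
        * integral unit_cube (\<lambda>x. \<bar>v (?aff x)\<bar> powr ps) powr (1 / ps)
      \<le> m * integral unit_cube (\<lambda>x. norm ((2 * L) *\<^sub>R g (?aff x)) powr p) powr (1 / p)
        * integral unit_cube (\<lambda>y. G (r *\<^sub>R (2 *\<^sub>R y - 1))) powr (1 / ps)
        * integral unit_cube (\<lambda>y. norm (r *\<^sub>R (2 *\<^sub>R y - 1)) powr q * G (r *\<^sub>R (2 *\<^sub>R y - 1))) powr (1 / q)"
      unfolding n_def m_def q_def ps_def
      by (rule sobolev_cube) (use p[unfolded n_def] vL gL bdry Gr G(2) r in auto)
    also have "integral unit_cube (\<lambda>y. G (r *\<^sub>R (2 *\<^sub>R y - 1)) powr (1 - 1 / n)) = W / (2 * r) powr n"
      unfolding W_def n_def using r by (intro integral_unit_cube_affine[OF Gpc])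
    also have "integral unit_cube (\<lambda>y. G (r *\<^sub>R (2 *\<^sub>R y - 1))) = A / (2 * r) powr n"
      unfolding A_def n_def using r by (intro integral_unit_cube_affine[OF G(1)])
    also have "integral unit_cube (\<lambda>y. norm (r *\<^sub>R (2 *\<^sub>R y - 1)) powr q * G (r *\<^sub>R (2 *\<^sub>R y - 1))) = C / (2 * r) powr n"
      unfolding C_def n_def using r by (intro integral_unit_cube_affine[OF qc])
    also have "integral unit_cube (\<lambda>x. \<bar>v (?aff x)\<bar> powr ps) = V / (2 * L) powr n"
      unfolding V[symmetric] n_def using L by (intro integral_unit_cube_affine[OF vpc])
    also have "integral unit_cube (\<lambda>x. norm ((2 * L) *\<^sub>R g (?aff x)) powr p) = (2 * L) powr p * (N / (2 * L) powr n)"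
    proof -
      have "integral unit_cube (\<lambda>x. norm ((2 * L) *\<^sub>R g (?aff x)) powr p)
          = integral unit_cube (\<lambda>x. (2 * L) powr p * norm (g (?aff x)) powr p)"
        using L by (simp add: powr_mult)
      also have "\<dots> = (2 * L) powr p * integral unit_cube (\<lambda>x. norm (g (?aff x)) powr p)" by simp
      also have "integral unit_cube (\<lambda>x. norm (g (?aff x)) powr p) = N / (2 * L) powr n"
        unfolding N[symmetric] n_def using L by (intro integral_unit_cube_affine[OF gpc])
      finally show ?thesis .
    qed
    finally have *: "2 * r * n * (W / (2 * r) powr n) * (V / (2 * L) powr n) powr (1 / ps)
      \<le> m * ((2 * L) powr p * (N / (2 * L) powr n)) powr (1 / p)
        * (A / (2 * r) powr n) powr (1 / ps) * (C / (2 * r) powr n) powr (1 / q)" .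
    \<comment> \<open>\<open>R\<close> collects the powers of \<open>2 * r\<close> and
      \<open>K\<close> those of \<open>2 * L\<close>; both sides of the rescaled inequality carry
      the same factor \<open>1 / (R * K)\<close>.\<close>
    define R where "R = (2 * r) powr (n / ps + n / q)"
    define K where "K = (2 * L) powr (n / ps)"
    have RK: "0 < R" "0 < K" using r L by (auto simp: R_def K_def)
    have e1: "2 * r * n * (W / (2 * r) powr n) * (V / (2 * L) powr n) powr (1 / ps)
        = n * W * V powr (1 / ps) / R / K"
    proof -
      have "n / ps + n / q = n * (1 / ps + 1 / q)" by (simp add: distrib_left)
      also have "1 / ps + 1 / q = 1 - 1 / n" using ps_inv q(2) by simp
      also have "n * (1 - 1 / n) = n - 1" using n by (simp add: field_simps)
      finally have "n / ps + n / q = n - 1" .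
      then have "(2 * r) powr n = R * (2 * r)" using r by (simp add: R_def powr_diff)
      moreover have "(V / (2 * L) powr n) powr (1 / ps) = V powr (1 / ps) / K"
        using L VN by (simp add: K_def powr_divide powr_powr)
      ultimately show ?thesis using r by simp
    qed
    have e2: "m * ((2 * L) powr p * (N / (2 * L) powr n)) powr (1 / p)
        * (A / (2 * r) powr n) powr (1 / ps) * (C / (2 * r) powr n) powr (1 / q)
      = m * N powr (1 / p) * A powr (1 / ps) * C powr (1 / q) / R / K"
    proof -
      have "n / ps = n * (1 / ps)" by simp
      also have "\<dots> = n / p - 1" unfolding ps_inv using n by (simp add: field_simps)
      finally have "n / ps = n / p - 1" .
      then have K: "K = (2 * L) powr (n / p) / (2 * L)" using L by (simp add: K_def powr_diff)
      have "((2 * L) powr p * (N / (2 * L) powr n)) powr (1 / p) = N powr (1 / p) / K"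
        unfolding K using L VN p by (simp add: powr_divide powr_mult powr_powr)
      moreover have "(A / (2 * r) powr n) powr (1 / ps) * (C / (2 * r) powr n) powr (1 / q)
          = A powr (1 / ps) * C powr (1 / q) / R"
        using r AC by (simp add: R_def powr_add powr_divide powr_powr)
      ultimately show ?thesis by (simp add: mult.assoc)
    qed
    have "n * W * V powr (1 / ps) \<le> m * N powr (1 / p) * A powr (1 / ps) * C powr (1 / q)"
      using * unfolding e1 e2 using RK by (simp add: divide_le_cancel)
    then show ?thesis by (simp add: W_def A_def C_def)
  qed
  let ?W = "\<lambda>k. LINT y : sym_cube (real (Suc k)) | lborel. G y powr (1 - 1 / n)"
    and ?A = "\<lambda>k. LINT y : sym_cube (real (Suc k)) | lborel. G y"
    and ?C = "\<lambda>k. LINT y : sym_cube (real (Suc k)) | lborel. norm y powr q * G y"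
    and ?B = "m * N powr (1 / p) * (LINT y | lborel. G y) powr (1 / ps) * (LINT y | lborel. norm y powr q * G y) powr (1 / q)"
  have bound: "n * ?W k * V powr (1 / ps) \<le> ?B" for k
  proof -
    have nn: "0 \<le> ?A k" "0 \<le> ?C k"
      unfolding set_lebesgue_integral_def using G(2)
      by (auto intro!: integral_nonneg_AE AE_I2 mult_nonneg_nonneg simp: less_imp_le indicator_def)
    have "n * ?W k * V powr (1 / ps) \<le> m * N powr (1 / p) * ?A k powr (1 / ps) * ?C k powr (1 / q)"
      by (rule cube) simp
    also have "\<dots> \<le> ?B"
      using m G(2) ps q nn p VN
      by (intro mult_mono powr_mono2 set_integral_le_integral int mult_nonneg_nonneg) (auto simp: less_imp_le)
    finally show ?thesis .
  qed
  have "n * (LINT y | lborel. G y powr (1 - 1 / n)) * V powr (1 / ps) \<le> ?B"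
  proof (rule tendsto_upperbound)
    show "(\<lambda>k. n * ?W k * V powr (1 / ps)) \<longlonglongrightarrow> n * (LINT y | lborel. G y powr (1 - 1 / n)) * V powr (1 / ps)"
      by (intro tendsto_mult tendsto_const tendsto_integral_sym_cube int)
  qed (use bound in auto)
  then show ?thesis by (simp add: V_def N_def)
qed

subsection \<open>Polar coordinates\<close>

text \<open>A substitute for surface measure: the volume of the part of the unit ball seen in given directions.\<close>

definition direction_measure :: "'a::euclidean_space measure" where
  "direction_measure = distr (density lborel (indicator (cball 0 1))) borel sgn"

text \<open>With the factor \<open>n\<close> the half-line up to \<open>r\<close> has mass
  \<open>r ^ n\<close>, the share of the ball of radius \<open>r\<close> relative to the unit ball.
  The volume of the unit ball is carried by \<open>direction_measure\<close>.\<close>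

definition radial_measure :: "nat \<Rightarrow> real measure" where
  "radial_measure n = density lborel (\<lambda>r. ennreal (real n * r ^ (n - 1)) * indicator {0..} r)"

lemma sets_direction_measure [simp, measurable_cong]: "sets direction_measure = sets borel"
  by (simp add: direction_measure_def)

lemma sets_radial_measure [simp, measurable_cong]: "sets (radial_measure n) = sets borel"
  by (simp add: radial_measure_def)

lemma emeasure_direction_measure:
  assumes [measurable]: "B \<in> sets borel"
  shows "emeasure direction_measure B = emeasure lborel {x :: 'a::euclidean_space. norm x \<le> 1 \<and> sgn x \<in> B}"
proof -
  have "emeasure direction_measure B = emeasure (density lborel (indicator (cball 0 1))) (sgn -` B :: 'a set)"
    unfolding direction_measure_def by (subst emeasure_distr) (auto intro!: borel_measurable_indicator)
  also have "\<dots> = (\<integral>\<^sup>+x. indicator (cball 0 1) x * indicator (sgn -` B) x \<partial>(lborel :: 'a measure))"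
    by (subst emeasure_density) (auto intro!: measurable_sets_borel[OF borel_measurable_sgn] borel_measurable_indicator)
  also have "\<dots> = (\<integral>\<^sup>+x. indicator {x. norm x \<le> 1 \<and> sgn x \<in> B} x \<partial>(lborel :: 'a measure))"
    by (intro nn_integral_cong) (auto simp: indicator_def)
  finally show ?thesis by simp
qed

lemma emeasure_direction_measure_UNIV:
  "emeasure (direction_measure :: 'a::euclidean_space measure) UNIV = ennreal (unit_ball_vol (real DIM('a)))"
proof -
  have "emeasure (direction_measure :: 'a measure) UNIV = emeasure lborel (cball (0::'a) 1)"
    by (subst emeasure_direction_measure) (auto simp: cball_def)
  then show ?thesis by (simp add: emeasure_cball)
qed

lemma finite_direction_measure: "finite_measure (direction_measure :: 'a::euclidean_space measure)"
  by standard (simp add: direction_measure_def[THEN arg_cong[where f = space]] emeasure_direction_measure_UNIV)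

lemma emeasure_radial_measure:
  assumes n: "0 < n"
  shows "emeasure (radial_measure n) {..r} = ennreal (max 0 r ^ n)"
proof -
  have "emeasure (radial_measure n) {..r}
      = (\<integral>\<^sup>+s. ennreal (real n * s ^ (n - 1)) * indicator {0..} s * indicator {..r} s \<partial>lborel)"
    unfolding radial_measure_def by (subst emeasure_density) auto
  also have "\<dots> = (\<integral>\<^sup>+s. ennreal (real n * s ^ (n - 1)) * indicator {0..r} s \<partial>lborel)"
    by (intro nn_integral_cong) (auto simp: indicator_def)
  also have "\<dots> = ennreal (max 0 r ^ n)"
  proof (cases "0 \<le> r")
    case True
    have "(\<integral>\<^sup>+s. ennreal (real n * s ^ (n - 1)) * indicator {0..r} s \<partial>lborel) = ennreal (r ^ n - 0 ^ n)"
      using True by (intro nn_integral_FTC_Icc) (auto intro!: derivative_eq_intros)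
    then show ?thesis using True n by simp
  qed (use n in \<open>simp add: max_def\<close>)
  finally show ?thesis .
qed

text \<open>Homogeneity of Lebesgue measure: for \<open>r > 0\<close> the set is the dilate by
  \<open>r\<close> of its counterpart in the unit ball, and otherwise it contains at most the
  origin.\<close>

lemma emeasure_cone:
  assumes [measurable]: "B \<in> sets borel"
  shows "emeasure lborel {x :: 'a::euclidean_space. norm x \<le> r \<and> sgn x \<in> B}
    = ennreal (max 0 r ^ DIM('a)) * emeasure direction_measure B"
proof (cases "0 < r")
  case True
  have [measurable]: "{x :: 'a. norm x \<le> r \<and> sgn x \<in> B} \<in> sets borel" by measurable
  have "emeasure lborel {x :: 'a. norm x \<le> r \<and> sgn x \<in> B}
      = emeasure (density (distr lborel borel (\<lambda>x. 0 + r *\<^sub>R x)) (\<lambda>_. ennreal (\<bar>r\<bar> ^ DIM('a)))) {x :: 'a. norm x \<le> r \<and> sgn x \<in> B}"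
    using lborel_affine[of r "0::'a"] True by simp
  also have "\<dots> = ennreal (r ^ DIM('a)) * emeasure lborel ((\<lambda>x. r *\<^sub>R x) -` {x :: 'a. norm x \<le> r \<and> sgn x \<in> B})"
    using True by (subst emeasure_density) (auto simp: nn_integral_cmult_indicator emeasure_distr)
  also have "(\<lambda>x. r *\<^sub>R x) -` {x :: 'a. norm x \<le> r \<and> sgn x \<in> B} = {x. norm x \<le> 1 \<and> sgn x \<in> B}"
    using True by (auto simp: sgn_scaleR mult_le_cancel_left1)
  finally show ?thesis using True by (simp add: emeasure_direction_measure)
next
  case False
  have "emeasure lborel {x :: 'a. norm x \<le> r \<and> sgn x \<in> B} \<le> emeasure lborel {0 :: 'a}"
  proof (intro emeasure_mono subsetI)
    fix x :: 'a assume "x \<in> {x. norm x \<le> r \<and> sgn x \<in> B}"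
    then have "norm x \<le> r" by simp
    then have "norm x \<le> 0" using False by linarith
    then show "x \<in> {0}" by simp
  qed simp
  then show ?thesis using False by (simp add: max_def)
qed

text \<open>For fixed \<open>B\<close> both sides are measures in \<open>A\<close>. They agree on
  half-lines by \<open>emeasure_cone\<close>, and half-lines are an intersection-stable generator
  with finite masses.\<close>

lemma polar_measure:
  "radial_measure DIM('a) \<Otimes>\<^sub>M direction_measure
    = distr lborel (borel \<Otimes>\<^sub>M borel) (\<lambda>x :: 'a::euclidean_space. (norm x, sgn x))"
proof (rule pair_measure_eqI)
  show "sigma_finite_measure (radial_measure DIM('a))"
    unfolding radial_measure_def
    by (subst sigma_finite_measure.sigma_finite_iff_density_finite[OF sigma_finite_lborel]) (auto simp: indicator_def)
  show "sigma_finite_measure (direction_measure :: 'a measure)"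
    by (rule finite_measure.axioms(1)[OF finite_direction_measure])
  show "sets (radial_measure DIM('a) \<Otimes>\<^sub>M (direction_measure :: 'a measure))
      = sets (distr lborel (borel \<Otimes>\<^sub>M borel) (\<lambda>x :: 'a. (norm x, sgn x)))"
    by (simp cong: sets_pair_measure_cong)
  fix A :: "real set" and B :: "'a set"
  assume "A \<in> sets (radial_measure DIM('a))" and "B \<in> sets direction_measure"
  then have [measurable]: "A \<in> sets borel" "B \<in> sets borel" by simp_all
  let ?c = "emeasure direction_measure B"
  have c: "?c \<noteq> \<infinity>" using finite_measure.emeasure_finite[OF finite_direction_measure] by simp
  let ?M = "density (radial_measure DIM('a)) (\<lambda>_. ?c)"
  let ?N = "distr (density lborel (indicator {x :: 'a. sgn x \<in> B})) borel norm"
  have N: "emeasure ?N A = emeasure lborel {x :: 'a. norm x \<in> A \<and> sgn x \<in> B}"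
    if [measurable]: "A \<in> sets borel" for A
  proof -
    have "(norm :: 'a \<Rightarrow> real) \<in> borel_measurable borel" by measurable
    from measurable_sets[OF this, of A] have [measurable]: "(norm -` A :: 'a set) \<in> sets borel" by simp
    have [measurable]: "{x :: 'a. norm x \<in> A \<and> sgn x \<in> B} \<in> sets borel" "{x :: 'a. sgn x \<in> B} \<in> sets borel"
      by measurable
    have "emeasure ?N A = emeasure (density lborel (indicator {x :: 'a. sgn x \<in> B})) (norm -` A)"
      by (subst emeasure_distr) auto
    also have "\<dots> = (\<integral>\<^sup>+x. indicator {x :: 'a. sgn x \<in> B} x * indicator (norm -` A) x \<partial>lborel)"
      by (subst emeasure_density) (auto intro!: borel_measurable_indicator)
    also have "\<dots> = (\<integral>\<^sup>+x. indicator {x :: 'a. norm x \<in> A \<and> sgn x \<in> B} x \<partial>lborel)"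
      by (intro nn_integral_cong) (auto simp: indicator_def)
    finally show ?thesis by simp
  qed
  have M: "emeasure ?M A = ?c * emeasure (radial_measure DIM('a)) A" if "A \<in> sets borel" for A
    using that by (subst emeasure_density) (auto simp: nn_integral_cmult_indicator)
  have "?M = ?N"
  proof (rule measure_eqI_generator_eq[where E = "range atMost" and \<Omega> = UNIV and A = "\<lambda>i. {..real i}"])
    show "Int_stable (range atMost :: real set set)"
      by (auto simp: Int_stable_def)
    fix X :: "real set" assume "X \<in> range atMost"
    then obtain r where X: "X = {..r}" by auto
    show "emeasure ?M X = emeasure ?N X"
      using emeasure_cone[of B r] by (simp add: X M N emeasure_radial_measure mult.commute)
  next
    show "(\<Union>i. {..real i}) = UNIV" by (auto intro: real_arch_simple)
    show "emeasure ?M {..real i} \<noteq> \<infinity>" for i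
      using c by (auto simp: M emeasure_radial_measure ennreal_mult_eq_top_iff)
  qed (auto simp: borel_eq_atMost)
  then have "emeasure ?M A = emeasure ?N A" by simp
  then have "emeasure (radial_measure DIM('a)) A * ?c = emeasure lborel {x :: 'a. norm x \<in> A \<and> sgn x \<in> B}"
    by (simp add: N M mult.commute)
  also have "\<dots> = emeasure (distr lborel (borel \<Otimes>\<^sub>M borel) (\<lambda>x :: 'a. (norm x, sgn x))) (A \<times> B)"
    by (subst emeasure_distr) (auto intro!: arg_cong[where f = "emeasure lborel"])
  finally show "emeasure (radial_measure DIM('a)) A * ?c
      = emeasure (distr lborel (borel \<Otimes>\<^sub>M borel) (\<lambda>x :: 'a. (norm x, sgn x))) (A \<times> B)" .
qed

theorem nn_integral_polar:
  fixes \<phi> :: "real \<times> 'a::euclidean_space \<Rightarrow> ennreal"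
  assumes [measurable]: "\<phi> \<in> borel_measurable (borel \<Otimes>\<^sub>M borel)"
  shows "(\<integral>\<^sup>+x. \<phi> (norm x, sgn x) \<partial>lborel) =
    (\<integral>\<^sup>+r. ennreal (real DIM('a) * r ^ (DIM('a) - 1)) * indicator {0..} r * (\<integral>\<^sup>+\<omega>. \<phi> (r, \<omega>) \<partial>direction_measure) \<partial>lborel)"
proof -
  interpret D: sigma_finite_measure "direction_measure :: 'a measure"
    by (rule finite_measure.axioms(1)[OF finite_direction_measure])
  have "(\<integral>\<^sup>+x. \<phi> (norm x, sgn x) \<partial>lborel) = (\<integral>\<^sup>+z. \<phi> z \<partial>(radial_measure DIM('a) \<Otimes>\<^sub>M direction_measure))"
    unfolding polar_measure by (subst nn_integral_distr) auto
  also have "\<dots> = (\<integral>\<^sup>+r. (\<integral>\<^sup>+\<omega>. \<phi> (r, \<omega>) \<partial>direction_measure) \<partial>radial_measure DIM('a))"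
    by (rule D.nn_integral_fst[symmetric]) (simp cong: measurable_cong_sets)
  also have "\<dots> = (\<integral>\<^sup>+r. ennreal (real DIM('a) * r ^ (DIM('a) - 1)) * indicator {0..} r * (\<integral>\<^sup>+\<omega>. \<phi> (r, \<omega>) \<partial>direction_measure) \<partial>lborel)"
    unfolding radial_measure_def by (subst nn_integral_density) auto
  finally show ?thesis .
qed

section \<open>Substitution in the radius\<close>

text \<open>The last clause exhausts \<open>J\<close> by nested compact intervals of positive
  length: substitution is carried out on each of them and passes to \<open>J\<close> by monotone
  convergence. Measurability is asked for on the whole line because the functions have unspecific
  values outside \<open>J\<close>.\<close>

definition increasing_diffeo ::
    "(real \<Rightarrow> real) \<Rightarrow> (real \<Rightarrow> real) \<Rightarrow> real set \<Rightarrow> real set \<Rightarrow> bool" where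
  "increasing_diffeo h h' J J' \<longleftrightarrow>
     h \<in> borel_measurable borel \<and> h' \<in> borel_measurable borel \<and>
     (\<forall>r\<in>J. DERIV h r :> h' r \<and> 0 \<le> h' r) \<and> continuous_on J h' \<and> h ` J = J' \<and> mono_on J h \<and>
     (\<exists>a b :: nat \<Rightarrow> real. decseq a \<and> incseq b \<and> (\<forall>k. a k < b k) \<and> (\<Union>k. {a k..b k}) = J)"

lemma open_interval_exhaustion:
  assumes R: "0 < (R::real)"
  shows "\<exists>a b :: nat \<Rightarrow> real. decseq a \<and> incseq b \<and> (\<forall>k. a k < b k) \<and> (\<Union>k. {a k..b k}) = {0<..<R}"
proof (intro exI conjI allI)
  \<comment> \<open>The shift by 3 makes \<open>2 * R / (k + 3)\<close> smaller than
    \<open>R\<close> already for \<open>k = 0\<close>, so all intervals have positive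
    length.\<close>
  show "decseq (\<lambda>k. R / real (k + 3))" using R by (auto simp: decseq_def intro!: divide_left_mono)
  show "incseq (\<lambda>k. R - R / real (k + 3))" using R by (auto simp: incseq_def intro!: divide_left_mono)
  show "R / real (k + 3) < R - R / real (k + 3)" for k using R by (simp add: field_simps add_pos_nonneg)
  show "(\<Union>k. {R / real (k + 3)..R - R / real (k + 3)}) = {0<..<R}"
  proof (intro equalityI subsetI)
    fix t :: real assume "t \<in> {0<..<R}"
    then have t: "0 < min t (R - t)" by auto
    obtain k :: nat where k: "R / min t (R - t) < real k" using reals_Archimedean2 by blast
    have "R / real (k + 3) \<le> R / (R / min t (R - t))"
      using t k R by (intro divide_left_mono) auto
    then have "R / real (k + 3) \<le> min t (R - t)" using R by simp
    then have "t \<in> {R / real (k + 3)..R - R / real (k + 3)}" by auto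
    then show "t \<in> (\<Union>k. {R / real (k + 3)..R - R / real (k + 3)})" by blast
  next
    fix t :: real assume "t \<in> (\<Union>k. {R / real (k + 3)..R - R / real (k + 3)})"
    then obtain k where k: "R / real (k + 3) \<le> t" "t \<le> R - R / real (k + 3)" by auto
    define c where "c = R / real (k + 3)"
    have "0 < c" using R by (simp add: c_def)
    then show "t \<in> {0<..<R}" using k unfolding c_def[symmetric] by auto
  qed
qed

lemma nn_integral_increasing_union:
  fixes f :: "'a \<Rightarrow> ennreal"
  assumes [measurable]: "f \<in> borel_measurable M" and A: "range A \<subseteq> sets M" "incseq A"
  shows "(SUP k::nat. \<integral>\<^sup>+x. f x * indicator (A k) x \<partial>M) = (\<integral>\<^sup>+x. f x * indicator (\<Union>k. A k) x \<partial>M)"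
proof -
  have "(SUP k. emeasure (density M f) (A k)) = emeasure (density M f) (\<Union>k. A k)"
    by (rule SUP_emeasure_incseq) (use A in auto)
  moreover have "emeasure (density M f) (A k) = (\<integral>\<^sup>+x. f x * indicator (A k) x \<partial>M)" for k
    using A by (subst emeasure_density) auto
  moreover have "emeasure (density M f) (\<Union>k. A k) = (\<integral>\<^sup>+x. f x * indicator (\<Union>k. A k) x \<partial>M)"
    using A by (subst emeasure_density) auto
  ultimately show ?thesis by simp
qed

lemma nn_integral_increasing_diffeo:
  fixes f :: "real \<Rightarrow> ennreal"
  assumes h: "increasing_diffeo h h' J J'" and [measurable]: "f \<in> borel_measurable borel"
  shows "(\<integral>\<^sup>+s. f s * indicator J' s \<partial>lborel) = (\<integral>\<^sup>+r. f (h r) * ennreal (h' r) * indicator J r \<partial>lborel)"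
proof -
  obtain a b :: "nat \<Rightarrow> real" where ab: "decseq a" "incseq b" "\<And>k. a k < b k" "(\<Union>k. {a k..b k}) = J"
    and [measurable]: "h \<in> borel_measurable borel" "h' \<in> borel_measurable borel"
    and d: "\<And>r. r \<in> J \<Longrightarrow> DERIV h r :> h' r" "\<And>r. r \<in> J \<Longrightarrow> 0 \<le> h' r" and c: "continuous_on J h'"
    and im: "h ` J = J'" and mono: "mono_on J h"
    using h unfolding increasing_diffeo_def by blast
  have sub: "{a k..b k} \<subseteq> J" for k using ab(4) by blast
  have inc: "incseq (\<lambda>k. {a k..b k})"
    using ab(1,2) by (auto simp: incseq_def decseq_def intro: order.trans)
  have im_k: "h ` {a k..b k} = {h (a k)..h (b k)}" for k
  proof -
    have ends: "a k \<in> J" "b k \<in> J" using sub[of k] ab(3)[of k] by auto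
    have "h ` {a k..b k} \<subseteq> {h (a k)..h (b k)}"
      using sub[of k] ends mono by (auto simp: mono_on_def subset_eq)
    moreover have "y \<in> h ` {a k..b k}" if "y \<in> {h (a k)..h (b k)}" for y
    proof -
      have "continuous_on {a k..b k} h"
        by (rule DERIV_continuous_on[where D = h'], rule has_field_derivative_at_within, rule d(1)) (use sub[of k] in auto)
      with that ab(3)[of k] obtain x where "a k \<le> x" "x \<le> b k" "h x = y"
        using IVT'[of h "a k" y "b k"] by auto
      then show ?thesis by (intro image_eqI[of _ _ x]) auto
    qed
    ultimately show ?thesis by blast
  qed
  have inc': "incseq (\<lambda>k. {h (a k)..h (b k)})"
    using inc unfolding im_k[symmetric] incseq_def by (blast intro: image_mono)
  have un': "(\<Union>k. {h (a k)..h (b k)}) = J'"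
    unfolding im_k[symmetric] using ab(4) im by blast
  have "(\<integral>\<^sup>+s. f s * indicator J' s \<partial>lborel) = (SUP k. \<integral>\<^sup>+s. f s * indicator {h (a k)..h (b k)} s \<partial>lborel)"
    unfolding un'[symmetric] by (rule nn_integral_increasing_union[symmetric, OF _ _ inc']) auto
  also have "\<dots> = (SUP k. \<integral>\<^sup>+r. f (h r) * ennreal (h' r) * indicator {a k..b k} r \<partial>lborel)"
  proof (intro SUP_cong refl)
    fix k
    show "(\<integral>\<^sup>+s. f s * indicator {h (a k)..h (b k)} s \<partial>lborel) = (\<integral>\<^sup>+r. f (h r) * ennreal (h' r) * indicator {a k..b k} r \<partial>lborel)"
      using sub[of k] by (intro nn_integral_substitution_aux d continuous_on_subset[OF c] ab(3)) auto
  qed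
  also have "\<dots> = (\<integral>\<^sup>+r. f (h r) * ennreal (h' r) * indicator J r \<partial>lborel)"
    unfolding ab(4)[symmetric] by (rule nn_integral_increasing_union[OF _ _ inc]) auto
  finally show ?thesis .
qed

text \<open>In polar coordinates only the radius is substituted. The factor \<open>h'\<close> comes
  from the one-dimensional rule, and the old and new radial densities combine to a power of
  \<open>h r / r\<close>, the stretching in the tangential directions.\<close>

theorem nn_integral_radial_substitution:
  fixes F :: "'a::euclidean_space \<Rightarrow> ennreal"
  assumes h: "increasing_diffeo h h' J J'" and J: "J \<subseteq> {0<..}" "J' \<subseteq> {0<..}"
    and [measurable]: "F \<in> borel_measurable borel" "J \<in> sets borel" "J' \<in> sets borel"
  shows "(\<integral>\<^sup>+x. F x * indicator J' (norm x) \<partial>lborel) =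
    (\<integral>\<^sup>+x. F (h (norm x) *\<^sub>R sgn x) * ennreal ((h (norm x) / norm x) ^ (DIM('a) - 1) * h' (norm x))
      * indicator J (norm x) \<partial>lborel)"
proof -
  have [measurable]: "h \<in> borel_measurable borel" "h' \<in> borel_measurable borel"
    and im: "h ` J = J'" and pos: "\<And>r. r \<in> J \<Longrightarrow> 0 \<le> h' r"
    using h unfolding increasing_diffeo_def by blast+
  interpret D: sigma_finite_measure "direction_measure :: 'a measure"
    by (rule finite_measure.axioms(1)[OF finite_direction_measure])
  let ?n = "DIM('a)"
  define \<Psi> where "\<Psi> s = (\<integral>\<^sup>+\<omega>. F (s *\<^sub>R \<omega>) \<partial>(direction_measure :: 'a measure))" for s
  have [measurable]: "\<Psi> \<in> borel_measurable borel"
    unfolding \<Psi>_def by measurable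
  have decomp: "norm x *\<^sub>R sgn x = x" for x :: 'a by (cases "x = 0") (simp_all add: sgn_div_norm)
  have "(\<integral>\<^sup>+x. F x * indicator J' (norm x) \<partial>lborel)
      = (\<integral>\<^sup>+x. (case (norm x, sgn x) of (r, \<omega>) \<Rightarrow> F (r *\<^sub>R \<omega>) * indicator J' r) \<partial>lborel)"
    by (simp add: decomp)
  also have "\<dots> = (\<integral>\<^sup>+s. ennreal (real ?n * s ^ (?n - 1)) * indicator {0..} s
      * (\<integral>\<^sup>+\<omega>. (case (s, \<omega>) of (r, \<omega>) \<Rightarrow> F (r *\<^sub>R \<omega>) * indicator J' r) \<partial>(direction_measure :: 'a measure)) \<partial>lborel)"
    by (rule nn_integral_polar) measurable
  also have "\<dots> = (\<integral>\<^sup>+s. (ennreal (real ?n * s ^ (?n - 1)) * \<Psi> s) * indicator J' s \<partial>lborel)"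
  proof (intro nn_integral_cong)
    fix s
    have "(\<integral>\<^sup>+\<omega>. (case (s, \<omega>) of (r, \<omega>) \<Rightarrow> F (r *\<^sub>R \<omega>) * indicator J' r) \<partial>(direction_measure :: 'a measure)) = \<Psi> s * indicator J' s"
      unfolding \<Psi>_def by (simp add: nn_integral_multc)
    then show "ennreal (real ?n * s ^ (?n - 1)) * indicator {0..} s
      * (\<integral>\<^sup>+\<omega>. (case (s, \<omega>) of (r, \<omega>) \<Rightarrow> F (r *\<^sub>R \<omega>) * indicator J' r) \<partial>(direction_measure :: 'a measure))
      = (ennreal (real ?n * s ^ (?n - 1)) * \<Psi> s) * indicator J' s"
      using J(2) by (auto simp: indicator_def subset_eq)
  qed
  also have "\<dots> = (\<integral>\<^sup>+r. (ennreal (real ?n * h r ^ (?n - 1)) * \<Psi> (h r)) * ennreal (h' r) * indicator J r \<partial>lborel)"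
    by (rule nn_integral_increasing_diffeo[OF h]) measurable
  also have "\<dots> = (\<integral>\<^sup>+r. ennreal (real ?n * r ^ (?n - 1)) * indicator {0..} r
      * (\<integral>\<^sup>+\<omega>. (case (r, \<omega>) of (r, \<omega>) \<Rightarrow> F (h r *\<^sub>R \<omega>) * ennreal ((h r / r) ^ (?n - 1) * h' r) * indicator J r)
        \<partial>(direction_measure :: 'a measure)) \<partial>lborel)"
  proof (intro nn_integral_cong)
    fix r
    have "(\<integral>\<^sup>+\<omega>. (case (r, \<omega>) of (r, \<omega>) \<Rightarrow> F (h r *\<^sub>R \<omega>) * ennreal ((h r / r) ^ (?n - 1) * h' r) * indicator J r) \<partial>(direction_measure :: 'a measure))
        = \<Psi> (h r) * ennreal ((h r / r) ^ (?n - 1) * h' r) * indicator J r"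
      unfolding \<Psi>_def by (simp add: nn_integral_multc mult.assoc)
    moreover have "ennreal (real ?n * h r ^ (?n - 1)) * \<Psi> (h r) * ennreal (h' r)
        = ennreal (real ?n * r ^ (?n - 1)) * (\<Psi> (h r) * ennreal ((h r / r) ^ (?n - 1) * h' r))" if r: "r \<in> J"
    proof -
      have rp: "0 < r" "0 < h r" using r J im by auto
      have "ennreal (real ?n * h r ^ (?n - 1)) * ennreal (h' r)
          = ennreal (real ?n * r ^ (?n - 1)) * ennreal ((h r / r) ^ (?n - 1) * h' r)"
        using rp pos[OF r] by (simp add: ennreal_mult'[symmetric] power_divide)
      then have "ennreal (real ?n * h r ^ (?n - 1)) * ennreal (h' r) * \<Psi> (h r)
          = ennreal (real ?n * r ^ (?n - 1)) * ennreal ((h r / r) ^ (?n - 1) * h' r) * \<Psi> (h r)" by simp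
      then show ?thesis by (simp only: mult_ac)
    qed
    ultimately show "ennreal (real ?n * h r ^ (?n - 1)) * \<Psi> (h r) * ennreal (h' r) * indicator J r
        = ennreal (real ?n * r ^ (?n - 1)) * indicator {0..} r
      * (\<integral>\<^sup>+\<omega>. (case (r, \<omega>) of (r, \<omega>) \<Rightarrow> F (h r *\<^sub>R \<omega>) * ennreal ((h r / r) ^ (?n - 1) * h' r) * indicator J r)
        \<partial>(direction_measure :: 'a measure))"
      using J(1) by (auto simp: indicator_def subset_eq)
  qed
  also have "\<dots> = (\<integral>\<^sup>+x. (case (norm x, sgn x) of (r, \<omega>) \<Rightarrow> F (h r *\<^sub>R \<omega>) * ennreal ((h r / r) ^ (?n - 1) * h' r) * indicator J r) \<partial>(lborel :: 'a measure))"
    by (rule nn_integral_polar[symmetric]) measurable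
  finally show ?thesis by simp
qed

subsection \<open>Integrals of the extremal functions\<close>

lemma nn_integral_radial:
  fixes \<phi> :: "real \<Rightarrow> ennreal"
  assumes [measurable]: "\<phi> \<in> borel_measurable borel"
  shows "(\<integral>\<^sup>+x. \<phi> (norm (x :: 'a::euclidean_space)) \<partial>lborel) =
    ennreal (real DIM('a) * unit_ball_vol (real DIM('a))) * (\<integral>\<^sup>+r. ennreal (r powr (real DIM('a) - 1)) * \<phi> r * indicator {0<..} r \<partial>lborel)"
proof -
  let ?n = "DIM('a)"
  have "(\<integral>\<^sup>+x. \<phi> (norm (x :: 'a)) \<partial>lborel) = (\<integral>\<^sup>+x. (\<lambda>z. \<phi> (fst z)) (norm x, sgn (x :: 'a)) \<partial>lborel)"
    by simp
  also have "\<dots> = (\<integral>\<^sup>+r. ennreal (real ?n * r ^ (?n - 1)) * indicator {0..} r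
      * (\<integral>\<^sup>+\<omega>. \<phi> (fst (r, \<omega>)) \<partial>(direction_measure :: 'a measure)) \<partial>lborel)"
    by (rule nn_integral_polar) measurable
  also have "\<dots> = (\<integral>\<^sup>+r. ennreal (real ?n * unit_ball_vol (real ?n)) * (ennreal (r powr (real ?n - 1)) * \<phi> r * indicator {0<..} r) \<partial>lborel)"
  proof (rule nn_integral_cong_AE)
    have sp: "space (direction_measure :: 'a measure) = UNIV" by (simp add: direction_measure_def)
    \<comment> \<open>The indicators of \<open>{0..}\<close> and \<open>{0<..}\<close> differ at 0,
      and so may the integer power and \<open>powr\<close>; the point is discarded as a null
      set.\<close>
    have "AE r in lborel. r \<noteq> (0::real)" by (rule AE_lborel_singleton)
    then show "AE r in lborel. ennreal (real ?n * r ^ (?n - 1)) * indicator {0..} r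
      * (\<integral>\<^sup>+\<omega>. \<phi> (fst (r, \<omega>)) \<partial>(direction_measure :: 'a measure))
      = ennreal (real ?n * unit_ball_vol (real ?n)) * (ennreal (r powr (real ?n - 1)) * \<phi> r * indicator {0<..} r)"
    proof eventually_elim
      case (elim r)
      show ?case
      proof (cases "0 < r")
        case True
        have "r ^ (?n - 1) = r powr (real ?n - 1)"
          using True DIM_positive[where 'a = 'a] by (simp add: powr_realpow[symmetric] of_nat_diff Suc_leI)
        then show ?thesis
          using True by (simp add: sp emeasure_direction_measure_UNIV ennreal_mult mult_ac)
      qed (use elim in auto)
    qed
  qed
  also have "\<dots> = ennreal (real ?n * unit_ball_vol (real ?n)) * (\<integral>\<^sup>+r. ennreal (r powr (real ?n - 1)) * \<phi> r * indicator {0<..} r \<partial>lborel)"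
    by (rule nn_integral_cmult) measurable
  finally show ?thesis .
qed

lemma Beta_pos_real: "0 < s \<Longrightarrow> 0 < t \<Longrightarrow> 0 < Beta s (t :: real)"
  by (simp add: Beta_def Gamma_real_pos)

lemma Gamma_plus1_pos: "0 < s \<Longrightarrow> Gamma (s + 1) = s * Gamma (s :: real)"
  by (rule Gamma_plus1) (auto dest: nonpos_Ints_nonpos)

lemma nn_integral_Beta:
  fixes s t :: real
  assumes "0 < s" "0 < t"
  shows "(\<integral>\<^sup>+u. ennreal (u powr (s - 1) * (1 - u) powr (t - 1)) * indicator {0<..<1} u \<partial>lborel) = ennreal (Beta s t)"
proof -
  have "(\<integral>\<^sup>+u. ennreal (u powr (s - 1) * (1 - u) powr (t - 1)) * indicator {0<..<1} u \<partial>lborel)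
      = (\<integral>\<^sup>+u. ennreal (u powr (s - 1) * (1 - u) powr (t - 1)) * indicator {0..1} u \<partial>lborel)"
    by (intro nn_integral_cong) (auto simp: indicator_def le_less)
  also have "\<dots> = ennreal (Beta s t)"
    by (rule nn_integral_has_integral_lebesgue'[OF _ has_integral_Beta_real]) (use assms in auto)
  finally show ?thesis .
qed

text \<open>The substitution t = b r^q / (a + b r^q) maps the half-line to the unit interval. It
  gives a + b r^q = a / (1 - t) and dr / r = dt / (q t (1 - t)), which leaves a Beta
  integral.\<close>

lemma nn_integral_powr_rational:
  fixes a b q \<mu> N :: real
  assumes a: "0 < a" and b: "0 < b" and q: "0 < q" and \<mu>: "0 < \<mu>" "\<mu> / q < N"
  shows "(\<integral>\<^sup>+r. ennreal (r powr (\<mu> - 1) * (a + b * r powr q) powr (- N)) * indicator {0<..} r \<partial>lborel)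
    = ennreal (a powr (\<mu> / q - N) * b powr (- (\<mu> / q)) * Beta (\<mu> / q) (N - \<mu> / q) / q)"
proof -
  define X where "X t = a / b * (t / (1 - t))" for t :: real
  define h where "h t = X t powr (1 / q)" for t
  define h' where "h' t = h t / (q * t * (1 - t))" for t :: real
  have Xpos: "0 < X t" if "0 < t" "t < 1" for t
    using that a b by (simp add: X_def)
  have h0: "0 < h t" if "0 < t" "t < 1" for t
    using Xpos[OF that] by (simp add: h_def)
  have deriv: "DERIV h t :> h' t" if t: "0 < t" "t < 1" for t
  proof -
    define w where "w = 1 - t"
    have w: "w \<noteq> 0" "1 - t = w" using t by (auto simp: w_def)
    have "DERIV (\<lambda>t. t / (1 - t)) t :> (1 * (1 - t) - t * (0 - 1)) / ((1 - t) * (1 - t))"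
      by (rule DERIV_divide DERIV_ident DERIV_diff DERIV_const)+ (use t in simp)
    then have d: "DERIV X t :> a / b * (1 / (w * w))"
      unfolding X_def by (intro DERIV_cmult) (simp add: w_def)
    have "DERIV h t :> (1 / q) * X t powr (1 / q - of_nat 1) * (a / b * (1 / (w * w)))"
      unfolding h_def by (rule DERIV_fun_powr[OF d Xpos[OF t]])
    also have "a / b * (1 / (w * w)) = X t / (t * w)"
      using t w by (simp add: X_def)
    also have "(1 / q) * X t powr (1 / q - of_nat 1) * (X t / (t * w)) = h' t"
      using Xpos[OF t] by (simp add: h'_def h_def powr_diff w(2))
    finally show ?thesis .
  qed
  have diffeo: "increasing_diffeo h h' {0<..<1} {0<..}"
    unfolding increasing_diffeo_def
  proof (intro conjI ballI)
    show [measurable]: "h \<in> borel_measurable borel" unfolding h_def X_def by measurable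
    show "h' \<in> borel_measurable borel" unfolding h'_def by measurable
    show "DERIV h t :> h' t" if "t \<in> {0<..<1}" for t using deriv that by auto
    show "0 \<le> h' t" if "t \<in> {0<..<1}" for t using h0[of t] that q by (simp add: h'_def)
    show "continuous_on {0<..<1} h'"
      unfolding h'_def h_def X_def using a b q by (intro continuous_intros) auto
    show "mono_on {0<..<1} h"
      unfolding mono_on_def h_def X_def
    proof (intro allI impI powr_mono2)
      fix s t :: real assume "s \<in> {0<..<1} \<and> t \<in> {0<..<1} \<and> s \<le> t"
      then show "a / b * (s / (1 - s)) \<le> a / b * (t / (1 - t))" "0 \<le> a / b * (s / (1 - s))"
        using a b by (auto intro!: mult_left_mono frac_le mult_nonneg_nonneg divide_nonneg_nonneg)
    qed (use q in auto)
    show "h ` {0<..<1} = {0<..}"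
    proof (intro equalityI subsetI)
      fix r :: real assume "r \<in> {0<..}"
      then have r: "0 < r" by simp
      define t where "t = b * r powr q / (a + b * r powr q)"
      have P: "0 < b * r powr q" using b r by simp
      have t: "0 < t" "t < 1" unfolding t_def using P a by auto
      have "1 - t = a / (a + b * r powr q)"
        unfolding t_def using a P by (simp add: field_simps)
      then have "X t = r powr q"
        unfolding X_def t_def using a b P by simp
      then have "h t = r" unfolding h_def using r q by (simp add: powr_powr)
      then show "r \<in> h ` {0<..<1}" using t by (intro image_eqI[of _ _ t]) auto
    qed (use h0 in auto)
    show "\<exists>a b :: nat \<Rightarrow> real. decseq a \<and> incseq b \<and> (\<forall>k. a k < b k) \<and> (\<Union>k. {a k..b k}) = {0<..<1}"
      by (rule open_interval_exhaustion) simp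
  qed
  let ?c = "a powr (\<mu> / q - N) * b powr (- (\<mu> / q)) / q"
  have c: "0 \<le> ?c" using q by simp
  have "(\<integral>\<^sup>+r. ennreal (r powr (\<mu> - 1) * (a + b * r powr q) powr (- N)) * indicator {0<..} r \<partial>lborel)
      = (\<integral>\<^sup>+t. ennreal (h t powr (\<mu> - 1) * (a + b * h t powr q) powr (- N)) * ennreal (h' t) * indicator {0<..<1} t \<partial>lborel)"
    by (rule nn_integral_increasing_diffeo[OF diffeo]) measurable
  also have "\<dots> = (\<integral>\<^sup>+t. ennreal ?c * (ennreal (t powr (\<mu> / q - 1) * (1 - t) powr (N - \<mu> / q - 1)) * indicator {0<..<1} t) \<partial>lborel)"
  proof (intro nn_integral_cong)
    fix t :: real
    show "ennreal (h t powr (\<mu> - 1) * (a + b * h t powr q) powr (- N)) * ennreal (h' t) * indicator {0<..<1} t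
      = ennreal ?c * (ennreal (t powr (\<mu> / q - 1) * (1 - t) powr (N - \<mu> / q - 1)) * indicator {0<..<1} t)"
    proof (cases "t \<in> {0<..<1}")
      case True
      then have t: "0 < t" "t < 1" by auto
      define w \<kappa> where "w = 1 - t" and "\<kappa> = \<mu> / q"
      have w: "0 < w" "1 - t = w" using t by (auto simp: w_def)
      have "h t powr q = X t"
        unfolding h_def using Xpos[OF t] q by (simp add: powr_powr)
      then have "b * h t powr q = a * (t / w)"
        using b by (simp add: X_def w(2))
      moreover have "a + a * (t / w) = a * ((w + t) / w)"
        using w(1) by (simp add: add_divide_distrib distrib_left)
      moreover have "w + t = 1" by (simp add: w_def)
      ultimately have e: "a + b * h t powr q = a / w" by simp
      have hm: "h t powr (\<mu> - 1) * h t = X t powr (\<mu> / q)"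
      proof -
        have "h t powr (\<mu> - 1) * h t = h t powr \<mu>" using h0[OF t] by (simp add: powr_diff)
        also have "\<dots> = X t powr (\<mu> / q)" unfolding h_def by (simp add: powr_powr)
        finally show ?thesis .
      qed
      have "h t powr (\<mu> - 1) * (a + b * h t powr q) powr (- N) * h' t
          = (h t powr (\<mu> - 1) * h t) * (a / w) powr (- N) / (q * t * w)"
        by (simp add: e h'_def w(2))
      also have "\<dots> = ?c * (t powr (\<mu> / q - 1) * (1 - t) powr (N - \<mu> / q - 1))"
        unfolding hm X_def w(2) \<kappa>_def[symmetric] using a b t q w(1)
        by (simp add: powr_divide powr_mult powr_diff powr_minus field_simps powr_add)
      finally show ?thesis
        using True h0[OF t] q t by (simp add: ennreal_mult''[symmetric] h'_def mult.assoc[symmetric] del: times_divide_eq_right)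
    qed simp
  qed
  also have "\<dots> = ennreal ?c * (\<integral>\<^sup>+t. ennreal (t powr (\<mu> / q - 1) * (1 - t) powr (N - \<mu> / q - 1)) * indicator {0<..<1} t \<partial>lborel)"
    by (rule nn_integral_cmult) measurable
  also have "\<dots> = ennreal ?c * ennreal (Beta (\<mu> / q) (N - \<mu> / q))"
    using \<mu> q by (subst nn_integral_Beta) auto
  also have "\<dots> = ennreal (?c * Beta (\<mu> / q) (N - \<mu> / q))"
    using c by (intro ennreal_mult'[symmetric])
  finally show ?thesis by simp
qed

lemma has_bochner_integral_radial_powr_rational:
  fixes a b q k N :: real
  defines "n \<equiv> real DIM('a::euclidean_space)"
  assumes a: "0 < a" and b: "0 < b" and q: "0 < q" and k: "0 \<le> k" "(n + k) / q < N"
  shows "has_bochner_integral lborel (\<lambda>y :: 'a. norm y powr k * (a + b * norm y powr q) powr (- N))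
    (n * unit_ball_vol n * (a powr ((n + k) / q - N) * b powr (- ((n + k) / q)) * Beta ((n + k) / q) (N - (n + k) / q) / q))"
proof (rule has_bochner_integral_nn_integral)
  have n: "0 < n" by (simp add: n_def)
  have beta: "0 \<le> Beta ((n + k) / q) (N - (n + k) / q)"
    using n k q by (intro less_imp_le Beta_pos_real) (auto intro: divide_pos_pos add_pos_nonneg)
  show "0 \<le> n * unit_ball_vol n * (a powr ((n + k) / q - N) * b powr (- ((n + k) / q)) * Beta ((n + k) / q) (N - (n + k) / q) / q)"
    using n q beta by (auto intro!: mult_nonneg_nonneg divide_nonneg_nonneg)
  have "(\<integral>\<^sup>+y. ennreal (norm (y :: 'a) powr k * (a + b * norm y powr q) powr (- N)) \<partial>lborel)
      = ennreal (n * unit_ball_vol n) * (\<integral>\<^sup>+r. ennreal (r powr (n - 1)) * ennreal (r powr k * (a + b * r powr q) powr (- N)) * indicator {0<..} r \<partial>lborel)"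
    unfolding n_def by (rule nn_integral_radial) measurable
  also have "(\<integral>\<^sup>+r. ennreal (r powr (n - 1)) * ennreal (r powr k * (a + b * r powr q) powr (- N)) * indicator {0<..} r \<partial>lborel)
      = (\<integral>\<^sup>+r. ennreal (r powr (n + k - 1) * (a + b * r powr q) powr (- N)) * indicator {0<..} r \<partial>lborel)"
    by (intro nn_integral_cong) (auto simp: indicator_def ennreal_mult'[symmetric] powr_add[symmetric] mult.assoc[symmetric] algebra_simps)
  also have "\<dots> = ennreal (a powr ((n + k) / q - N) * b powr (- ((n + k) / q)) * Beta ((n + k) / q) (N - (n + k) / q) / q)"
    by (rule nn_integral_powr_rational) (use a b q k n in auto)
  finally show "(\<integral>\<^sup>+y. ennreal (norm (y :: 'a) powr k * (a + b * norm y powr q) powr (- N)) \<partial>lborel)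
      = ennreal (n * unit_ball_vol n * (a powr ((n + k) / q - N) * b powr (- ((n + k) / q)) * Beta ((n + k) / q) (N - (n + k) / q) / q))"
    using n by (simp add: ennreal_mult'[symmetric])
qed auto

text \<open>The integrals are the mass and the \<open>q\<close>-th moment of the extremal density,
  related by the recursion for Beta. Up to the outer exponents, the last identity compares the
  gradient norm of (a + b |y|^q)^(1 - n/p), on the left, with its Lebesgue norm of exponent
  np/(n-p), on the right; thus the explicit \<open>sobolev_const\<close> is the quotient of the
  extremal function, in which \<open>a\<close> and \<open>b\<close> cancel.\<close>

theorem talenti_integrals:
  fixes p a b :: real
  defines "n \<equiv> real DIM('a::euclidean_space)"
  defines "q \<equiv> p / (p - 1)" and "\<alpha> \<equiv> (n - p) / (p - 1)"
  defines "G \<equiv> \<lambda>y :: 'a. (a + b * norm y powr q) powr (- n)"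
  assumes p: "1 < p" "p < n" and a: "0 < a" and b: "0 < b"
  shows "integrable lborel G" "integrable lborel (\<lambda>y. norm y powr q * G y)"
    and "0 < (LINT y | lborel. G y)"
    and "(LINT y | lborel. norm y powr q * G y) = (LINT y | lborel. G y) * (a / b) * (n / \<alpha>)"
    and "b * \<alpha> * (LINT y | lborel. norm y powr q * G y) powr (1 / p)
      = sobolev_const n p * (LINT y | lborel. G y) powr (1 / p - 1 / n)"
proof -
  define s t where "s = n / q" and "t = n / p"
  have n: "1 < n" using p by simp
  have q: "0 < q" unfolding q_def using p by simp
  have st: "0 < s" "1 < t" "n - s = t" "n - (s + 1) = t - 1"
    unfolding s_def t_def q_def using p by (auto simp: field_simps)
  have s_eq: "n / q = s" "(n + q) / q = s + 1"
    unfolding s_def using q by (auto simp: field_simps)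
  have \<alpha>: "0 < \<alpha>" unfolding \<alpha>_def using p by simp
  define K where "K = n * unit_ball_vol n / q"
  have K: "0 < K" unfolding K_def using n q by simp
  have A: "has_bochner_integral lborel G (K * (a powr (s - n) * b powr (- s) * Beta s t))"
  proof -
    have "has_bochner_integral lborel (\<lambda>y :: 'a. norm y powr 0 * (a + b * norm y powr q) powr (- n))
      (n * unit_ball_vol n * (a powr ((n + 0) / q - n) * b powr (- ((n + 0) / q)) * Beta ((n + 0) / q) (n - (n + 0) / q) / q))"
      unfolding n_def by (rule has_bochner_integral_radial_powr_rational) (use a b q st s_eq in \<open>auto simp: n_def\<close>)
    then have "has_bochner_integral lborel (\<lambda>y :: 'a. norm y powr 0 * (a + b * norm y powr q) powr (- n))
        (K * (a powr (s - n) * b powr (- s) * Beta s t))"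
      by (simp add: s_eq st K_def)
    \<comment> \<open>As \<open>0 powr 0\<close> is 0, the moment of order 0 has the integrand
      \<open>G\<close> only away from the origin.\<close>
    moreover have "AE y in lborel. norm (y :: 'a) powr 0 * (a + b * norm y powr q) powr (- n) = G y"
      using AE_lborel_singleton[of "0 :: 'a"] by eventually_elim (simp add: G_def)
    ultimately show ?thesis
      by (subst (asm) has_bochner_integral_cong_AE) (auto simp: G_def)
  qed
  have C: "has_bochner_integral lborel (\<lambda>y. norm y powr q * G y) (K * (a powr (s + 1 - n) * b powr (- (s + 1)) * Beta (s + 1) (t - 1)))"
  proof -
    have "has_bochner_integral lborel (\<lambda>y :: 'a. norm y powr q * (a + b * norm y powr q) powr (- n))
      (n * unit_ball_vol n * (a powr ((n + q) / q - n) * b powr (- ((n + q) / q)) * Beta ((n + q) / q) (n - (n + q) / q) / q))"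
      unfolding n_def by (rule has_bochner_integral_radial_powr_rational) (use a b q st s_eq in \<open>auto simp: n_def\<close>)
    then show ?thesis
      by (simp add: s_eq st K_def G_def)
  qed
  have Beta_pos: "0 < Beta s t" using st by (intro Beta_pos_real) auto
  have Beta_step: "Beta (s + 1) (t - 1) = Beta s t * (s / (t - 1))"
  proof -
    have "Gamma (s + 1) = s * Gamma s" using st by (intro Gamma_plus1_pos) auto
    moreover have "Gamma t = (t - 1) * Gamma (t - 1)" using Gamma_plus1_pos[of "t - 1"] st by auto
    moreover have "s + 1 + (t - 1) = s + t" "t - 1 \<noteq> 0" using st by auto
    ultimately show ?thesis unfolding Beta_def by simp
  qed
  have st\<alpha>: "s / (t - 1) = n / \<alpha>"
    unfolding s_def t_def q_def \<alpha>_def using p by (simp add: field_simps)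
  show "integrable lborel G" "integrable lborel (\<lambda>y. norm y powr q * G y)"
    using A C by (auto intro: integrable.intros)
  have iA: "(LINT y | lborel. G y) = K * (a powr (s - n) * b powr (- s) * Beta s t)"
    using A by (rule has_bochner_integral_integral_eq)
  have iC: "(LINT y | lborel. norm y powr q * G y) = K * (a powr (s + 1 - n) * b powr (- (s + 1)) * Beta (s + 1) (t - 1))"
    using C by (rule has_bochner_integral_integral_eq)
  show pos: "0 < (LINT y | lborel. G y)"
    unfolding iA using K a b Beta_pos by simp
  show rel: "(LINT y | lborel. norm y powr q * G y) = (LINT y | lborel. G y) * (a / b) * (n / \<alpha>)"
    unfolding iA iC Beta_step st\<alpha> using a b by (simp add: powr_add powr_diff powr_minus field_simps)
  define A where "A = (LINT y | lborel. G y)"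
  have A_root: "A powr (1 / n) = (K * Beta s t) powr (1 / n) * a powr (- (1 / p)) * b powr (1 / p - 1)"
  proof -
    have e: "(s - n) * (1 / n) = - (1 / p)" "- s * (1 / n) = 1 / p - 1"
      unfolding s_def q_def using p by (auto simp: field_simps)
    have "A = K * Beta s t * a powr (s - n) * b powr (- s)" unfolding A_def iA by simp
    then have "A powr (1 / n) = (K * Beta s t) powr (1 / n) * a powr ((s - n) * (1 / n)) * b powr (- s * (1 / n))"
      using K Beta_pos by (simp add: powr_mult powr_powr)
    then show ?thesis by (simp only: e)
  qed
  have S: "sobolev_const n p = \<alpha> powr (1 - 1 / p) * n powr (1 / p) * (K * Beta s t) powr (1 / n)"
  proof -
    have "K = unit_ball_vol n * s" "s + t = n" using st(3) by (auto simp: K_def s_def)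
    then have "K * Beta s t = unit_ball_vol n * (s * Gamma s) * Gamma t / Gamma n"
      by (simp add: Beta_def)
    \<comment> \<open>Together with the gamma factor in the volume of the unit ball this produces
      the bracket of the explicit constant; the power of pi from that volume becomes its square
      root.\<close>
    also have "s * Gamma s = Gamma (n + 1 - n / p)"
    proof -
      have eq: "n + 1 - n / p = s + 1" using st(3) by (simp add: t_def)
      show ?thesis unfolding eq by (rule Gamma_plus1_pos[OF st(1), symmetric])
    qed
    finally have KB: "K * Beta s t = pi powr (n / 2) * (Gamma (n / p) * Gamma (n + 1 - n / p) / (Gamma n * Gamma (1 + n / 2)))"
      by (simp add: unit_ball_vol_def t_def add.commute mult_ac)
    have "(pi powr (n / 2)) powr (1 / n) = sqrt pi"
      using n by (simp add: powr_powr powr_half_sqrt)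
    moreover have "0 \<le> Gamma (n / p) * Gamma (n + 1 - n / p) / (Gamma n * Gamma (1 + n / 2))"
    proof -
      have "0 < n + 1 - n / p" using st by (simp add: t_def algebra_simps)
      then show ?thesis using n p by (intro divide_nonneg_nonneg mult_nonneg_nonneg less_imp_le[OF Gamma_real_pos]) auto
    qed
    ultimately have "(K * Beta s t) powr (1 / n) = sqrt pi * (Gamma (n / p) * Gamma (n + 1 - n / p) / (Gamma n * Gamma (1 + n / 2))) powr (1 / n)"
      unfolding KB by (subst powr_mult) auto
    moreover have "(p - 1) / p = 1 - 1 / p" using p by (simp add: field_simps)
    ultimately show ?thesis by (simp add: sobolev_const_def \<alpha>_def)
  qed
  have "b * \<alpha> * (A * (a / b) * (n / \<alpha>)) powr (1 / p) = sobolev_const n p * A powr (1 / p - 1 / n)"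
  proof -
    have Ap: "0 < A" using pos by (simp add: A_def)
    have "A powr (1 / p - 1 / n) * A powr (1 / n) = A powr (1 / p)"
      using Ap by (simp add: powr_add[symmetric])
    moreover have "b * \<alpha> * (A * (a / b) * (n / \<alpha>)) powr (1 / p) * A powr (1 / n)
        = (b * b powr (1 / p - 1) / b powr (1 / p)) * (a powr (1 / p) * a powr (- (1 / p))) * (\<alpha> / \<alpha> powr (1 / p))
          * n powr (1 / p) * (K * Beta s t) powr (1 / n) * A powr (1 / p)"
      unfolding A_root using a b n \<alpha> Ap by (simp add: powr_mult powr_divide)
    moreover have "b * b powr (1 / p - 1) / b powr (1 / p) = 1" "a powr (1 / p) * a powr (- (1 / p)) = 1"
      "\<alpha> / \<alpha> powr (1 / p) = \<alpha> powr (1 - 1 / p)"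
      using a b \<alpha> by (auto simp: powr_diff powr_minus)
    ultimately have "b * \<alpha> * (A * (a / b) * (n / \<alpha>)) powr (1 / p) * A powr (1 / n)
        = sobolev_const n p * A powr (1 / p - 1 / n) * A powr (1 / n)"
      unfolding S by (simp add: mult.assoc)
    then show ?thesis using Ap by simp
  qed
  then show "b * \<alpha> * (LINT y | lborel. norm y powr q * G y) powr (1 / p)
      = sobolev_const n p * (LINT y | lborel. G y) powr (1 / p - 1 / n)"
    unfolding rel by (simp only: A_def)
qed

text \<open>For the density (1 + |y|^q)^(-n) the power \<open>1 - 1 / n\<close> multiplies it by 1 +
  |y|^q, so all three integrals in the transport inequality are expressed by the mass
  \<open>A\<close> and the moment \<open>C\<close>. What remains after cancelling is the quotient
  that \<open>talenti_integrals\<close> identifies with the constant.\<close>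

theorem sobolev_sharp:
  fixes v :: "real ^ 'n \<Rightarrow> real" and g :: "real ^ 'n \<Rightarrow> real ^ 'n" and p :: real
  defines "n \<equiv> real CARD('n)"
  defines "ps \<equiv> n * p / (n - p)"
  assumes p: "1 < p" "p < n"
    and v: "\<And>x. (v has_derivative (\<lambda>h. g x \<bullet> h)) (at x)" "continuous_on UNIV g"
    and supp: "\<And>x. v x \<noteq> 0 \<Longrightarrow> norm x < M"
  shows "sobolev_const n p * (LINT x | lborel. \<bar>v x\<bar> powr ps) powr (1 / ps)
    \<le> (LINT x | lborel. norm (g x) powr p) powr (1 / p)"
proof -
  define q \<alpha> where "q = p / (p - 1)" and "\<alpha> = (n - p) / (p - 1)"
  define G where "G y = (1 + 1 * norm y powr q) powr (- n)" for y :: "real ^ 'n"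
  have nD: "n = real DIM(real ^ 'n)" by (simp add: n_def)
  have n: "1 < n" using p by simp
  have q: "1 < q" "1 / p + 1 / q = 1" unfolding q_def using p by (auto simp: field_simps)
  have \<alpha>: "0 < \<alpha>" unfolding \<alpha>_def using p by simp
  have pos: "0 < 1 + 1 * norm y powr q" for y :: "real ^ 'n"
    by (intro add_pos_nonneg) auto
  note tal = talenti_integrals[where 'a = "real ^ 'n" and p = p and a = 1 and b = 1, folded nD, folded q_def \<alpha>_def,
      folded G_def, OF p zero_less_one zero_less_one]
  define A C where "A = (LINT y | lborel. G y)" and "C = (LINT y | lborel. norm y powr q * G y)"
  have A: "0 < A" unfolding A_def by (rule tal)
  have C_A: "C = A * (n / \<alpha>)" using tal(4) by (simp add: A_def C_def)
  have C: "0 < C" unfolding C_A using A n \<alpha> by simp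
  have S: "\<alpha> * C powr (1 / p) = sobolev_const n p * A powr (1 / ps)"
  proof -
    have "1 / ps = 1 / p - 1 / n" unfolding ps_def using p n by (simp add: field_simps)
    then show ?thesis using tal(5) by (simp add: A_def C_def)
  qed
  have Gc: "continuous_on UNIV G"
    unfolding G_def using q pos
    by (intro continuous_on_powr continuous_on_powr' continuous_intros) (auto simp: less_le)
  have G_pos: "0 < G y" for y using pos[of y] by (simp add: G_def)
  have Gn: "G y powr (1 - 1 / n) = G y + norm y powr q * G y" for y
  proof -
    have "- n * (1 - 1 / n) = 1 - n" using n by (simp add: field_simps)
    then have "G y powr (1 - 1 / n) = (1 + 1 * norm y powr q) powr (1 - n)"
      unfolding G_def powr_powr by (simp only:)
    also have "\<dots> = (1 + 1 * norm y powr q) * G y"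
      unfolding G_def using pos[of y] by (simp add: powr_diff powr_minus divide_inverse)
    finally show ?thesis by (simp add: algebra_simps)
  qed
  define V N where "V = (LINT x | lborel. \<bar>v x\<bar> powr ps) powr (1 / ps)"
    and "N = (LINT x | lborel. norm (g x) powr p) powr (1 / p)"
  have "n * (LINT y | lborel. G y powr (1 - 1 / n)) * V
      \<le> p * (n - 1) / (n - p) * N * A powr (1 / ps) * C powr (1 / q)"
    unfolding V_def N_def A_def C_def n_def ps_def q_def
  proof (rule sobolev_whole_space[OF p[unfolded n_def] v supp Gc G_pos])
    show "integrable lborel G" by (rule tal)
    show "integrable lborel (\<lambda>y. G y powr (1 - 1 / real CARD('n)))"
      using tal(1,2) by (simp add: Gn[unfolded n_def])
    show "integrable lborel (\<lambda>y. norm y powr (p / (p - 1)) * G y)"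
      using tal(2) by (simp add: q_def)
  qed
  also have "(LINT y | lborel. G y powr (1 - 1 / n)) = A + C"
    unfolding Gn A_def C_def by (rule Bochner_Integration.integral_add[OF tal(1,2)])
  also have "n * (A + C) = (n - 1) * q * C"
  proof -
    have "A = C * (\<alpha> / n)" unfolding C_A using n \<alpha> by simp
    then have "n * (A + C) = (n + \<alpha>) * C" using n by (simp add: algebra_simps)
    also have "n + \<alpha> = (n - 1) * q" unfolding \<alpha>_def q_def using p by (simp add: field_simps)
    finally show ?thesis .
  qed
  finally have le: "(n - 1) * q * C * V \<le> p * (n - 1) / (n - p) * N * A powr (1 / ps) * C powr (1 / q)" .
  \<comment> \<open>The part with exponent \<open>1 / q\<close> cancels against the Hoelder factor;
    the part with exponent \<open>1 / p\<close> is the one occurring in \<open>S\<close>.\<close>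
  have "C = C powr (1 / p) * C powr (1 / q)" using C q by (simp add: powr_add[symmetric])
  then have e1: "(n - 1) * q * C * V = ((n - 1) * C powr (1 / q)) * (q * C powr (1 / p) * V)" by (metis mult.assoc mult.commute)
  have e2: "p * (n - 1) / (n - p) * N * A powr (1 / ps) * C powr (1 / q)
      = ((n - 1) * C powr (1 / q)) * (p / (n - p) * N * A powr (1 / ps))" by simp
  note le[unfolded e1 e2]
  moreover have "0 < (n - 1) * C powr (1 / q)" using n C by simp
  ultimately have "q * C powr (1 / p) * V \<le> p / (n - p) * N * A powr (1 / ps)"
    by (simp only: mult_le_cancel_left_pos)
  then have "(n - p) / p * (q * C powr (1 / p) * V) \<le> (n - p) / p * (p / (n - p) * N * A powr (1 / ps))"
    using p by (intro mult_left_mono) auto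
  also have "\<dots> = N * A powr (1 / ps)" using p by simp
  also have "(n - p) / p * (q * C powr (1 / p) * V) = \<alpha> * C powr (1 / p) * V"
    using p by (simp add: q_def \<alpha>_def)
  also have "\<dots> = sobolev_const n p * V * A powr (1 / ps)" unfolding S by simp
  finally have "sobolev_const n p * V \<le> N" using A by simp
  then show ?thesis by (simp add: V_def N_def)
qed

subsection \<open>Radial maps\<close>

definition radial_map :: "(real \<Rightarrow> real) \<Rightarrow> 'a::real_inner \<Rightarrow> 'a" where
  "radial_map h x = h (norm x) *\<^sub>R sgn x"

lemma radial_map_0 [simp]: "radial_map h 0 = 0"
  by (simp add: radial_map_def)

lemma norm_radial_map: "x \<noteq> 0 \<Longrightarrow> 0 \<le> h (norm x) \<Longrightarrow> norm (radial_map h x) = h (norm x)"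
  by (simp add: radial_map_def norm_sgn)

lemma sgn_radial_map: "0 < h (norm x) \<Longrightarrow> sgn (radial_map h x) = sgn x"
  by (cases "x = 0") (simp_all add: radial_map_def sgn_div_norm field_simps)

lemma inner_sgn_self: "x \<noteq> 0 \<Longrightarrow> sgn x \<bullet> sgn x = (1::real)" for x :: "'a::real_inner"
  by (simp add: dot_square_norm norm_sgn)

text \<open>Tangential directions are stretched by \<open>h r / r\<close> and the radial one by
  \<open>h'\<close>; the formula applies the tangential factor to all of \<open>k\<close> and
  corrects the radial component.\<close>

lemma has_derivative_radial_map:
  fixes x :: "'a::real_inner"
  assumes x: "x \<noteq> 0" and h: "DERIV h (norm x) :> h'"
  shows "(radial_map h has_derivative
    (\<lambda>k. (h (norm x) / norm x) *\<^sub>R k + ((h' - h (norm x) / norm x) * (sgn x \<bullet> k)) *\<^sub>R sgn x)) (at x)"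
proof -
  let ?r = "norm x"
  have eq: "radial_map h = (\<lambda>y. (h (norm y) / norm y) *\<^sub>R (y :: 'a))"
    by (simp add: radial_map_def fun_eq_iff sgn_div_norm divide_inverse)
  have n: "(norm has_derivative (\<lambda>k. sgn x \<bullet> k)) (at x)"
    using has_derivative_norm[OF x] by (simp add: inner_commute)
  have "DERIV (\<lambda>r. h r / r) ?r :> (h' * ?r - h ?r * 1) / (?r * ?r)"
    using x by (intro DERIV_divide h DERIV_ident) auto
  then have "((\<lambda>r. h r / r) has_derivative (\<lambda>k. (h' * ?r - h ?r * 1) / (?r * ?r) * k)) (at ?r)"
    unfolding has_field_derivative_def .
  from has_derivative_compose[OF n this]
  have "((\<lambda>y. h (norm y) / norm y) has_derivative (\<lambda>k. (h' * ?r - h ?r * 1) / (?r * ?r) * (sgn x \<bullet> k))) (at x)" .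
  from has_derivative_scaleR[OF this has_derivative_ident]
  show ?thesis
    unfolding eq
  proof (rule has_derivative_eq_rhs)
    have "((h' * ?r - h ?r * 1) / (?r * ?r) * c) *\<^sub>R x = ((h' - h ?r / ?r) * c) *\<^sub>R sgn x" for c
    proof -
      have "((h' - h ?r / ?r) * c) *\<^sub>R sgn x = ((h' - h ?r / ?r) * c / ?r) *\<^sub>R x"
        by (simp add: sgn_div_norm divide_inverse)
      also have "(h' - h ?r / ?r) * c / ?r = (h' * ?r - h ?r * 1) / (?r * ?r) * c"
        using x by (simp add: field_simps)
      finally show ?thesis by simp
    qed
    then show "(\<lambda>k. (h ?r / ?r) *\<^sub>R k + ((h' * ?r - h ?r * 1) / (?r * ?r) * (sgn x \<bullet> k)) *\<^sub>R x)
      = (\<lambda>k. (h ?r / ?r) *\<^sub>R k + ((h' - h ?r / ?r) * (sgn x \<bullet> k)) *\<^sub>R sgn x)" by simp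
  qed
qed

text \<open>The derivative of a radial map is symmetric, so it acts on the gradient of
  \<open>u\<close> by the same formula as on vectors.\<close>

lemma has_derivative_compose_radial_map:
  fixes x g :: "'a::real_inner"
  assumes "x \<noteq> 0" "DERIV h (norm x) :> h'"
    and u: "(u has_derivative (\<lambda>k. g \<bullet> k)) (at (radial_map h x))"
  shows "((\<lambda>x. u (radial_map h x)) has_derivative
    (\<lambda>k. ((h (norm x) / norm x) *\<^sub>R g + ((h' - h (norm x) / norm x) * (sgn x \<bullet> g)) *\<^sub>R sgn x) \<bullet> k)) (at x)"
  using has_derivative_compose[OF has_derivative_radial_map[OF assms(1,2)] u]
  by (rule has_derivative_eq_rhs) (simp add: fun_eq_iff inner_add_left inner_add_right inner_commute[of g "sgn x"] mult_ac)

text \<open>The general formula breaks down at the origin, where \<open>sgn\<close> is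
  discontinuous. Written as \<open>k (norm y) *\<^sub>R y\<close>, the map differs from the identity
  by a factor that tends to 1.\<close>

lemma has_derivative_radial_map_at_0:
  fixes k :: "real \<Rightarrow> real"
  assumes k: "continuous_on {0..} k" "k 0 = 1" and h: "\<And>r. 0 < r \<Longrightarrow> h r = k r * r"
  shows "(radial_map h has_derivative (\<lambda>x. x)) (at (0 :: 'a::real_inner))"
proof -
  have eq: "radial_map h y = k (norm y) *\<^sub>R y" for y :: 'a
    by (cases "y = 0") (simp_all add: radial_map_def h sgn_div_norm)
  have "((\<lambda>y :: 'a. k (norm y)) \<longlongrightarrow> k (norm (0 :: 'a))) (at 0)"
  proof -
    have "continuous_on UNIV (\<lambda>y :: 'a. k (norm y))"
      by (intro continuous_on_compose2[OF k(1)] continuous_intros) auto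
    then show ?thesis unfolding continuous_on_def by blast
  qed
  then have "((\<lambda>y :: 'a. k (norm y) - 1) \<longlongrightarrow> 0) (at 0)"
    using k(2) by (simp add: LIM_zero_iff)
  then have lim: "((\<lambda>y :: 'a. \<bar>k (norm y) - 1\<bar>) \<longlongrightarrow> 0) (at 0)"
    by (simp add: tendsto_rabs_zero_iff)
  have "((\<lambda>y. norm (radial_map h y - radial_map h 0 - (y - 0)) / norm (y - 0)) \<longlongrightarrow> 0) (at (0 :: 'a))"
  proof (rule Lim_transform_eventually[OF lim])
    have "\<bar>k (norm y) - 1\<bar> = norm (radial_map h y - radial_map h 0 - (y - 0)) / norm (y - 0)" if "y \<noteq> 0" for y :: 'a
    proof -
      have "radial_map h y - radial_map h 0 - (y - 0) = (k (norm y) - 1) *\<^sub>R y" by (simp add: eq algebra_simps)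
      then show ?thesis using that by simp
    qed
    then show "\<forall>\<^sub>F y in at 0. \<bar>k (norm y) - 1\<bar> = norm (radial_map h y - radial_map h 0 - (y - 0)) / norm (y - 0 :: 'a)"
      by (auto simp: eventually_at_filter)
  qed
  then show ?thesis by (simp add: has_derivative_iff_norm bounded_linear_ident)
qed

text \<open>Up to the powers \<open>- \<alpha>\<close> and \<open>- 1 / \<alpha>\<close> these are the affine maps; they comprise the radial
  parts of the scaling, of the map from the ball to the whole space, and of its inverse.\<close>

definition affine_conj :: "real \<Rightarrow> real \<Rightarrow> real \<Rightarrow> real \<Rightarrow> real" where
  "affine_conj \<alpha> l c r = (l * r powr (- \<alpha>) + c) powr (- (1 / \<alpha>))"

context
  fixes \<alpha> l c r :: real
  assumes \<alpha>: "0 < \<alpha>" and r: "0 < r" and pos: "0 < l * r powr (- \<alpha>) + c"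
begin

lemma affine_conj_pos: "0 < affine_conj \<alpha> l c r"
  using pos by (simp add: affine_conj_def)

lemma affine_conj_powr: "affine_conj \<alpha> l c r powr (- \<alpha>) = l * r powr (- \<alpha>) + c"
  using pos \<alpha> by (simp add: affine_conj_def powr_powr)

text \<open>Differentiating s^(-\<alpha>) = l r^(-\<alpha>) + c gives s^(-\<alpha>-1) ds = l
  r^(-\<alpha>-1) dr. The derivative is thus a power of the same ratio s/r that governs tangential
  stretching.\<close>

lemma affine_conj_deriv:
  "DERIV (affine_conj \<alpha> l c) r :> l * (affine_conj \<alpha> l c r / r) powr (\<alpha> + 1)"
proof -
  have d: "DERIV (\<lambda>r. l * r powr (- \<alpha>) + c) r :> l * (- \<alpha> * r powr (- \<alpha> - 1))"
    using r by (auto intro!: derivative_eq_intros)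
  have "DERIV (affine_conj \<alpha> l c) r :> - (1 / \<alpha>) * (l * r powr (- \<alpha>) + c) powr (- (1 / \<alpha>) - of_nat 1) * (l * (- \<alpha> * r powr (- \<alpha> - 1)))"
    unfolding affine_conj_def by (rule DERIV_fun_powr[OF d pos])
  also have "- (1 / \<alpha>) * (l * r powr (- \<alpha>) + c) powr (- (1 / \<alpha>) - of_nat 1) * (l * (- \<alpha> * r powr (- \<alpha> - 1)))
      = l * ((l * r powr (- \<alpha>) + c) powr (- (1 / \<alpha>) - 1) * r powr (- \<alpha> - 1))"
    using \<alpha> by simp
  also have "(l * r powr (- \<alpha>) + c) powr (- (1 / \<alpha>) - 1) = affine_conj \<alpha> l c r powr (\<alpha> + 1)"
  proof -
    have "- (1 / \<alpha>) - 1 = - (1 / \<alpha>) * (\<alpha> + 1)" using \<alpha> by (simp add: field_simps)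
    then show ?thesis unfolding affine_conj_def powr_powr by (simp only:)
  qed
  also have "affine_conj \<alpha> l c r powr (\<alpha> + 1) * r powr (- \<alpha> - 1) = (affine_conj \<alpha> l c r / r) powr (\<alpha> + 1)"
  proof -
    have "- \<alpha> - 1 = - (\<alpha> + 1)" by simp
    then have "r powr (- \<alpha> - 1) = inverse (r powr (\<alpha> + 1))" by (simp only: powr_minus)
    then show ?thesis using r affine_conj_pos by (simp add: powr_divide) (simp add: divide_inverse)
  qed
  finally show ?thesis .
qed

end

text \<open>The last hypothesis expresses surjectivity in the variable r^(-\<alpha>), where the map
  is affine: the quotient is the only candidate for the preimage, and lying above
  \<open>R powr (- \<alpha>)\<close> means that its radius is below \<open>R\<close>.\<close>

lemma increasing_diffeo_affine_conj:
  assumes \<alpha>: "0 < \<alpha>" and l: "0 < l" and R: "0 < R"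
    and pos: "\<And>r. 0 < r \<Longrightarrow> r < R \<Longrightarrow> 0 < l * r powr (- \<alpha>) + c"
    and into: "\<And>r. 0 < r \<Longrightarrow> r < R \<Longrightarrow> affine_conj \<alpha> l c r \<in> J'"
    and J': "\<And>s. s \<in> J' \<Longrightarrow> 0 < s \<and> R powr (- \<alpha>) < (s powr (- \<alpha>) - c) / l"
  shows "increasing_diffeo (affine_conj \<alpha> l c) (\<lambda>r. l * (affine_conj \<alpha> l c r / r) powr (\<alpha> + 1)) {0<..<R} J'"
  unfolding increasing_diffeo_def
proof (intro conjI ballI)
  let ?h = "affine_conj \<alpha> l c"
  show m: "?h \<in> borel_measurable borel" unfolding affine_conj_def by measurable
  show "(\<lambda>r. l * (?h r / r) powr (\<alpha> + 1)) \<in> borel_measurable borel" using m by measurable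
  show d: "DERIV ?h r :> l * (?h r / r) powr (\<alpha> + 1)" if "r \<in> {0<..<R}" for r
    using that by (intro affine_conj_deriv \<alpha> pos) auto
  show "0 \<le> l * (?h r / r) powr (\<alpha> + 1)" for r using l by simp
  have hc: "continuous_on {0<..<R} ?h"
    by (intro continuous_at_imp_continuous_on ballI DERIV_isCont[OF d])
  have hpos: "0 < ?h r" if "r \<in> {0<..<R}" for r
    using that by (intro affine_conj_pos \<alpha> pos) auto
  show "continuous_on {0<..<R} (\<lambda>r. l * (?h r / r) powr (\<alpha> + 1))"
    using \<alpha> hpos by (intro continuous_intros hc) (auto simp: less_le)
  show "mono_on {0<..<R} ?h"
  proof (rule mono_onI)
    fix r s assume rs: "r \<in> {0<..<R}" "s \<in> {0<..<R}" "r \<le> s"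
    show "?h r \<le> ?h s"
    proof (rule DERIV_nonneg_imp_nondecreasing[OF rs(3)])
      fix x assume "r \<le> x" "x \<le> s"
      then have "x \<in> {0<..<R}" using rs by auto
      then show "\<exists>y. DERIV ?h x :> y \<and> 0 \<le> y" using d[of x] l by (intro exI conjI) auto
    qed
  qed
  show "?h ` {0<..<R} = J'"
  proof (intro equalityI subsetI)
    fix s assume s: "s \<in> J'"
    define X where "X = (s powr (- \<alpha>) - c) / l"
    have X: "R powr (- \<alpha>) < X" "0 < s" using J'[OF s] by (auto simp: X_def)
    have X0: "0 < X" using X(1) by (rule order.strict_trans1[rotated]) simp
    define r where "r = X powr (- (1 / \<alpha>))"
    have r: "0 < r" using X0 by (simp add: r_def)
    have rX: "r powr (- \<alpha>) = X" using X0 \<alpha> by (simp add: r_def powr_powr)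
    have "r < R"
    proof (rule ccontr)
      assume "\<not> r < R"
      then have "r powr (- \<alpha>) \<le> R powr (- \<alpha>)" using R \<alpha> by (intro powr_mono2') auto
      then show False using X(1) rX by simp
    qed
    moreover have "?h r = s"
      unfolding affine_conj_def rX using l X \<alpha> by (simp add: X_def powr_powr)
    ultimately show "s \<in> ?h ` {0<..<R}" using r by (intro image_eqI[of _ _ r]) auto
  qed (use into in auto)
  show "\<exists>a b :: nat \<Rightarrow> real. decseq a \<and> incseq b \<and> (\<forall>k. a k < b k) \<and> (\<Union>k. {a k..b k}) = {0<..<R}"
    by (rule open_interval_exhaustion[OF R])
qed

subsection \<open>The change of variables between the ball and the whole space\<close>

lemma grad_eqI:
  fixes u :: "real ^ 'n \<Rightarrow> real"
  assumes "(u has_derivative (\<lambda>h. g \<bullet> h)) (at x)"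
  shows "grad u x = g"
proof -
  have "frechet_derivative u (at x) = (\<lambda>h. g \<bullet> h)"
    using frechet_derivative_at[OF assms] by simp
  then show ?thesis
    by (simp add: grad_def vec_eq_iff inner_axis)
qed

lemma has_derivative_grad:
  fixes u :: "real ^ 'n \<Rightarrow> real"
  assumes "u differentiable (at x)"
  shows "(u has_derivative (\<lambda>h. grad u x \<bullet> h)) (at x)"
proof -
  let ?D = "frechet_derivative u (at x)"
  have d: "(u has_derivative ?D) (at x)" using assms by (simp add: frechet_derivative_works)
  then have lin: "linear ?D" by (rule has_derivative_linear)
  have eq: "?D h = grad u x \<bullet> h" for h
  proof -
    have "?D h = ?D (\<Sum>i\<in>UNIV. h $ i *\<^sub>R axis i 1)"
      using basis_expansion[of h] by (simp add: scalar_mult_eq_scaleR)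
    also have "\<dots> = (\<Sum>i\<in>UNIV. h $ i * ?D (axis i 1))"
      by (simp add: linear_sum[OF lin] linear_cmul[OF lin] o_def)
    finally show ?thesis by (simp add: grad_def inner_vec_def mult.commute)
  qed
  show ?thesis using d unfolding eq[abs_def] .
qed

lemma test_functionsD:
  fixes u :: "real ^ 'n \<Rightarrow> real"
  assumes u: "u \<in> test_functions R" and R: "0 < R"
  shows test_functions_has_derivative: "(u has_derivative (\<lambda>h. grad u x \<bullet> h)) (at x)"
    and test_functions_grad_continuous: "continuous_on UNIV (grad u)"
    and test_functions_support: "\<exists>R0. 0 < R0 \<and> R0 < R \<and> (\<forall>x. u x \<noteq> 0 \<longrightarrow> norm x \<le> R0)"
proof -
  have "Ck (Suc 0) u" using u by (simp add: test_functions_def smooth_def)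
  then have d: "u differentiable (at x)" and c: "continuous_on UNIV (\<lambda>x. frechet_derivative u (at x) v)" for x v
    by auto
  show "(u has_derivative (\<lambda>h. grad u x \<bullet> h)) (at x)" by (rule has_derivative_grad[OF d])
  show "continuous_on UNIV (grad u)"
    unfolding grad_def by (intro continuous_on_vec_lambda c)
  let ?S = "closure {x. u x \<noteq> 0}"
  have S: "compact ?S" "?S \<subseteq> ball 0 R" using u by (auto simp: test_functions_def)
  show "\<exists>R0. 0 < R0 \<and> R0 < R \<and> (\<forall>x. u x \<noteq> 0 \<longrightarrow> norm x \<le> R0)"
  proof (cases "?S = {}")
    case True
    then have "\<not> u x \<noteq> 0" for x using closure_subset[of "{x. u x \<noteq> 0}"] by blast
    then show ?thesis using R by (intro exI[of _ "R / 2"]) auto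
  next
    case False
    obtain y where y: "y \<in> ?S" "\<And>x. x \<in> ?S \<Longrightarrow> norm x \<le> norm y"
      using continuous_attains_sup[OF S(1) False, of norm] by (auto intro: continuous_intros)
    have "norm y < R" using y(1) S(2) by auto
    moreover have "norm x \<le> norm y" if "u x \<noteq> 0" for x
      using that closure_subset[of "{x. u x \<noteq> 0}"] by (intro y(2)) auto
    \<comment> \<open>The maximum with \<open>R / 2\<close> keeps the radius positive, so that
      \<phi> can be evaluated there.\<close>
    ultimately show ?thesis using R by (intro exI[of _ "max (norm y) (R / 2)"]) (auto simp: le_max_iff_disj)
  qed
qed

locale sobolev_ball =
  fixes n p R :: real
  assumes p: "1 < p" "p < n" and R: "0 < R"
begin

text \<open>In the notation of the paper \<open>ps = p*\<close>, and \<open>w r / \<alpha>\<close> is the \<open>q\<close>-logarithm of \<open>R / r\<close>.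
  The functions \<open>\<phi>\<close> and \<open>\<psi>\<close> are the radial parts of the map from the ball onto the whole space and of
  its inverse, \<open>\<sigma> l\<close> is the radial part of the scaling.\<close>

definition "\<alpha> = (n - p) / (p - 1)"
definition "ps = n * p / (n - p)"
definition "e = p * (n - 1) / (n - p)"
definition "w r = 1 - (r / R) powr \<alpha>"
definition "\<phi> = affine_conj \<alpha> 1 (- (R powr (- \<alpha>)))"
definition "\<psi> = affine_conj \<alpha> 1 (R powr (- \<alpha>))"
definition "\<sigma> l = affine_conj \<alpha> l ((1 - l) * R powr (- \<alpha>))"

lemma n: "1 < n" using p by simp

text \<open>The exponent bookkeeping: \<open>\<alpha>_e\<close> matches the weight with the
  Jacobian, \<open>\<alpha>_p\<close> the p-th power of the radial derivative with the Jacobian, and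
  \<open>ps_e\<close> the prefactor of the scaling with the powers of \<open>l\<close> on the
  left-hand side.\<close>

lemma exponents:
  shows \<alpha>_pos: "0 < \<alpha>" and ps_pos: "0 < ps"
    and \<alpha>_e: "\<alpha> * e = n + \<alpha>" and \<alpha>_p: "(\<alpha> + 1) * p = n + \<alpha>"
    and ps_e: "ps * ((p - 1) / p) = e - 1"
proof -
  have 1: "\<alpha> + 1 = (n - 1) / (p - 1)" unfolding \<alpha>_def using p by (simp add: field_simps)
  have 2: "\<alpha> * e = p * (n - 1) / (p - 1)" unfolding \<alpha>_def e_def using p by simp
  have 3: "n + \<alpha> = p * (n - 1) / (p - 1)" unfolding \<alpha>_def using p by (simp add: field_simps)
  show "0 < \<alpha>" "0 < ps" unfolding \<alpha>_def ps_def using p by auto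
  show "\<alpha> * e = n + \<alpha>" using 2 3 by simp
  show "(\<alpha> + 1) * p = n + \<alpha>" unfolding 1 3 by simp
  show "ps * ((p - 1) / p) = e - 1" unfolding ps_def e_def using p by (simp add: field_simps)
qed

lemma powr_less: "0 < r \<Longrightarrow> r < R \<Longrightarrow> R powr (- \<alpha>) < r powr (- \<alpha>)"
  using \<alpha>_pos by (intro powr_less_mono2_neg) auto

lemma w_eq: "0 < r \<Longrightarrow> w r = r powr \<alpha> * (r powr (- \<alpha>) - R powr (- \<alpha>))"
  using R by (simp add: w_def powr_divide powr_minus field_simps)

lemma w_pos: "0 < r \<Longrightarrow> r < R \<Longrightarrow> 0 < w r"
  using powr_less[of r] by (simp add: w_eq)

lemma logq_eq: "0 < r \<Longrightarrow> logq ((n - 1) / (p - 1)) (R / r) = w r / \<alpha>"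
proof -
  assume r: "0 < r"
  have e: "1 - (n - 1) / (p - 1) = - \<alpha>" unfolding \<alpha>_def using p by (simp add: field_simps)
  have "(R / r) powr (- \<alpha>) = (r / R) powr \<alpha>" using r R by (simp add: powr_divide powr_minus field_simps)
  then show ?thesis using \<alpha>_pos unfolding logq_def e by (simp add: w_def field_simps)
qed

lemma \<phi>_arg: "0 < r \<Longrightarrow> r < R \<Longrightarrow> 0 < 1 * r powr (- \<alpha>) + - (R powr (- \<alpha>))"
  using powr_less by simp

lemma \<psi>_arg: "0 < 1 * r powr (- \<alpha>) + R powr (- \<alpha>)"
  using R by (intro add_nonneg_pos) auto

lemma \<sigma>_arg: "0 < l \<Longrightarrow> 0 < r \<Longrightarrow> r < R \<Longrightarrow> 0 < l * r powr (- \<alpha>) + (1 - l) * R powr (- \<alpha>)"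
proof -
  assume "0 < l" "0 < r" "r < R"
  then have "0 < l * (r powr (- \<alpha>) - R powr (- \<alpha>))" using powr_less[of r] by simp
  moreover have "0 < R powr (- \<alpha>)" using R by simp
  moreover have "l * r powr (- \<alpha>) + (1 - l) * R powr (- \<alpha>)
      = l * (r powr (- \<alpha>) - R powr (- \<alpha>)) + R powr (- \<alpha>)" by (simp add: algebra_simps)
  ultimately show ?thesis by linarith
qed

lemma \<phi>_pos: "0 < r \<Longrightarrow> r < R \<Longrightarrow> 0 < \<phi> r"
  unfolding \<phi>_def by (intro affine_conj_pos \<alpha>_pos \<phi>_arg)
lemmas \<psi>_pos = affine_conj_pos[OF \<alpha>_pos _ \<psi>_arg, folded \<psi>_def]
lemmas \<sigma>_pos = affine_conj_pos[OF \<alpha>_pos _ \<sigma>_arg, folded \<sigma>_def]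
lemmas \<phi>_powr = affine_conj_powr[OF \<alpha>_pos _ \<phi>_arg, folded \<phi>_def]
lemmas \<psi>_powr = affine_conj_powr[OF \<alpha>_pos _ \<psi>_arg, folded \<psi>_def]
lemmas \<sigma>_powr = affine_conj_powr[OF \<alpha>_pos _ \<sigma>_arg, folded \<sigma>_def]
lemmas \<psi>_deriv = affine_conj_deriv[OF \<alpha>_pos _ \<psi>_arg, folded \<psi>_def]
lemmas \<sigma>_deriv = affine_conj_deriv[OF \<alpha>_pos _ \<sigma>_arg, folded \<sigma>_def]

lemma powr_less_iff: "0 < r \<Longrightarrow> r < R \<longleftrightarrow> R powr (- \<alpha>) < r powr (- \<alpha>)"
proof
  assume r: "0 < r" and *: "R powr (- \<alpha>) < r powr (- \<alpha>)"
  show "r < R"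
  proof (rule ccontr)
    assume "\<not> r < R"
    then have "r powr (- \<alpha>) \<le> R powr (- \<alpha>)" using R \<alpha>_pos by (intro powr_mono2') auto
    then show False using * by simp
  qed
qed (use powr_less in auto)

lemma \<sigma>_less: "0 < l \<Longrightarrow> 0 < r \<Longrightarrow> r < R \<Longrightarrow> \<sigma> l r < R"
proof -
  assume *: "0 < l" "0 < r" "r < R"
  have "0 < l * (r powr (- \<alpha>) - R powr (- \<alpha>))" using * powr_less[of r] by simp
  then show ?thesis
    using * by (subst powr_less_iff) (auto simp: \<sigma>_pos \<sigma>_powr algebra_simps)
qed

lemma \<psi>_\<phi>: "0 < r \<Longrightarrow> r < R \<Longrightarrow> \<psi> (\<phi> r) = r"
  unfolding \<psi>_def affine_conj_def using \<alpha>_pos by (simp add: \<phi>_powr powr_powr)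

lemma diffeo_\<phi>: "increasing_diffeo \<phi> (\<lambda>r. 1 * (\<phi> r / r) powr (\<alpha> + 1)) {0<..<R} {0<..}"
  unfolding \<phi>_def
proof (rule increasing_diffeo_affine_conj[OF \<alpha>_pos _ R])
  show "0 < s \<and> R powr (- \<alpha>) < (s powr (- \<alpha>) - - (R powr (- \<alpha>))) / 1" if "s \<in> {0<..}" for s
    using that by simp
qed (use powr_less in \<open>auto intro: \<phi>_pos[unfolded \<phi>_def]\<close>)

lemma diffeo_\<sigma>:
  assumes l: "0 < l"
  shows "increasing_diffeo (\<sigma> l) (\<lambda>r. l * (\<sigma> l r / r) powr (\<alpha> + 1)) {0<..<R} {0<..<R}"
  unfolding \<sigma>_def
proof (rule increasing_diffeo_affine_conj[OF \<alpha>_pos l R])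
  show "0 < s \<and> R powr (- \<alpha>) < (s powr (- \<alpha>) - (1 - l) * R powr (- \<alpha>)) / l" if "s \<in> {0<..<R}" for s
    using that powr_less[of s] l by (simp add: field_simps)
qed (use l in \<open>auto intro: \<sigma>_arg \<sigma>_pos[unfolded \<sigma>_def] \<sigma>_less[unfolded \<sigma>_def]\<close>)

text \<open>By \<open>w_eq\<close>, \<open>w r\<close> is r^\<alpha> times the difference
  r^(-\<alpha>) - R^(-\<alpha>), and the scaling multiplies this difference by
  \<open>l\<close>.\<close>

lemma w_\<sigma>:
  assumes "0 < l" "0 < r" "r < R"
  shows "w (\<sigma> l r) = l * (\<sigma> l r / r) powr \<alpha> * w r"
proof -
  have "\<sigma> l r powr (- \<alpha>) - R powr (- \<alpha>) = l * (r powr (- \<alpha>) - R powr (- \<alpha>))"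
    using assms by (simp add: \<sigma>_powr algebra_simps)
  also have "r powr (- \<alpha>) - R powr (- \<alpha>) = w r / r powr \<alpha>" using assms by (simp add: w_eq)
  finally show ?thesis
    using assms \<sigma>_pos[of r l] by (simp add: w_eq[of "\<sigma> l r"] powr_divide)
qed

lemma w_\<phi>: "0 < r \<Longrightarrow> r < R \<Longrightarrow> w r = (\<phi> r / r) powr (- \<alpha>)"
proof -
  assume r: "0 < r" "r < R"
  have "r powr (- \<alpha>) - R powr (- \<alpha>) = \<phi> r powr (- \<alpha>)" using r by (simp add: \<phi>_powr)
  then have "w r = r powr \<alpha> * \<phi> r powr (- \<alpha>)" using r by (simp only: w_eq)
  then show ?thesis using r \<phi>_pos[of r] by (simp add: powr_divide powr_minus_divide)
qed

section \<open>Integrals and the operator \<open>Lp\<close> on the ball\<close>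

text \<open>The origin is left out, where the integrands of the theorem only have default values,
  and extended nonnegative integrals postpone all questions of integrability.\<close>

definition ball_int :: "(real ^ 'n \<Rightarrow> real) \<Rightarrow> ennreal" where
  "ball_int f = (\<integral>\<^sup>+x. ennreal (f x) * indicator {0<..<R} (norm x) \<partial>lborel)"

lemma ball_int_cong:
  "(\<And>x. 0 < norm x \<Longrightarrow> norm x < R \<Longrightarrow> f x = g x) \<Longrightarrow> ball_int f = ball_int g"
  unfolding ball_int_def by (intro nn_integral_cong) (auto simp: indicator_def)

lemma ball_int_cmult:
  fixes f :: "real ^ 'n \<Rightarrow> real"
  assumes "0 \<le> c" "f \<in> borel_measurable borel"
  shows "ball_int (\<lambda>x. c * f x) = ennreal c * ball_int f"
  unfolding ball_int_def using assms
  by (subst nn_integral_cmult[symmetric]) (auto simp: ennreal_mult' mult.assoc intro!: nn_integral_cong)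

text \<open>Measurability is carried by the Borel function \<open>F\<close>, with which the
  integrand \<open>f\<close> agrees off the origin; this absorbs the default values at 0 and also
  the passage from \<open>lebesgue\<close> to \<open>lborel\<close>.\<close>

lemma integral_ball:
  fixes f F :: "real ^ 'n \<Rightarrow> real"
  assumes F: "F \<in> borel_measurable borel"
    and nonneg: "\<And>x. 0 < norm x \<Longrightarrow> norm x < R \<Longrightarrow> 0 \<le> F x"
    and eq: "\<And>x. 0 < norm x \<Longrightarrow> norm x < R \<Longrightarrow> f x = F x"
  shows "(LINT x : ball 0 R | lebesgue. f x) = enn2real (ball_int F)"
    and "ball_int F < \<infinity> \<Longrightarrow> set_integrable lebesgue (ball 0 R) f"
proof -
  let ?g = "\<lambda>x :: real ^ 'n. indicator {0<..<R} (norm x) * F x"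
  have [measurable]: "F \<in> borel_measurable borel" by (rule F)
  have g: "?g \<in> borel_measurable lborel" by measurable
  have e: "indicat_real (ball 0 R) x *\<^sub>R f x = ?g x" if "x \<notin> {0}" for x
    using that eq[of x] by (auto simp: indicator_def)
  have nn: "(\<integral>\<^sup>+x. ennreal (?g x) \<partial>lborel) = ball_int F"
    unfolding ball_int_def by (intro nn_integral_cong) (auto simp: indicator_def)
  have null: "emeasure lebesgue {x :: real ^ 'n} = 0" "{x :: real ^ 'n} \<in> sets lebesgue" for x
    by auto
  have "(LINT x : ball 0 R | lebesgue. f x) = integral\<^sup>L lebesgue ?g"
    unfolding set_lebesgue_integral_def
    by (rule integral_discrete_difference[where X = "{0}"]) (use e null in auto)
  also have "\<dots> = integral\<^sup>L lborel ?g" by (rule integral_completion[OF g])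
  also have "\<dots> = enn2real (ball_int F)"
    unfolding nn[symmetric] by (rule integral_eq_nn_integral) (use g nonneg in \<open>auto simp: indicator_def\<close>)
  finally show "(LINT x : ball 0 R | lebesgue. f x) = enn2real (ball_int F)" .
  assume fin: "ball_int F < \<infinity>"
  have "integrable lborel ?g"
  proof (rule integrableI_nonneg[OF g])
    show "(\<integral>\<^sup>+x. ennreal (?g x) \<partial>lborel) < \<infinity>" unfolding nn by (rule fin)
  qed (use nonneg in \<open>auto simp: indicator_def\<close>)
  then have "integrable lebesgue ?g" by (simp add: integrable_completion[OF g])
  then show "set_integrable lebesgue (ball 0 R) f"
    unfolding set_integrable_def
    by (subst integrable_discrete_difference[where X = "{0}" and g = ?g]) (use e null in auto)
qed

lemma borel_measurable_w [measurable]: "w \<in> borel_measurable borel"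
  unfolding w_def by measurable

text \<open>Replacing the logarithm by \<open>w\<close> costs \<alpha>^e under the integral, and
  \<open>e / ps = (n - 1) / n\<close>. This is the origin of the extra factor in the constant of the
  theorem.\<close>

lemma sobolev_const_factor:
  "0 \<le> X \<Longrightarrow> S * \<alpha> powr (- ((n - 1) / n)) * (\<alpha> powr e * X) powr (1 / ps) = S * X powr (1 / ps)"
proof -
  assume X: "0 \<le> X"
  have "e * (1 / ps) = (n - 1) / n" unfolding e_def ps_def using p by (simp add: field_simps)
  then have "(\<alpha> powr e * X) powr (1 / ps) = \<alpha> powr ((n - 1) / n) * X powr (1 / ps)"
    using X by (simp add: powr_mult powr_powr)
  then show ?thesis using \<alpha>_pos by (simp add: powr_minus)
qed

context
  assumes dim: "n = real CARD('n::finite)"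
begin

lemma dim_power: "0 < x \<Longrightarrow> x ^ (DIM(real ^ 'n) - 1) = x powr (n - 1)"
  using n by (simp add: dim powr_realpow[symmetric] of_nat_diff)

text \<open>The tangential factor with exponent \<open>n - 1\<close> and the radial derivative with
  exponent \<open>\<alpha> + 1\<close> are powers of the same ratio, so the Jacobian is a single
  power.\<close>

lemma nn_integral_radial_map:
  fixes F :: "real ^ 'n \<Rightarrow> real"
  assumes h: "increasing_diffeo h (\<lambda>r. l * (h r / r) powr (\<alpha> + 1)) {0<..<R} J"
    and J: "J \<subseteq> {0<..}" "J \<in> sets borel"
    and F: "F \<in> borel_measurable borel" "\<And>x. norm x \<in> J \<Longrightarrow> 0 \<le> F x"
  shows "(\<integral>\<^sup>+x. ennreal (F x) * indicator J (norm x) \<partial>lborel)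
    = ball_int (\<lambda>x. F (radial_map h x) * (l * (h (norm x) / norm x) powr (n + \<alpha>)))"
proof -
  have "(\<integral>\<^sup>+x. ennreal (F x) * indicator J (norm x) \<partial>lborel)
    = (\<integral>\<^sup>+x. ennreal (F (radial_map h x)) * ennreal ((h (norm x) / norm x) ^ (DIM(real ^ 'n) - 1)
        * (l * (h (norm x) / norm x) powr (\<alpha> + 1))) * indicator {0<..<R} (norm x) \<partial>lborel)"
    unfolding radial_map_def using F(1) J by (intro nn_integral_radial_substitution[OF h]) auto
  also have "\<dots> = ball_int (\<lambda>x. F (radial_map h x) * (l * (h (norm x) / norm x) powr (n + \<alpha>)))"
    unfolding ball_int_def
  proof (intro nn_integral_cong)
    fix x :: "real ^ 'n"
    let ?k = "h (norm x) / norm x"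
    show "ennreal (F (radial_map h x)) * ennreal (?k ^ (DIM(real ^ 'n) - 1) * (l * ?k powr (\<alpha> + 1))) * indicator {0<..<R} (norm x)
      = ennreal (F (radial_map h x) * (l * ?k powr (n + \<alpha>))) * indicator {0<..<R} (norm x)"
    proof (cases "0 < norm x \<and> norm x < R")
      case True
      then have "h (norm x) \<in> J" using h by (auto simp: increasing_diffeo_def)
      moreover from this have "0 < h (norm x)" using J(1) by auto
      ultimately have k: "0 < ?k" and nonneg: "0 \<le> F (radial_map h x)"
        using True by (auto intro!: F(2) simp: norm_radial_map)
      from k have "?k ^ (DIM(real ^ 'n) - 1) * (l * ?k powr (\<alpha> + 1)) = l * ?k powr (n + \<alpha>)"
        by (simp only: dim_power) (simp add: powr_add[symmetric])
      with nonneg show ?thesis by (simp only: ennreal_mult')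
    qed (auto simp: indicator_def)
  qed
  finally show ?thesis .
qed

lemma nn_integral_\<phi>:
  fixes F :: "real ^ 'n \<Rightarrow> real"
  assumes F: "F \<in> borel_measurable borel" "\<And>x. 0 \<le> F x"
  shows "(\<integral>\<^sup>+y. ennreal (F y) \<partial>lborel)
    = ball_int (\<lambda>x. F (radial_map \<phi> x) * (\<phi> (norm x) / norm x) powr (n + \<alpha>))"
proof -
  have "(\<integral>\<^sup>+y. ennreal (F y) \<partial>lborel) = (\<integral>\<^sup>+y. ennreal (F y) * indicator {0<..} (norm y) \<partial>lborel)"
    using AE_lborel_singleton[of "0 :: real ^ 'n"] by (intro nn_integral_cong_AE) (auto elim!: eventually_mono)
  also have "\<dots> = ball_int (\<lambda>x. F (radial_map \<phi> x) * (1 * (\<phi> (norm x) / norm x) powr (n + \<alpha>)))"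
    by (rule nn_integral_radial_map[OF diffeo_\<phi>]) (use F in auto)
  finally show ?thesis by simp
qed

lemma ball_int_\<sigma>:
  fixes F :: "real ^ 'n \<Rightarrow> real"
  assumes l: "0 < l" and F: "F \<in> borel_measurable borel" "\<And>x. 0 < norm x \<Longrightarrow> norm x < R \<Longrightarrow> 0 \<le> F x"
  shows "ball_int F = ball_int (\<lambda>x. F (radial_map (\<sigma> l) x) * (l * (\<sigma> l (norm x) / norm x) powr (n + \<alpha>)))"
  unfolding ball_int_def[of F] by (rule nn_integral_radial_map[OF diffeo_\<sigma>[OF l]]) (use F in auto)

lemma Lp_eq:
  fixes u :: "real ^ 'n \<Rightarrow> real"
  assumes "0 < norm x"
  shows "Lp p R u x = (1 / w (norm x)) *\<^sub>R (grad u x - (sgn x \<bullet> grad u x) *\<^sub>R sgn x) + (sgn x \<bullet> grad u x) *\<^sub>R sgn x"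
proof -
  have "(n - p) / (p - 1) * logq ((n - 1) / (p - 1)) (R / norm x) = w (norm x)"
    using logq_eq[OF assms] \<alpha>_pos by (simp add: \<alpha>_def[symmetric])
  then show ?thesis
    unfolding Lp_def Let_def dim[symmetric]
    by (simp add: grad_tan_def grad_rad_def sgn_div_norm inverse_eq_divide)
qed

text \<open>The hypothesis \<open>eq\<close> says that the ratio of tangential to radial stretching
  is the ratio of the weights before and after the map. Hence both parts of \<open>Lp\<close>
  acquire the same factor.\<close>

lemma Lp_compose_radial:
  fixes u f :: "real ^ 'n \<Rightarrow> real"
  assumes x: "0 < norm x" and h: "0 < h (norm x)" and w: "w (norm x) \<noteq> 0" "w (h (norm x)) \<noteq> 0"
    and f: "grad f x = c *\<^sub>R ((h (norm x) / norm x) *\<^sub>R grad u (radial_map h x)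
      + ((h' - h (norm x) / norm x) * (sgn x \<bullet> grad u (radial_map h x))) *\<^sub>R sgn x)"
    and eq: "h (norm x) / norm x = h' * w (norm x) / w (h (norm x))"
  shows "Lp p R f x = (c * h') *\<^sub>R Lp p R u (radial_map h x)"
proof -
  let ?g = "grad u (radial_map h x)" and ?s = "sgn x" and ?k = "h (norm x) / norm x"
  have ss: "?s \<bullet> ?s = 1" using x by (intro inner_sgn_self) auto
  have rad: "?s \<bullet> grad f x = c * h' * (?s \<bullet> ?g)"
    unfolding f by (simp add: inner_add_right ss algebra_simps)
  have tan: "grad f x - (?s \<bullet> grad f x) *\<^sub>R ?s = (c * ?k) *\<^sub>R (?g - (?s \<bullet> ?g) *\<^sub>R ?s)"
    unfolding rad unfolding f by (simp add: algebra_simps)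
  have Hx: "norm (radial_map h x) = h (norm x)" "sgn (radial_map h x) = sgn x"
    using x h by (auto simp: norm_radial_map sgn_radial_map)
  have k: "1 / w (norm x) * (c * ?k) = c * h' * (1 / w (h (norm x)))"
    unfolding eq using w by simp
  have "Lp p R f x = (1 / w (norm x) * (c * ?k)) *\<^sub>R (?g - (?s \<bullet> ?g) *\<^sub>R ?s) + (c * h' * (?s \<bullet> ?g)) *\<^sub>R ?s"
    by (simp only: Lp_eq[OF x] tan) (simp add: rad)
  also have "\<dots> = (c * h') *\<^sub>R Lp p R u (radial_map h x)"
    unfolding k by (subst Lp_eq) (use h Hx in \<open>auto simp: scaleR_add_right\<close>)
  finally show ?thesis .
qed

lemma lhs_integrand_eq:
  fixes u :: "real ^ 'n \<Rightarrow> real"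
  assumes "0 < norm x" "norm x < R"
  shows "lhs_integrand p ps R u x = \<alpha> powr e * (\<bar>u x\<bar> powr ps * w (norm x) powr (- e))"
  using logq_eq[OF assms(1)] w_pos[OF assms] \<alpha>_pos
  unfolding lhs_integrand_def Let_def dim[symmetric] e_def[symmetric]
  by (simp add: powr_divide powr_minus_divide)

lemma lhs_norm_eq:
  fixes u U :: "real ^ 'n \<Rightarrow> real"
  assumes [measurable]: "U \<in> borel_measurable borel"
    and eq: "\<And>x. 0 < norm x \<Longrightarrow> norm x < R \<Longrightarrow> \<bar>u x\<bar> powr ps * w (norm x) powr (- e) = U x"
  shows "lhs_norm p ps R u = (\<alpha> powr e * enn2real (ball_int U)) powr (1 / ps)"
    and "ball_int U < \<infinity> \<Longrightarrow> set_integrable lebesgue (ball 0 R) (lhs_integrand p ps R u)"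
proof -
  have U: "0 \<le> U x" if "0 < norm x" "norm x < R" for x
    unfolding eq[OF that, symmetric] by simp
  have m: "(\<lambda>x. \<alpha> powr e * U x) \<in> borel_measurable borel" by measurable
  have i: "lhs_integrand p ps R u x = \<alpha> powr e * U x" if "0 < norm x" "norm x < R" for x
    using lhs_integrand_eq[OF that] eq[OF that] by simp
  have b: "ball_int (\<lambda>x. \<alpha> powr e * U x) = ennreal (\<alpha> powr e) * ball_int U"
    by (rule ball_int_cmult) auto
  note ib = integral_ball[where f = "lhs_integrand p ps R u", OF m _ i]
  show "lhs_norm p ps R u = (\<alpha> powr e * enn2real (ball_int U)) powr (1 / ps)"
    unfolding lhs_norm_def by (subst ib(1)) (auto simp: b enn2real_mult U)
  assume "ball_int U < \<infinity>"
  then show "set_integrable lebesgue (ball 0 R) (lhs_integrand p ps R u)"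
    by (intro ib(2)) (auto simp: b U ennreal_mult_less_top)
qed

lemma rhs_norm_eq:
  fixes u U :: "real ^ 'n \<Rightarrow> real"
  assumes U: "U \<in> borel_measurable borel"
    and eq: "\<And>x. 0 < norm x \<Longrightarrow> norm x < R \<Longrightarrow> norm (Lp p R u x) powr p = U x"
  shows "rhs_norm p R u = enn2real (ball_int U) powr (1 / p)"
    and "ball_int U < \<infinity> \<Longrightarrow> set_integrable lebesgue (ball 0 R) (rhs_integrand p R u)"
proof -
  have nn: "0 \<le> U x" if "0 < norm x" "norm x < R" for x
    unfolding eq[OF that, symmetric] by simp
  have i: "rhs_integrand p R u x = U x" if "0 < norm x" "norm x < R" for x
    using eq[OF that] by (simp add: rhs_integrand_def)
  note ib = integral_ball[where f = "rhs_integrand p R u", OF U _ i]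
  show "rhs_norm p R u = enn2real (ball_int U) powr (1 / p)"
    unfolding rhs_norm_def by (subst ib(1)) (auto simp: nn)
  assume "ball_int U < \<infinity>"
  then show "set_integrable lebesgue (ball 0 R) (rhs_integrand p R u)"
    by (intro ib(2)) (auto simp: nn)
qed

end

end

lemma borel_measurable_radial_map:
  fixes h :: "real \<Rightarrow> real"
  assumes [measurable]: "h \<in> borel_measurable borel"
  shows "radial_map h \<in> borel_measurable (borel :: 'a::euclidean_space measure)"
  unfolding radial_map_def by measurable

lemma borel_measurable_affine_conj [measurable]: "affine_conj \<alpha> l c \<in> borel_measurable borel"
  unfolding affine_conj_def by measurable

lemma borel_measurable_Lp:
  fixes u :: "real ^ 'n \<Rightarrow> real"
  assumes [measurable]: "grad u \<in> borel_measurable borel"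
  shows "Lp p R u \<in> borel_measurable borel"
  unfolding Lp_def Let_def grad_tan_def grad_rad_def logq_def by measurable

section \<open>Scaling invariance and the inequality on the ball\<close>

context sobolev_ball
begin

context
  assumes dim: "n = real CARD('n::finite)"
begin

lemma scale_pt_eq: "scale_pt p R l = (radial_map (\<sigma> l) :: real ^ 'n \<Rightarrow> _)"
proof -
  have "(p - 1) / (n - p) = 1 / \<alpha>" by (simp add: \<alpha>_def)
  then show ?thesis
    by (simp add: fun_eq_iff scale_pt_def Let_def dim[symmetric] radial_map_def \<sigma>_def affine_conj_def
        \<alpha>_def[symmetric] sgn_div_norm)
qed

text \<open>Both integrands change by the Jacobian of the scaling, up to a power of
  \<open>l\<close>: the prefactor would have to contribute \<open>l powr (1 - e)\<close> on the left
  and \<open>l powr (1 - p)\<close> on the right. The exponent \<open>- ((p - 1) / p)\<close> does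
  both.\<close>

theorem scaling_invariance:
  fixes u :: "real ^ 'n \<Rightarrow> real"
  assumes u: "u \<in> test_functions R" and l: "0 < l"
  shows "lhs_norm p ps R (scale_fun p R l u) = lhs_norm p ps R u"
    and "rhs_norm p R (scale_fun p R l u) = rhs_norm p R u"
proof -
  let ?H = "radial_map (\<sigma> l) :: real ^ 'n \<Rightarrow> real ^ 'n"
  define c where "c = l powr (- ((p - 1) / p))"
  define f where "f x = c * u (?H x)" for x
  have f: "scale_fun p R l u = f"
    by (simp add: fun_eq_iff scale_fun_def scale_pt_eq f_def c_def)
  have uc: "continuous_on UNIV u"
    by (intro continuous_at_imp_continuous_on ballI has_derivative_continuous[OF test_functions_has_derivative[OF u R]])
  have [measurable]: "u \<in> borel_measurable borel" "grad u \<in> borel_measurable borel"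
    using uc test_functions_grad_continuous[OF u R] by (auto intro: borel_measurable_continuous_onI)
  have [measurable]: "?H \<in> borel_measurable borel" "\<sigma> l \<in> borel_measurable borel"
    unfolding \<sigma>_def by (intro borel_measurable_radial_map borel_measurable_affine_conj)+
  have [measurable]: "Lp p R u \<in> borel_measurable borel"
    by (rule borel_measurable_Lp) measurable
  define k where "k x = \<sigma> l (norm x) / norm x" for x :: "real ^ 'n"
  have H: "0 < \<sigma> l (norm x)" "\<sigma> l (norm x) < R" "norm (?H x) = \<sigma> l (norm x)" "0 < k x"
    "w (\<sigma> l (norm x)) = l * k x powr \<alpha> * w (norm x)" "0 < w (norm x)"
    if "0 < norm x" "norm x < R" for x
    using that l \<sigma>_pos[of "norm x" l] \<sigma>_less[of l "norm x"] w_\<sigma>[of l "norm x"] w_pos[of "norm x"]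
    by (auto simp: norm_radial_map k_def)
  let ?F = "\<lambda>x. \<bar>u x\<bar> powr ps * w (norm x) powr (- e)"
  have "lhs_norm p ps R f = (\<alpha> powr e * enn2real (ball_int (\<lambda>x. ?F (?H x) * (l * k x powr (n + \<alpha>))))) powr (1 / ps)"
  proof (rule lhs_norm_eq(1)[OF dim])
    show "(\<lambda>x. ?F (?H x) * (l * k x powr (n + \<alpha>))) \<in> borel_measurable borel"
      unfolding k_def by measurable
    fix x :: "real ^ 'n" assume x: "0 < norm x" "norm x < R"
    have "(k x powr \<alpha>) powr (- e) = inverse (k x powr (n + \<alpha>))"
      unfolding powr_powr mult_minus_right \<alpha>_e by (rule powr_minus)
    then have W: "w (\<sigma> l (norm x)) powr (- e) = l powr (- e) * inverse (k x powr (n + \<alpha>)) * w (norm x) powr (- e)"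
      unfolding H(5)[OF x] using l H(4,6)[OF x] by (simp add: powr_mult)
    have "?F (?H x) * (l * k x powr (n + \<alpha>)) = \<bar>u (?H x)\<bar> powr ps * w (norm x) powr (- e) * (l powr (- e) * l)"
      unfolding H(3)[OF x] W using H(4)[OF x] by simp
    also have "l powr (- e) * l = l powr (1 - e)" using l by (simp add: powr_diff powr_minus_divide)
    also have "l powr (1 - e) = c powr ps"
    proof -
      have "1 - e = - ((p - 1) / p) * ps" using ps_e by (simp add: mult.commute)
      then show ?thesis unfolding c_def powr_powr by (simp only:)
    qed
    finally have "?F (?H x) * (l * k x powr (n + \<alpha>)) = \<bar>u (?H x)\<bar> powr ps * w (norm x) powr (- e) * c powr ps" .
    moreover have "\<bar>f x\<bar> powr ps = c powr ps * \<bar>u (?H x)\<bar> powr ps"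
      by (simp add: f_def abs_mult powr_mult c_def)
    ultimately show "\<bar>f x\<bar> powr ps * w (norm x) powr (- e) = ?F (?H x) * (l * k x powr (n + \<alpha>))"
      by (simp only: mult_ac)
  qed
  also have "ball_int (\<lambda>x. ?F (?H x) * (l * k x powr (n + \<alpha>))) = ball_int ?F"
  proof -
    have "?F \<in> borel_measurable borel" by measurable
    from ball_int_\<sigma>[OF dim l this] show ?thesis unfolding k_def by simp
  qed
  also have "(\<alpha> powr e * enn2real (ball_int ?F)) powr (1 / ps) = lhs_norm p ps R u"
    by (rule lhs_norm_eq(1)[OF dim, symmetric]) auto
  finally show "lhs_norm p ps R (scale_fun p R l u) = lhs_norm p ps R u" by (simp add: f)
  let ?G = "\<lambda>x. norm (Lp p R u x) powr p"
  have "rhs_norm p R f = enn2real (ball_int (\<lambda>x. ?G (?H x) * (l * k x powr (n + \<alpha>)))) powr (1 / p)"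
  proof (rule rhs_norm_eq(1)[OF dim])
    show "(\<lambda>x. ?G (?H x) * (l * k x powr (n + \<alpha>))) \<in> borel_measurable borel"
      unfolding k_def by measurable
    fix x :: "real ^ 'n" assume x: "0 < norm x" "norm x < R"
    let ?h' = "l * k x powr (\<alpha> + 1)"
    have d: "DERIV (\<sigma> l) (norm x) :> ?h'" unfolding k_def by (rule \<sigma>_deriv) (use x l in auto)
    have "(f has_derivative (\<lambda>h. c * (((\<sigma> l (norm x) / norm x) *\<^sub>R grad u (?H x)
        + ((?h' - \<sigma> l (norm x) / norm x) * (sgn x \<bullet> grad u (?H x))) *\<^sub>R sgn x) \<bullet> h))) (at x)"
      unfolding f_def using x
      by (intro has_derivative_mult_right has_derivative_compose_radial_map d test_functions_has_derivative[OF u R]) auto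
    then have g: "grad f x = c *\<^sub>R ((\<sigma> l (norm x) / norm x) *\<^sub>R grad u (?H x)
        + ((?h' - \<sigma> l (norm x) / norm x) * (sgn x \<bullet> grad u (?H x))) *\<^sub>R sgn x)"
      by (intro grad_eqI) simp
    have "Lp p R f x = (c * ?h') *\<^sub>R Lp p R u (?H x)"
    proof (rule Lp_compose_radial[OF dim x(1) H(1)[OF x] _ _ g])
      show "w (norm x) \<noteq> 0" "w (\<sigma> l (norm x)) \<noteq> 0"
        using H(1,2)[OF x] w_pos[of "norm x"] w_pos[of "\<sigma> l (norm x)"] x by auto
      show "\<sigma> l (norm x) / norm x = ?h' * w (norm x) / w (\<sigma> l (norm x))"
        unfolding H(5)[OF x] k_def[symmetric] using l H(4,6)[OF x] by (simp add: powr_add)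
    qed
    then have "norm (Lp p R f x) powr p = ?G (?H x) * (c powr p * (l powr p * k x powr (n + \<alpha>)))"
      using l by (simp add: c_def abs_mult powr_mult powr_powr \<alpha>_p)
    also have "c powr p * (l powr p * k x powr (n + \<alpha>)) = l * k x powr (n + \<alpha>)"
    proof -
      have "- ((p - 1) / p) * p = 1 - p" using p by simp
      then have "c powr p = l powr (1 - p)" unfolding c_def powr_powr by (simp only:)
      then have "c powr p * l powr p = l" using l by (simp add: powr_add[symmetric])
      then show ?thesis by simp
    qed
    finally show "norm (Lp p R f x) powr p = ?G (?H x) * (l * k x powr (n + \<alpha>))" .
  qed
  also have "ball_int (\<lambda>x. ?G (?H x) * (l * k x powr (n + \<alpha>))) = ball_int ?G"
  proof -
    have "?G \<in> borel_measurable borel" by measurable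
    from ball_int_\<sigma>[OF dim l this] show ?thesis unfolding k_def by simp
  qed
  also have "enn2real (ball_int ?G) powr (1 / p) = rhs_norm p R u"
    by (rule rhs_norm_eq(1)[OF dim, symmetric]) auto
  finally show "rhs_norm p R (scale_fun p R l u) = rhs_norm p R u" by (simp add: f)
qed

text \<open>The sharp inequality is applied to \<open>v\<close>, which is \<open>u\<close> composed
  with the inverse change of variables. The delicate point is the origin, where \<open>v\<close>
  must be shown to be continuously differentiable although the map is given in polar form.\<close>

theorem sobolev_ball_inequality:
  fixes u :: "real ^ 'n \<Rightarrow> real"
  assumes u: "u \<in> test_functions R"
  shows "sobolev_const n p * \<alpha> powr (- ((n - 1) / n)) * lhs_norm p ps R u \<le> rhs_norm p R u"
proof -
  let ?P = "radial_map \<psi> :: real ^ 'n \<Rightarrow> real ^ 'n"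
  \<comment> \<open>The ratio \<open>\<psi> s / s\<close> in a form that extends continuously to
    \<open>s = 0\<close> with value 1; the derivative of \<psi> is its power with exponent
    \<open>\<alpha> + 1\<close>.\<close>
  define \<kappa> where "\<kappa> s = (1 + (s / R) powr \<alpha>) powr (- (1 / \<alpha>))" for s
  define v where "v y = u (?P y)" for y
  define g where "g y = \<kappa> (norm y) *\<^sub>R grad u (?P y)
    + ((\<kappa> (norm y) powr (\<alpha> + 1) - \<kappa> (norm y)) * (sgn y \<bullet> grad u (?P y))) *\<^sub>R sgn y" for y
  have \<kappa>: "\<kappa> s = \<psi> s / s" if s: "0 < s" for s
  proof -
    have "1 * s powr (- \<alpha>) + R powr (- \<alpha>) = s powr (- \<alpha>) * (1 + (s / R) powr \<alpha>)"
      using s R by (simp add: powr_divide powr_minus field_simps)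
    then have "\<psi> s = s * \<kappa> s"
      unfolding \<psi>_def affine_conj_def \<kappa>_def using s \<alpha>_pos by (simp add: powr_mult powr_powr add_nonneg_nonneg)
    then show ?thesis using s by simp
  qed
  have \<kappa>_pos: "0 < \<kappa> s" for s
  proof -
    have "0 < 1 + (s / R) powr \<alpha>" by (intro add_pos_nonneg) auto
    then show ?thesis by (simp add: \<kappa>_def)
  qed
  have \<kappa>c: "continuous_on {0..} \<kappa>"
    unfolding \<kappa>_def using \<alpha>_pos R
    by (intro continuous_on_powr continuous_on_add continuous_on_const continuous_on_powr' continuous_on_divide continuous_on_id)
      (auto simp: add_nonneg_eq_0_iff)
  have \<kappa>0: "\<kappa> 0 = 1" by (simp add: \<kappa>_def)
  have \<kappa>nc: "continuous_on UNIV (\<lambda>y :: real ^ 'n. \<kappa> (norm y))"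
    by (intro continuous_on_compose2[OF \<kappa>c] continuous_intros) auto
  have Peq: "?P y = \<kappa> (norm y) *\<^sub>R y" for y
    by (cases "y = 0") (simp_all add: radial_map_def \<kappa> sgn_div_norm divide_inverse)
  have Pc: "continuous_on UNIV ?P"
    unfolding Peq by (intro continuous_intros \<kappa>nc)
  have gradc: "continuous_on UNIV (\<lambda>y. grad u (?P y))"
    by (rule continuous_on_compose2[OF test_functions_grad_continuous[OF u R] Pc]) auto
  have dv: "(v has_derivative (\<lambda>h. g y \<bullet> h)) (at y)" for y
  proof (cases "y = 0")
    case True
    have "(u has_derivative (\<lambda>h. grad u (?P 0) \<bullet> h)) (at (?P 0))"
      by (rule test_functions_has_derivative[OF u R])
    moreover have "(?P has_derivative (\<lambda>x. x)) (at 0)"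
      by (rule has_derivative_radial_map_at_0[OF \<kappa>c \<kappa>0]) (simp add: \<kappa>)
    ultimately have "((\<lambda>y. u (?P y)) has_derivative (\<lambda>h. grad u (?P 0) \<bullet> h)) (at 0)"
      using has_derivative_compose by blast
    then show ?thesis by (simp add: True v_def g_def \<kappa>0 flip: v_def[abs_def])
  next
    case False
    then have s: "0 < norm y" by simp
    have "DERIV \<psi> (norm y) :> \<kappa> (norm y) powr (\<alpha> + 1)"
      using \<psi>_deriv[OF s] by (simp add: \<kappa>[OF s])
    from has_derivative_compose_radial_map[OF False this test_functions_has_derivative[OF u R]]
    show ?thesis by (simp add: v_def[abs_def] g_def \<kappa>[OF s])
  qed
  have gc: "continuous_on UNIV g"
  proof -
    have "isCont g y" for y
    proof (cases "y = 0")
      case False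
      have iso: "isCont (\<lambda>y. \<kappa> (norm y)) y" "isCont (\<lambda>y. grad u (?P y)) y"
        using \<kappa>nc gradc by (auto simp: continuous_on_eq_continuous_at)
      have "isCont sgn y" using False unfolding isCont_def by (intro tendsto_sgn tendsto_ident_at) auto
      then show ?thesis
        unfolding g_def using iso by (intro continuous_intros iso) (use \<kappa>_pos False in \<open>auto simp: less_le\<close>)
    next
      case True
      have lim: "((\<lambda>y. \<kappa> (norm y)) \<longlongrightarrow> 1) (at (0 :: real ^ 'n))"
        using \<kappa>nc \<kappa>0 unfolding continuous_on_def by (metis UNIV_I norm_zero)
      have limg: "((\<lambda>y. grad u (?P y)) \<longlongrightarrow> grad u (?P 0)) (at 0)"
        using gradc unfolding continuous_on_def by blast
      \<comment> \<open>The direction \<open>sgn y\<close> has no limit at the origin, but its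
        coefficient tends to 0 because both powers of \<kappa> tend to 1.\<close>
      have z: "((\<lambda>y. ((\<kappa> (norm y) powr (\<alpha> + 1) - \<kappa> (norm y)) * (sgn y \<bullet> grad u (?P y))) *\<^sub>R sgn y) \<longlongrightarrow> 0) (at 0)"
      proof (rule Lim_null_comparison)
        have "((\<lambda>y. \<bar>\<kappa> (norm y) powr (\<alpha> + 1) - \<kappa> (norm y)\<bar> * norm (grad u (?P y)))
          \<longlongrightarrow> \<bar>1 powr (\<alpha> + 1) - 1\<bar> * norm (grad u (?P 0))) (at 0)"
          by (intro tendsto_intros lim limg) auto
        then show "((\<lambda>y. \<bar>\<kappa> (norm y) powr (\<alpha> + 1) - \<kappa> (norm y)\<bar> * norm (grad u (?P y))) \<longlongrightarrow> 0) (at 0)"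
          by simp
        show "\<forall>\<^sub>F y in at 0. norm (((\<kappa> (norm y) powr (\<alpha> + 1) - \<kappa> (norm y)) * (sgn y \<bullet> grad u (?P y))) *\<^sub>R sgn y)
          \<le> \<bar>\<kappa> (norm y) powr (\<alpha> + 1) - \<kappa> (norm y)\<bar> * norm (grad u (?P y))"
        proof (intro always_eventually allI)
          fix y :: "real ^ 'n"
          have "\<bar>sgn y \<bullet> grad u (?P y)\<bar> \<le> norm (sgn y) * norm (grad u (?P y))" by (rule Cauchy_Schwarz_ineq2)
          also have "\<dots> \<le> 1 * norm (grad u (?P y))" by (intro mult_right_mono) (auto simp: norm_sgn)
          finally have "\<bar>sgn y \<bullet> grad u (?P y)\<bar> * norm (sgn y) \<le> norm (grad u (?P y)) * 1"
            by (intro mult_mono) (auto simp: norm_sgn)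
          from mult_left_mono[OF this, of "\<bar>\<kappa> (norm y) powr (\<alpha> + 1) - \<kappa> (norm y)\<bar>"]
          show "norm (((\<kappa> (norm y) powr (\<alpha> + 1) - \<kappa> (norm y)) * (sgn y \<bullet> grad u (?P y))) *\<^sub>R sgn y)
          \<le> \<bar>\<kappa> (norm y) powr (\<alpha> + 1) - \<kappa> (norm y)\<bar> * norm (grad u (?P y))"
            by (simp add: abs_mult mult.assoc)
        qed
      qed
      have "(g \<longlongrightarrow> 1 *\<^sub>R grad u (?P 0) + 0) (at 0)"
        unfolding g_def by (intro tendsto_add tendsto_scaleR lim limg z)
      moreover have "g 0 = 1 *\<^sub>R grad u (?P 0) + 0" by (simp add: g_def \<kappa>0)
      ultimately show ?thesis by (simp add: True isCont_def)
    qed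
    then show ?thesis by (intro continuous_at_imp_continuous_on) auto
  qed
  have vc: "continuous_on UNIV v"
    by (intro continuous_at_imp_continuous_on ballI has_derivative_continuous[OF dv])
  have [measurable]: "v \<in> borel_measurable borel" "g \<in> borel_measurable borel"
    using vc gc by (auto intro: borel_measurable_continuous_onI)
  obtain R0 where R0: "0 < R0" "R0 < R" "\<And>x. u x \<noteq> 0 \<Longrightarrow> norm x \<le> R0"
    using test_functions_support[OF u R] by blast
  \<comment> \<open>The summand 1 turns the bound \<open>\<phi> R0\<close> for the support into a
    strict one.\<close>
  have supp: "norm y < \<phi> R0 + 1" if "v y \<noteq> 0" for y
  proof (cases "y = 0")
    case True
    then show ?thesis using \<phi>_pos[OF R0(1,2)] by simp
  next
    case False
    then have s: "0 < norm y" by simp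
    have "\<psi> (norm y) \<le> R0"
      using R0(3)[of "?P y"] that \<psi>_pos[OF s] False by (simp add: v_def norm_radial_map)
    then have "R0 powr (- \<alpha>) \<le> \<psi> (norm y) powr (- \<alpha>)"
      using \<psi>_pos[OF s] \<alpha>_pos by (intro powr_mono2') auto
    then have le: "\<phi> R0 powr (- \<alpha>) \<le> norm y powr (- \<alpha>)"
      using s R0 by (simp add: \<psi>_powr \<phi>_powr)
    have "norm y \<le> \<phi> R0"
    proof (rule ccontr)
      assume "\<not> norm y \<le> \<phi> R0"
      then have "norm y powr (- \<alpha>) < \<phi> R0 powr (- \<alpha>)"
        using \<phi>_pos[OF R0(1,2)] \<alpha>_pos by (intro powr_less_mono2_neg) auto
      then show False using le by simp
    qed
    then show ?thesis by simp
  qed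
  have S: "sobolev_const n p * (LINT y | lborel. \<bar>v y\<bar> powr ps) powr (1 / ps)
    \<le> (LINT y | lborel. norm (g y) powr p) powr (1 / p)"
    using sobolev_sharp[OF p[unfolded dim] dv gc supp, folded dim, folded ps_def] .
  have inv: "?P (radial_map \<phi> x) = x" if "0 < norm x" "norm x < R" for x
  proof -
    have "norm (radial_map \<phi> x) = \<phi> (norm x)" "sgn (radial_map \<phi> x) = sgn x"
      using that \<phi>_pos[OF that] by (auto simp: norm_radial_map sgn_radial_map)
    then have "?P (radial_map \<phi> x) = norm x *\<^sub>R sgn x"
      using that by (simp add: radial_map_def[of \<psi>] \<psi>_\<phi>)
    then show ?thesis using that by (simp add: sgn_div_norm)
  qed
  have vint: "(\<integral>\<^sup>+y. ennreal (\<bar>v y\<bar> powr ps) \<partial>lborel) = ball_int (\<lambda>x. \<bar>u x\<bar> powr ps * w (norm x) powr (- e))"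
  proof -
    have "(\<integral>\<^sup>+y. ennreal (\<bar>v y\<bar> powr ps) \<partial>lborel)
        = ball_int (\<lambda>x. \<bar>v (radial_map \<phi> x)\<bar> powr ps * (\<phi> (norm x) / norm x) powr (n + \<alpha>))"
      by (rule nn_integral_\<phi>[OF dim]) auto
    also have "\<dots> = ball_int (\<lambda>x. \<bar>u x\<bar> powr ps * w (norm x) powr (- e))"
    proof (rule ball_int_cong)
      fix x :: "real ^ 'n" assume x: "0 < norm x" "norm x < R"
      have "- \<alpha> * - e = n + \<alpha>" using \<alpha>_e by simp
      then have "w (norm x) powr (- e) = (\<phi> (norm x) / norm x) powr (n + \<alpha>)"
        unfolding w_\<phi>[OF x] powr_powr by (simp only:)
      then show "\<bar>v (radial_map \<phi> x)\<bar> powr ps * (\<phi> (norm x) / norm x) powr (n + \<alpha>) = \<bar>u x\<bar> powr ps * w (norm x) powr (- e)"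
        by (simp add: v_def inv[OF x])
    qed
    finally show ?thesis .
  qed
  have gint: "(\<integral>\<^sup>+y. ennreal (norm (g y) powr p) \<partial>lborel) = ball_int (\<lambda>x. norm (Lp p R u x) powr p)"
  proof -
    have "(\<integral>\<^sup>+y. ennreal (norm (g y) powr p) \<partial>lborel)
        = ball_int (\<lambda>x. norm (g (radial_map \<phi> x)) powr p * (\<phi> (norm x) / norm x) powr (n + \<alpha>))"
      by (rule nn_integral_\<phi>[OF dim]) auto
    also have "\<dots> = ball_int (\<lambda>x. norm (Lp p R u x) powr p)"
    proof (rule ball_int_cong)
      fix x :: "real ^ 'n" assume x: "0 < norm x" "norm x < R"
      define k where "k = \<kappa> (\<phi> (norm x))"
      have \<phi>: "0 < \<phi> (norm x)" by (rule \<phi>_pos[OF x])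
      have Hx: "norm (radial_map \<phi> x) = \<phi> (norm x)" "sgn (radial_map \<phi> x) = sgn x"
        using x \<phi> by (auto simp: norm_radial_map sgn_radial_map)
      have k: "k = norm x / \<phi> (norm x)" unfolding k_def using \<phi> x by (simp add: \<kappa> \<psi>_\<phi>)
      have k0: "0 < k" unfolding k_def by (rule \<kappa>_pos)
      \<comment> \<open>Since \<open>w (norm x) = k powr \<alpha>\<close>, dividing by the weight
        turns the radial factor into the tangential one; this is what makes the gradient of
        \<open>v\<close> a multiple of \<open>Lp\<close>.\<close>
      have kw: "k powr (\<alpha> + 1) * (1 / w (norm x)) = k"
      proof -
        have "w (norm x) = k powr \<alpha>"
          unfolding w_\<phi>[OF x] k using x \<phi> by (simp add: powr_divide powr_minus_divide)
        then show ?thesis using k0 by (simp add: powr_add)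
      qed
      have "g (radial_map \<phi> x) = k *\<^sub>R grad u x + ((k powr (\<alpha> + 1) - k) * (sgn x \<bullet> grad u x)) *\<^sub>R sgn x"
        by (simp add: g_def Hx inv[OF x] k_def)
      also have "\<dots> = k *\<^sub>R (grad u x - (sgn x \<bullet> grad u x) *\<^sub>R sgn x) + (k powr (\<alpha> + 1) * (sgn x \<bullet> grad u x)) *\<^sub>R sgn x"
        by (simp add: algebra_simps)
      also have "\<dots> = k powr (\<alpha> + 1) *\<^sub>R Lp p R u x"
        by (simp add: Lp_eq[OF dim x(1)] scaleR_add_right kw[simplified])
      finally have "norm (g (radial_map \<phi> x)) powr p = k powr (n + \<alpha>) * norm (Lp p R u x) powr p"
        by (simp add: powr_mult powr_powr \<alpha>_p)
      moreover have "k powr (n + \<alpha>) * (\<phi> (norm x) / norm x) powr (n + \<alpha>) = 1"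
        unfolding k using x \<phi> by (simp add: powr_divide)
      ultimately show "norm (g (radial_map \<phi> x)) powr p * (\<phi> (norm x) / norm x) powr (n + \<alpha>) = norm (Lp p R u x) powr p"
        by (simp add: mult_ac)
    qed
    finally show ?thesis .
  qed
  have [measurable]: "u \<in> borel_measurable borel" "grad u \<in> borel_measurable borel"
    using test_functions_grad_continuous[OF u R]
    by (auto intro!: borel_measurable_continuous_onI continuous_at_imp_continuous_on has_derivative_continuous[OF test_functions_has_derivative[OF u R]])
  have [measurable]: "Lp p R u \<in> borel_measurable borel"
    by (rule borel_measurable_Lp) measurable
  have "lhs_norm p ps R u = (\<alpha> powr e * enn2real (ball_int (\<lambda>x. \<bar>u x\<bar> powr ps * w (norm x) powr (- e)))) powr (1 / ps)"
    by (rule lhs_norm_eq(1)[OF dim]) auto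
  also have "\<dots> = (\<alpha> powr e * (LINT y | lborel. \<bar>v y\<bar> powr ps)) powr (1 / ps)"
    unfolding vint[symmetric] by (subst integral_eq_nn_integral) auto
  finally have L: "sobolev_const n p * \<alpha> powr (- ((n - 1) / n)) * lhs_norm p ps R u
      = sobolev_const n p * (LINT y | lborel. \<bar>v y\<bar> powr ps) powr (1 / ps)"
    by (simp add: sobolev_const_factor integral_nonneg_AE)
  have "rhs_norm p R u = enn2real (ball_int (\<lambda>x. norm (Lp p R u x) powr p)) powr (1 / p)"
    by (rule rhs_norm_eq(1)[OF dim]) auto
  also have "\<dots> = (LINT y | lborel. norm (g y) powr p) powr (1 / p)"
    unfolding gint[symmetric] by (subst integral_eq_nn_integral) auto
  finally show ?thesis using S unfolding L by simp
qed

end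

end

subsection \<open>Smooth truncations\<close>

text \<open>The derivative is quantified existentially on an arbitrary set, so closure rules just
  exhibit a witness and smoothness can be glued from open pieces.\<close>

primrec Dk :: "nat \<Rightarrow> real set \<Rightarrow> (real \<Rightarrow> real) \<Rightarrow> bool" where
  "Dk 0 S f \<longleftrightarrow> continuous_on S f"
| "Dk (Suc k) S f \<longleftrightarrow> (\<exists>f'. (\<forall>x\<in>S. DERIV f x :> f' x) \<and> Dk k S f')"

lemma Dk_SucI: "(\<And>x. x \<in> S \<Longrightarrow> DERIV f x :> f' x) \<Longrightarrow> Dk k S f' \<Longrightarrow> Dk (Suc k) S f"
  by auto

lemma Dk_SucE:
  assumes "Dk (Suc k) S f"
  obtains f' where "\<And>x. x \<in> S \<Longrightarrow> DERIV f x :> f' x" "Dk k S f'"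
  using assms by auto

lemma Dk_Suc_imp: "Dk (Suc k) S f \<Longrightarrow> Dk k S f"
proof (induction k arbitrary: f)
  case 0
  then show ?case by (auto intro!: continuous_at_imp_continuous_on dest: DERIV_isCont)
next
  case (Suc k)
  then show ?case by (metis Dk.simps(2))
qed

lemma Dk_cong:
  assumes "open S" "Dk k S f" "\<And>x. x \<in> S \<Longrightarrow> f x = g x"
  shows "Dk k S g"
proof (cases k)
  case 0
  then show ?thesis using assms by (auto cong: continuous_on_cong)
next
  case (Suc j)
  then obtain f' where f': "\<And>x. x \<in> S \<Longrightarrow> DERIV f x :> f' x" "Dk j S f'" using assms by auto
  have "DERIV g x :> f' x" if "x \<in> S" for x
    using has_field_derivative_transform_within_open[OF f'(1)[OF that] assms(1) that] assms(3) by auto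
  then show ?thesis using f'(2) Suc by auto
qed

lemma Dk_subset: "Dk k S f \<Longrightarrow> T \<subseteq> S \<Longrightarrow> Dk k T f"
  by (induction k arbitrary: f) (auto intro: continuous_on_subset)

lemma Dk_const: "Dk k S (\<lambda>x. c)"
proof (induction k arbitrary: c)
  case (Suc k)
  then show ?case by (intro Dk_SucI[where f' = "\<lambda>x. 0"]) auto
qed auto

lemma Dk_ident: "Dk k S (\<lambda>x. x)"
proof (cases k)
  case (Suc j)
  then show ?thesis using Dk_const[of j S 1] by (auto intro!: exI[of _ "\<lambda>x. 1"])
qed auto

lemma Dk_add: "Dk k S f \<Longrightarrow> Dk k S g \<Longrightarrow> Dk k S (\<lambda>x. f x + g x)"
proof (induction k arbitrary: f g)
  case (Suc k)
  obtain f' where "\<And>x. x \<in> S \<Longrightarrow> DERIV f x :> f' x" "Dk k S f'" by (rule Dk_SucE[OF Suc.prems(1)]) blast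
  moreover obtain g' where "\<And>x. x \<in> S \<Longrightarrow> DERIV g x :> g' x" "Dk k S g'" by (rule Dk_SucE[OF Suc.prems(2)]) blast
  ultimately show ?case using Suc.IH by (intro Dk_SucI[where f' = "\<lambda>x. f' x + g' x"] DERIV_add) auto
qed (auto intro: continuous_intros)

lemma Dk_mult: "Dk k S f \<Longrightarrow> Dk k S g \<Longrightarrow> Dk k S (\<lambda>x. f x * g x)"
proof (induction k arbitrary: f g)
  case (Suc k)
  obtain f' where f': "\<And>x. x \<in> S \<Longrightarrow> DERIV f x :> f' x" "Dk k S f'" by (rule Dk_SucE[OF Suc.prems(1)]) blast
  obtain g' where g': "\<And>x. x \<in> S \<Longrightarrow> DERIV g x :> g' x" "Dk k S g'" by (rule Dk_SucE[OF Suc.prems(2)]) blast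
  note Dk_Suc_imp[OF Suc.prems(1)] Dk_Suc_imp[OF Suc.prems(2)]
  with f' g' show ?case using Suc.IH
    by (intro Dk_SucI[where f' = "\<lambda>x. f' x * g x + g' x * f x"] DERIV_mult Dk_add) auto
qed (auto intro: continuous_intros)

lemma Dk_compose: "Dk k T f \<Longrightarrow> Dk k S g \<Longrightarrow> g ` S \<subseteq> T \<Longrightarrow> Dk k S (\<lambda>x. f (g x))"
proof (induction k arbitrary: f g)
  case 0
  then show ?case by (auto intro: continuous_on_compose2)
next
  case (Suc k)
  obtain f' where f': "\<And>x. x \<in> T \<Longrightarrow> DERIV f x :> f' x" "Dk k T f'" by (rule Dk_SucE[OF Suc.prems(1)]) blast
  obtain g' where g': "\<And>x. x \<in> S \<Longrightarrow> DERIV g x :> g' x" "Dk k S g'" by (rule Dk_SucE[OF Suc.prems(2)]) blast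
  have "Dk k S (\<lambda>x. f' (g x))" by (rule Suc.IH[OF f'(2) Dk_Suc_imp[OF Suc.prems(2)] Suc.prems(3)])
  then show ?case using f' g' Suc.prems(3)
    by (intro Dk_SucI[where f' = "\<lambda>x. f' (g x) * g' x"] DERIV_chain2 Dk_mult) auto
qed

lemma Dk_powr: "Dk k {0<..} (\<lambda>x. x powr c)"
proof (induction k arbitrary: c)
  case (Suc k)
  show ?case
  proof (rule Dk_SucI)
    show "DERIV (\<lambda>x. x powr c) x :> c * x powr (c - 1)" if "x \<in> {0<..}" for x
      using that by (intro has_real_derivative_powr) auto
    show "Dk k {0<..} (\<lambda>x. c * x powr (c - 1))"
      by (intro Dk_mult Dk_const Suc.IH)
  qed
qed (auto intro!: continuous_intros)

text \<open>The derivatives on the two pieces agree on the overlap by uniqueness, so they glue to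
  one function and the induction hypothesis applies to it.\<close>

lemma Dk_Un:
  assumes "open S" "open T"
  shows "Dk k S f \<Longrightarrow> Dk k T f \<Longrightarrow> Dk k (S \<union> T) f"
proof (induction k arbitrary: f)
  case 0
  then show ?case using assms by (simp add: continuous_on_open_Un)
next
  case (Suc k)
  obtain f1 where f1: "\<And>x. x \<in> S \<Longrightarrow> DERIV f x :> f1 x" "Dk k S f1" by (rule Dk_SucE[OF Suc.prems(1)]) blast
  obtain f2 where f2: "\<And>x. x \<in> T \<Longrightarrow> DERIV f x :> f2 x" "Dk k T f2" by (rule Dk_SucE[OF Suc.prems(2)]) blast
  note * = f1 f2
  define f' where "f' x = (if x \<in> S then f1 x else f2 x)" for x
  have eq: "f' x = f2 x" if "x \<in> T" for x
    using that *(1,3) by (auto simp: f'_def intro: DERIV_unique)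
  have "Dk k S f'" by (rule Dk_cong[OF assms(1) *(2)]) (simp add: f'_def)
  moreover have "Dk k T f'" by (rule Dk_cong[OF assms(2) *(4)]) (simp add: eq)
  ultimately have "Dk k (S \<union> T) f'" by (rule Suc.IH)
  then show ?case using * eq by (intro Dk_SucI[where f' = f']) (auto simp: f'_def)
qed

text \<open>\<open>flat 0\<close> is the classical smooth function vanishing to infinite order at 0.
  The powers of \<open>inverse x\<close> make the family closed under differentiation up to linear
  combinations.\<close>

definition flat :: "nat \<Rightarrow> real \<Rightarrow> real" where
  "flat m x = (if 0 < x then inverse x ^ m * exp (- inverse x) else 0)"

lemma flat_tendsto_0: "(flat m \<longlongrightarrow> 0) (at 0)"
proof -
  have "((\<lambda>y :: real. y ^ m / exp y) \<longlongrightarrow> 0) at_top" by (rule tendsto_power_div_exp_0)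
  from filterlim_compose[OF this filterlim_inverse_at_top_right]
  have "((\<lambda>x :: real. inverse x ^ m / exp (inverse x)) \<longlongrightarrow> 0) (at_right 0)" .
  then have "(flat m \<longlongrightarrow> 0) (at_right 0)"
  proof (rule Lim_transform_eventually)
    show "\<forall>\<^sub>F x in at_right 0. inverse x ^ m / exp (inverse x) = flat m x"
      by (rule eventually_at_rightI[of 0 1]) (auto simp: flat_def exp_minus divide_inverse)
  qed
  moreover have "(flat m \<longlongrightarrow> 0) (at_left 0)"
  proof (rule Lim_transform_eventually[OF tendsto_const])
    show "\<forall>\<^sub>F x in at_left 0. 0 = flat m x"
      by (rule eventually_at_leftI[of "-1" 0]) (auto simp: flat_def)
  qed
  ultimately show ?thesis by (simp add: filterlim_split_at)
qed

lemma DERIV_flat: "DERIV (flat m) x :> flat (m + 2) x - real m * flat (m + 1) x"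
proof (cases "x = 0")
  case True
  \<comment> \<open>At 0 the difference quotient of \<open>flat m\<close> is
    \<open>flat (m + 1)\<close>.\<close>
  have "((\<lambda>h. flat (m + 1) h) \<longlongrightarrow> 0) (at 0)" by (rule flat_tendsto_0)
  then have "((\<lambda>h. (flat m (0 + h) - flat m 0) / h) \<longlongrightarrow> 0) (at 0)"
    by (rule Lim_transform_eventually) (auto simp: eventually_at_filter flat_def divide_inverse)
  then show ?thesis by (simp add: True DERIV_def flat_def)
next
  case False
  show ?thesis
  proof (cases "0 < x")
    case True
    have d: "DERIV (\<lambda>x. inverse x ^ m * exp (- inverse x)) x :> flat (m + 2) x - real m * flat (m + 1) x"
    proof -
      have inv: "DERIV inverse x :> - (inverse x ^ Suc (Suc 0))" using True by (intro DERIV_inverse) auto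
      have dm: "DERIV (\<lambda>x. inverse x ^ m) x :> - real m * inverse x ^ (m + 1)"
        by (rule DERIV_cong[OF DERIV_power[OF inv]]) (cases m; simp add: algebra_simps)
      have de: "DERIV (\<lambda>x. exp (- inverse x)) x :> exp (- inverse x) * - (- (inverse x ^ Suc (Suc 0)))"
        by (intro DERIV_fun_exp DERIV_minus inv)
      show ?thesis
        by (rule DERIV_cong[OF DERIV_mult[OF dm de]]) (use True in \<open>simp add: flat_def\<close>)
    qed
    show ?thesis
      by (rule has_field_derivative_transform_within_open[OF d, of "{0<..}"]) (use True in \<open>auto simp: flat_def\<close>)
  next
    case x: False
    have d: "DERIV (\<lambda>x. 0) x :> flat (m + 2) x - real m * flat (m + 1) x" using x by (simp add: flat_def)
    show ?thesis
      by (rule has_field_derivative_transform_within_open[OF d, of "{..<0}"]) (use x False in \<open>auto simp: flat_def\<close>)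
  qed
qed

lemma Dk_flat: "Dk k S (flat m)"
proof (induction k arbitrary: m)
  case 0
  then show ?case by (auto intro!: continuous_at_imp_continuous_on DERIV_isCont[OF DERIV_flat])
next
  case (Suc k)
  have "Dk k S (\<lambda>x. flat (m + 2) x + (- real m) * flat (m + 1) x)"
    by (intro Dk_add Dk_mult Dk_const Suc.IH)
  then show ?case using DERIV_flat[of m] by (intro Dk_SucI[where f' = "\<lambda>x. flat (m + 2) x - real m * flat (m + 1) x"]) auto
qed

text \<open>The function \<open>h\<close> has values between 0 and 1 and is positive exactly
  strictly between \<epsilon> and \<open>M - \<epsilon>\<close>, so its primitive is 0 before and
  constant after. Its arguments are written with \<open>+\<close> and \<open>*\<close> only, to suit
  \<open>Dk_add\<close> and \<open>Dk_mult\<close>.\<close>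

lemma smooth_truncation_exists:
  fixes M \<epsilon> :: real
  assumes \<epsilon>: "0 < \<epsilon>"
  defines "h \<equiv> \<lambda>t. flat 0 (inverse \<epsilon> * t + - 1) * flat 0 (inverse \<epsilon> * (M + - 1 * t) + - 1)"
  defines "H \<equiv> \<lambda>t. integral {0..t} h"
  shows "0 < t \<Longrightarrow> DERIV H t :> h t" and "0 \<le> h t" and "h t \<le> 1"
    and "0 \<le> t \<Longrightarrow> 0 \<le> H t" and "0 \<le> t \<Longrightarrow> H t \<le> t"
    and "Dk k {0<..} H"
    and "t \<le> \<epsilon> \<Longrightarrow> H t = 0"
    and "0 \<le> M - \<epsilon> \<Longrightarrow> M - \<epsilon> \<le> t \<Longrightarrow> H t = H (M - \<epsilon>)"
    and "continuous_on UNIV h"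
proof -
  have Dh: "Dk k UNIV h" for k
    unfolding h_def by (intro Dk_mult Dk_compose[OF Dk_flat] Dk_add Dk_const Dk_ident) auto
  have hc: "continuous_on S h" for S
    using Dh[of 0] by (auto intro: continuous_on_subset)
  then show "continuous_on UNIV h" .
  have hi: "h integrable_on {a..b}" for a b by (intro integrable_continuous_real hc)
  have f01: "0 \<le> flat 0 x" "flat 0 x \<le> 1" for x by (auto simp: flat_def)
  have h0: "0 \<le> h t" and h1: "h t \<le> 1" for t
    unfolding h_def using f01 by (auto intro: mult_nonneg_nonneg mult_le_one)
  then show "0 \<le> h t" "h t \<le> 1" by auto
  have D: "DERIV H t :> h t" if "0 < t" for t
  proof -
    have "(H has_real_derivative h t) (at t within {0..t + 1})"
      unfolding H_def using that by (intro integral_has_real_derivative hc) auto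
    then show ?thesis using that by (simp add: at_within_Icc_at)
  qed
  then show "0 < t \<Longrightarrow> DERIV H t :> h t" .
  show "0 \<le> t \<Longrightarrow> 0 \<le> H t"
    unfolding H_def by (intro integral_nonneg hi) (auto simp: h0)
  show "H t \<le> t" if "0 \<le> t"
  proof -
    have "H t \<le> integral {0..t} (\<lambda>_. 1)"
      unfolding H_def by (intro integral_le hi) (auto simp: h1)
    then show ?thesis using that by simp
  qed
  show "Dk k {0<..} H"
    by (rule Dk_Suc_imp, rule Dk_SucI[where f' = h]) (auto intro: D Dk_subset[OF Dh])
  show "H t = 0" if "t \<le> \<epsilon>"
  proof -
    have "integral {0..t} h = integral {0..t} (\<lambda>_. 0)"
      using that \<epsilon> by (intro integral_cong) (auto simp: h_def flat_def field_simps)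
    then show ?thesis by (simp add: H_def)
  qed
  show "H t = H (M - \<epsilon>)" if "0 \<le> M - \<epsilon>" "M - \<epsilon> \<le> t"
  proof -
    have "integral {0..M - \<epsilon>} h + integral {M - \<epsilon>..t} h = integral {0..t} h"
      by (rule Henstock_Kurzweil_Integration.integral_combine[OF that hi])
    moreover have "integral {M - \<epsilon>..t} h = integral {M - \<epsilon>..t} (\<lambda>_. 0)"
      using \<epsilon> by (intro integral_cong) (auto simp: h_def flat_def field_simps)
    ultimately show ?thesis by (simp add: H_def)
  qed
qed

text \<open>As \<epsilon> shrinks, the arguments of \<open>flat 0\<close> at a fixed interior point
  tend to infinity, where \<open>flat 0\<close> tends to 1; dominated convergence carries this over
  to the primitives.\<close>

theorem smooth_truncations:
  fixes M :: real
  assumes M: "0 < M"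
  obtains H h :: "nat \<Rightarrow> real \<Rightarrow> real" and \<epsilon> :: "nat \<Rightarrow> real" where
    "\<And>k t. 0 < t \<Longrightarrow> DERIV (H k) t :> h k t" "\<And>k t. 0 \<le> h k t" "\<And>k t. h k t \<le> 1"
    "\<And>k t. 0 \<le> t \<Longrightarrow> 0 \<le> H k t" "\<And>k t. 0 \<le> t \<Longrightarrow> H k t \<le> t" "\<And>k j. Dk j {0<..} (H k)"
    "\<And>k. 0 < \<epsilon> k" "\<And>k. \<epsilon> k < M - \<epsilon> k" "\<And>k t. t \<le> \<epsilon> k \<Longrightarrow> H k t = 0" "\<And>k t. M - \<epsilon> k \<le> t \<Longrightarrow> H k t = H k M"
    "\<And>t. 0 < t \<Longrightarrow> t < M \<Longrightarrow> (\<lambda>k. h k t) \<longlonglongrightarrow> 1" "\<And>t. 0 < t \<Longrightarrow> t < M \<Longrightarrow> (\<lambda>k. H k t) \<longlonglongrightarrow> t"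
    "\<And>k. h k \<in> borel_measurable borel"
proof -
  define \<epsilon> where "\<epsilon> k = M / real (k + 3)" for k
  define h where "h k t = flat 0 (inverse (\<epsilon> k) * t + - 1) * flat 0 (inverse (\<epsilon> k) * (M + - 1 * t) + - 1)" for k t
  define H where "H k t = integral {0..t} (h k)" for k t
  have \<epsilon>: "0 < \<epsilon> k" "\<epsilon> k < M - \<epsilon> k" for k using M by (auto simp: \<epsilon>_def field_simps add_pos_nonneg)
  note tr = smooth_truncation_exists[OF \<epsilon>(1), where M = M, folded h_def, folded H_def]
  have h_eq: "h k = (\<lambda>t. h k t)" for k by simp
  have inv: "inverse (\<epsilon> k) = real (k + 3) / M" for k by (simp add: \<epsilon>_def)
  have top: "filterlim (\<lambda>k. inverse (\<epsilon> k) * t + - 1) at_top sequentially" if "0 < t" for t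
  proof -
    have "filterlim (\<lambda>k. real (k + 3)) at_top sequentially"
      by (rule filterlim_compose[OF filterlim_real_sequentially]) (rule filterlim_add_const_nat_at_top)
    then have "filterlim (\<lambda>k. (t / M) * real (k + 3)) at_top sequentially"
      using that M by (intro filterlim_tendsto_pos_mult_at_top[OF tendsto_const]) auto
    then have "filterlim (\<lambda>k. - 1 + (t / M) * real (k + 3)) at_top sequentially"
      by (rule filterlim_tendsto_add_at_top[OF tendsto_const])
    then show ?thesis by (simp add: inv mult.commute add.commute)
  qed
  have flat_top: "(flat 0 \<longlongrightarrow> 1) at_top"
  proof -
    have "((\<lambda>x :: real. exp (- inverse x)) \<longlongrightarrow> exp (- 0)) at_top"
      by (intro tendsto_exp tendsto_minus tendsto_inverse_0_at_top filterlim_ident)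
    then have "((\<lambda>x :: real. exp (- inverse x)) \<longlongrightarrow> 1) at_top" by simp
    then show ?thesis
      by (rule Lim_transform_eventually) (use eventually_gt_at_top[of "0::real"] in \<open>auto simp: flat_def elim!: eventually_mono\<close>)
  qed
  have h_lim: "(\<lambda>k. h k t) \<longlonglongrightarrow> 1" if t: "0 < t" "t < M" for t
  proof -
    have "(\<lambda>k. h k t) \<longlonglongrightarrow> 1 * 1"
      unfolding h_def using t
      by (intro tendsto_mult filterlim_compose[OF flat_top] top) auto
    then show ?thesis by simp
  qed
  have H_lim: "(\<lambda>k. H k t) \<longlonglongrightarrow> t" if t: "0 < t" "t < M" for t
  proof -
    \<comment> \<open>The pointwise limit is 1 except at \<open>s = 0\<close>, where every
      \<open>h k\<close> vanishes.\<close>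
    have "(\<lambda>k. integral {0..t} (h k)) \<longlonglongrightarrow> integral {0..t} (\<lambda>s. if s = 0 then 0 else 1)"
    proof (rule dominated_convergence(2)[where h = "\<lambda>_. 1"])
      show "h k integrable_on {0..t}" for k
        using tr(9) by (intro integrable_continuous_real) (auto intro: continuous_on_subset)
      show "norm (h k s) \<le> 1" for k s using tr(2,3) by simp
      show "(\<lambda>k. h k s) \<longlonglongrightarrow> (if s = 0 then 0 else 1)" if "s \<in> {0..t}" for s
      proof (cases "s = 0")
        case True
        then show ?thesis by (simp add: h_def flat_def)
      next
        case False
        then show ?thesis using that t h_lim[of s] by simp
      qed
    qed auto
    also have "integral {0..t} (\<lambda>s. if s = 0 then 0 else 1 :: real) = integral {0..t} (\<lambda>s. 1)"
      by (rule integral_spike[of "{0}"]) auto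
    also have "\<dots> = t" using t by simp
    finally show ?thesis by (simp add: H_def)
  qed
  show thesis
  proof (rule that[of H h \<epsilon>])
    show "H k t = H k M" if "M - \<epsilon> k \<le> t" for k t
    proof -
      have "0 \<le> M - \<epsilon> k" using \<epsilon>[of k] by linarith
      then show ?thesis using tr(8)[of k t] tr(8)[of k M] that \<epsilon>[of k] by simp
    qed
    show "h k \<in> borel_measurable borel" for k
      using tr(9)[of k] by (rule borel_measurable_continuous_onI)
  qed (use tr \<epsilon> h_lim H_lim in auto)
qed

section \<open>Smooth radial functions\<close>

lemma Ck_SucI:
  assumes "\<And>x. (f has_derivative D x) (at x)" "\<And>v. Ck k (\<lambda>x. D x v)"
  shows "Ck (Suc k) f"
proof -
  have "frechet_derivative f (at x) = D x" for x
    using frechet_derivative_at[OF assms(1)] by simp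
  then show ?thesis using assms by (auto simp: differentiable_def)
qed

lemma Ck_SucD:
  assumes "Ck (Suc k) f"
  shows "(f has_derivative frechet_derivative f (at x)) (at x)" "Ck k (\<lambda>x. frechet_derivative f (at x) v)"
  using assms by (auto simp: frechet_derivative_works[symmetric])

lemma Ck_Suc_imp: "Ck (Suc k) f \<Longrightarrow> Ck k f"
proof (induction k arbitrary: f)
  case 0
  then show ?case by (auto intro!: continuous_at_imp_continuous_on differentiable_imp_continuous_within)
next
  case (Suc k)
  then show ?case by (metis Ck.simps(2))
qed

lemma Ck_const: "Ck k (\<lambda>x. c)"
proof (induction k arbitrary: c)
  case (Suc k)
  then show ?case by (intro Ck_SucI[where D = "\<lambda>x v. 0"]) auto
qed auto

lemma Ck_inner: "Ck k (\<lambda>x. x \<bullet> v)"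
proof (cases k)
  case (Suc j)
  show ?thesis unfolding Suc
    by (rule Ck_SucI[where D = "\<lambda>x h. h \<bullet> v"]) (auto intro!: derivative_eq_intros Ck_const)
qed (auto intro!: continuous_intros)

lemma Ck_add: "Ck k f \<Longrightarrow> Ck k g \<Longrightarrow> Ck k (\<lambda>x. f x + g x)"
proof (induction k arbitrary: f g)
  case (Suc k)
  show ?case
    by (rule Ck_SucI, rule has_derivative_add[OF Ck_SucD(1)[OF Suc.prems(1)] Ck_SucD(1)[OF Suc.prems(2)]])
      (intro Suc.IH Ck_SucD(2) Suc.prems)
qed (auto intro: continuous_intros)

lemma Ck_mult: "Ck k f \<Longrightarrow> Ck k g \<Longrightarrow> Ck k (\<lambda>x. f x * g x)"
proof (induction k arbitrary: f g)
  case (Suc k)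
  show ?case
    by (rule Ck_SucI, rule has_derivative_mult[OF Ck_SucD(1)[OF Suc.prems(1)] Ck_SucD(1)[OF Suc.prems(2)]])
      (intro Ck_add Suc.IH Ck_SucD(2) Suc.prems Ck_Suc_imp[OF Suc.prems(1)] Ck_Suc_imp[OF Suc.prems(2)])
qed (auto intro: continuous_intros)

text \<open>The profile is taken in the variable \<open>x \<bullet> x\<close>, which unlike the norm
  is smooth at the origin, so no point needs separate treatment.\<close>

lemma Ck_radial: "Dk k UNIV g \<Longrightarrow> Ck k (\<lambda>x :: real ^ 'n. g (x \<bullet> x))"
proof (induction k arbitrary: g)
  case 0
  then have "continuous_on UNIV g" by simp
  then show ?case by (auto intro!: continuous_on_compose2[of UNIV g] continuous_intros)
next
  case (Suc k)
  then obtain g' where g': "\<And>x. DERIV g x :> g' x" "Dk k UNIV g'" by auto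
  show ?case
  proof (rule Ck_SucI)
    fix x :: "real ^ 'n"
    have "((\<lambda>x. x \<bullet> x) has_derivative (\<lambda>h. 2 * (x \<bullet> h))) (at x)"
      by (auto intro!: derivative_eq_intros simp: inner_commute)
    from has_derivative_compose[OF this g'(1)[unfolded has_field_derivative_def]]
    show "((\<lambda>x. g (x \<bullet> x)) has_derivative (\<lambda>h. g' (x \<bullet> x) * (2 * (x \<bullet> h)))) (at x)" .
  next
    fix v :: "real ^ 'n"
    show "Ck k (\<lambda>x. g' (x \<bullet> x) * (2 * (x \<bullet> v)))"
      by (intro Ck_mult Suc.IH[OF g'(2)] Ck_const Ck_inner)
  qed
qed

lemma smooth_radial: "(\<And>k. Dk k UNIV g) \<Longrightarrow> smooth (\<lambda>x. g (x \<bullet> x))"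
  by (simp add: smooth_def Ck_radial)

subsection \<open>Extremal functions and optimality\<close>

context sobolev_ball
begin

text \<open>\<open>\<zeta>\<close> is the radial profile of the Aubin-Talenti extremal on the whole space, and its pullback
  \<open>\<eta>\<close> is the profile of \<open>U\<^sub>R\<close>; a prime marks derivatives.\<close>

definition "q = p / (p - 1)"
definition "\<zeta> a b s = (a + b * s powr q) powr (1 - n / p)"
definition "\<zeta>' a b s = (1 - n / p) * (a + b * s powr q) powr (- (n / p)) * (b * (q * s powr (q - 1)))"
definition "\<eta> a b r = \<zeta> a b (\<phi> r)"
definition "\<eta>' a b r = \<zeta>' a b (\<phi> r) * (\<phi> r / r) powr (\<alpha> + 1)"

lemma q: "1 < q" "q * (n / p - 1) = \<alpha>" "(n / p - 1) * ps = n" "q / \<alpha> = p / (n - p)" "(q - 1) * p = q"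
proof -
  have 1: "n / p - 1 = (n - p) / p" "q - 1 = 1 / (p - 1)" unfolding q_def using p by (auto simp: field_simps)
  show "1 < q" unfolding q_def using p by (simp add: field_simps)
  show "q * (n / p - 1) = \<alpha>" "(n / p - 1) * ps = n" unfolding 1 q_def \<alpha>_def ps_def using p by auto
  show "q / \<alpha> = p / (n - p)" unfolding q_def \<alpha>_def using p by simp
  show "(q - 1) * p = q" unfolding 1 by (simp add: q_def)
qed

lemma \<phi>_deriv': "0 < r \<Longrightarrow> r < R \<Longrightarrow> DERIV \<phi> r :> (\<phi> r / r) powr (\<alpha> + 1)"
proof -
  assume r: "0 < r" "r < R"
  have "DERIV \<phi> r :> 1 * (\<phi> r / r) powr (\<alpha> + 1)"
    unfolding \<phi>_def by (intro affine_conj_deriv \<alpha>_pos \<phi>_arg r)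
  then show ?thesis by simp
qed

lemma \<zeta>_surj:
  assumes ab: "0 < a" "0 < b" and t: "0 < t" "t < a powr (1 - n / p)"
  shows "\<exists>s>0. \<zeta> a b s = t"
proof -
  define \<gamma> where "\<gamma> = n / p - 1"
  have \<gamma>: "0 < \<gamma>" "1 - n / p = - \<gamma>" using p by (auto simp: \<gamma>_def field_simps)
  define X where "X = t powr (- (1 / \<gamma>))"
  have "(a powr (- \<gamma>)) powr (- (1 / \<gamma>)) < t powr (- (1 / \<gamma>))"
    using t \<gamma> ab by (intro powr_less_mono2_neg) auto
  then have aX: "a < X" using \<gamma> ab by (simp add: X_def powr_powr)
  define s where "s = ((X - a) / b) powr (1 / q)"
  have s: "0 < s" using aX ab by (simp add: s_def)
  have "s powr q = (X - a) / b" unfolding s_def using aX ab q(1) by (simp add: powr_powr)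
  then have "a + b * s powr q = X" using ab by simp
  then have "\<zeta> a b s = X powr (- \<gamma>)" by (simp add: \<zeta>_def \<gamma>)
  also have "\<dots> = t" unfolding X_def using t \<gamma> by (simp add: powr_powr)
  finally show ?thesis using s by blast
qed

lemma \<zeta>_mono:
  assumes ab: "0 < a" "0 < b" and "0 < s" "s \<le> t"
  shows "\<zeta> a b t \<le> \<zeta> a b s"
  unfolding \<zeta>_def using assms p q(1)
  by (intro powr_mono2' add_left_mono mult_left_mono powr_mono2) (auto simp: add_pos_pos)

lemma \<zeta>_bounds:
  assumes ab: "0 < a" "0 < b" and "0 < s"
  shows "0 < \<zeta> a b s" "\<zeta> a b s < a powr (1 - n / p)"
proof -
  have "0 < b * s powr q" using assms by simp
  then show "0 < \<zeta> a b s" "\<zeta> a b s < a powr (1 - n / p)"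
    unfolding \<zeta>_def using ab p by (auto intro!: powr_less_mono2_neg simp: field_simps)
qed

lemma \<zeta>_deriv:
  assumes ab: "0 < a" "0 < b" and s: "0 < s"
  shows "DERIV (\<zeta> a b) s :> \<zeta>' a b s"
proof -
  have pos: "0 < a + b * s powr q" using assms by (simp add: add_pos_pos)
  have d: "DERIV (\<lambda>s. a + b * s powr q) s :> b * (q * s powr (q - 1))"
    using s by (auto intro!: derivative_eq_intros)
  have "DERIV (\<zeta> a b) s :> (1 - n / p) * (a + b * s powr q) powr ((1 - n / p) - of_nat 1) * (b * (q * s powr (q - 1)))"
    unfolding \<zeta>_def by (rule DERIV_fun_powr[OF d pos])
  moreover have "(1 - n / p) - of_nat 1 = - (n / p)" by simp
  ultimately show ?thesis by (simp only: \<zeta>'_def)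
qed

lemma \<eta>_deriv: "0 < a \<Longrightarrow> 0 < b \<Longrightarrow> 0 < r \<Longrightarrow> r < R \<Longrightarrow> DERIV (\<eta> a b) r :> \<eta>' a b r"
  unfolding \<eta>_def[abs_def] \<eta>'_def by (intro DERIV_chain2[OF \<zeta>_deriv \<phi>_deriv'] \<phi>_pos)

lemma \<eta>_bounds:
  "0 < a \<Longrightarrow> 0 < b \<Longrightarrow> 0 < r \<Longrightarrow> r < R \<Longrightarrow> 0 < \<eta> a b r"
  "0 < a \<Longrightarrow> 0 < b \<Longrightarrow> 0 < r \<Longrightarrow> r < R \<Longrightarrow> \<eta> a b r < a powr (1 - n / p)"
  unfolding \<eta>_def by (auto intro!: \<zeta>_bounds \<phi>_pos)

lemma \<zeta>_powr_ps:
  "0 < a \<Longrightarrow> 0 < b \<Longrightarrow> 0 < s \<Longrightarrow> \<bar>\<zeta> a b s\<bar> powr ps = (a + b * s powr q) powr (- n)"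
proof -
  have "(1 - n / p) * ps = - n" using q(3) by (simp add: algebra_simps)
  then show ?thesis by (simp add: \<zeta>_def powr_powr)
qed

text \<open>The p-th power turns the exponent \<open>- (n / p)\<close> into \<open>- n\<close> and,
  by \<open>(q - 1) * p = q\<close>, the factor of \<open>s\<close> into that of the
  \<open>q\<close>-th moment of the extremal density.\<close>

lemma \<zeta>'_powr_p:
  assumes ab: "0 < a" "0 < b" and s: "0 < s"
  shows "\<bar>\<zeta>' a b s\<bar> powr p = (b * \<alpha>) powr p * (s powr q * (a + b * s powr q) powr (- n))"
proof -
  have np: "0 < n / p - 1" using p by simp
  have "\<bar>\<zeta>' a b s\<bar> = (b * \<alpha>) * ((a + b * s powr q) powr (- (n / p)) * s powr (q - 1))"
  proof -
    have "1 - n / p = - (n / p - 1)" by simp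
    then have "\<zeta>' a b s = - ((q * (n / p - 1)) * b * ((a + b * s powr q) powr (- (n / p)) * s powr (q - 1)))"
      unfolding \<zeta>'_def by (simp only: mult_minus_left mult_minus_right mult_ac)
    then have "\<bar>\<zeta>' a b s\<bar> = \<bar>\<alpha> * b * ((a + b * s powr q) powr (- (n / p)) * s powr (q - 1))\<bar>"
      unfolding q(2) by (simp only: abs_minus_cancel)
    also have "\<dots> = \<alpha> * b * ((a + b * s powr q) powr (- (n / p)) * s powr (q - 1))"
      using \<alpha>_pos ab by (intro abs_of_nonneg mult_nonneg_nonneg) auto
    finally show ?thesis by (simp add: mult_ac)
  qed
  then have "\<bar>\<zeta>' a b s\<bar> powr p = (b * \<alpha>) powr p * ((a + b * s powr q) powr (- (n / p) * p) * s powr ((q - 1) * p))"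
    using ab \<alpha>_pos by (simp only: powr_mult powr_powr powr_ge_zero mult_nonneg_nonneg less_imp_le)
  also have "- (n / p) * p = - n" using p by simp
  finally show ?thesis using q(5) by (simp add: mult.commute)
qed

lemma borel_measurable_\<eta> [measurable]:
  "\<eta> a b \<in> borel_measurable borel" "\<eta>' a b \<in> borel_measurable borel"
  unfolding \<eta>_def[abs_def] \<eta>'_def[abs_def] \<zeta>_def \<zeta>'_def \<phi>_def by measurable

context
  assumes dim: "n = real CARD('n::finite)"
begin

lemma U_fun_eq:
  assumes "0 < norm (x :: real ^ 'n)" "norm x < R"
  shows "U_fun p R a b x = \<eta> a b (norm x)"
proof -
  have "\<phi> (norm x) powr q = (norm x powr (- \<alpha>) - R powr (- \<alpha>)) powr (- (p / (n - p)))"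
  proof -
    have "- (1 / \<alpha>) * q = - (p / (n - p))" using q(4) by simp
    then show ?thesis unfolding \<phi>_def affine_conj_def powr_powr by simp
  qed
  then show ?thesis
    using assms by (simp add: U_fun_def Let_def dim[symmetric] \<alpha>_def[symmetric] \<eta>_def \<zeta>_def powr_minus_divide)
qed

text \<open>For a radial function the tangential gradient vanishes, and with it the weight in
  \<open>Lp\<close>.\<close>

lemma Lp_radial:
  fixes f :: "real ^ 'n \<Rightarrow> real"
  assumes x: "0 < norm x" "norm x < R" and d: "DERIV H (norm x) :> d"
    and f: "\<And>y. 0 < norm y \<Longrightarrow> norm y < R \<Longrightarrow> f y = H (norm y)"
  shows "Lp p R f x = d *\<^sub>R sgn x"
proof -
  have x0: "x \<noteq> 0" using x by auto
  have nm: "(norm has_derivative (\<lambda>k. sgn x \<bullet> k)) (at x)"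
    using has_derivative_norm[OF x0] by (simp add: inner_commute)
  have "((\<lambda>y. H (norm y)) has_derivative (\<lambda>k. d * (sgn x \<bullet> k))) (at x)"
    by (rule has_derivative_compose[OF nm d[unfolded has_field_derivative_def]])
  then have "((\<lambda>y. H (norm y)) has_derivative (\<lambda>k. (d *\<^sub>R sgn x) \<bullet> k)) (at x)" by simp
  moreover have "open (ball 0 R - {0 :: real ^ 'n})" by (intro open_Diff) auto
  ultimately have "(f has_derivative (\<lambda>k. (d *\<^sub>R sgn x) \<bullet> k)) (at x)"
    by (rule has_derivative_transform_within_open) (use x f in auto)
  then have "grad f x = d *\<^sub>R sgn x" by (rule grad_eqI)
  then show ?thesis using inner_sgn_self[OF x0] by (simp add: Lp_eq[OF dim x(1)])
qed

lemma norm_Lp_radial: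
  fixes f :: "real ^ 'n \<Rightarrow> real"
  assumes "0 < norm x" "norm x < R" "DERIV H (norm x) :> d"
    and "\<And>y. 0 < norm y \<Longrightarrow> norm y < R \<Longrightarrow> f y = H (norm y)"
  shows "norm (Lp p R f x) = \<bar>d\<bar>"
proof -
  have "x \<noteq> 0" using assms(1) by auto
  then show ?thesis using Lp_radial[OF assms] by (simp add: norm_sgn)
qed

context
  fixes a b :: real
  assumes ab: "0 < a" "0 < b"
begin

definition lhs_profile :: "real ^ 'n \<Rightarrow> real" where
  "lhs_profile x = \<bar>\<eta> a b (norm x)\<bar> powr ps * w (norm x) powr (- e)"

definition rhs_profile :: "real ^ 'n \<Rightarrow> real" where
  "rhs_profile x = \<bar>\<eta>' a b (norm x)\<bar> powr p"

lemma borel_measurable_profile [measurable]: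
  "lhs_profile \<in> borel_measurable borel" "rhs_profile \<in> borel_measurable borel"
  unfolding lhs_profile_def[abs_def] rhs_profile_def[abs_def] by measurable

text \<open>The mass \<open>A\<close> is at the same time the integral of the \<open>ps\<close>-th
  power of the Aubin-Talenti function, and \<open>C\<close> determines that of the p-th power of its
  gradient. The dimension enters through the type of \<open>y\<close>, hence the argument
  \<open>TYPE('n)\<close> outside this context.\<close>

definition "A = (LINT y | lborel. (a + b * norm (y :: real ^ 'n) powr q) powr (- n))"
definition "C = (LINT y | lborel. norm y powr q * (a + b * norm (y :: real ^ 'n) powr q) powr (- n))"

lemma talenti:
  "integrable lborel (\<lambda>y :: real ^ 'n. (a + b * norm y powr q) powr (- n))"
  "integrable lborel (\<lambda>y :: real ^ 'n. norm y powr q * (a + b * norm y powr q) powr (- n))"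
  "0 < A" "0 \<le> C" "b * \<alpha> * C powr (1 / p) = sobolev_const n p * A powr (1 / ps)"
proof -
  have nD: "real DIM(real ^ 'n) = n" by (simp add: dim)
  have "1 / p - 1 / n = 1 / ps" unfolding ps_def using p n by (simp add: field_simps)
  note tal = talenti_integrals[where 'a = "real ^ 'n" and p = p and a = a and b = b, unfolded nD, OF p ab,
      folded q_def \<alpha>_def, unfolded this, folded A_def C_def]
  show "integrable lborel (\<lambda>y :: real ^ 'n. (a + b * norm y powr q) powr (- n))"
    "integrable lborel (\<lambda>y :: real ^ 'n. norm y powr q * (a + b * norm y powr q) powr (- n))"
    "0 < A" "b * \<alpha> * C powr (1 / p) = sobolev_const n p * A powr (1 / ps)"
    using tal by blast+
  show "0 \<le> C" unfolding C_def by (intro integral_nonneg_AE) auto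
qed

lemma ball_int_lhs_profile: "ball_int lhs_profile = ennreal A"
proof -
  let ?F = "\<lambda>y :: real ^ 'n. (a + b * norm y powr q) powr (- n)"
  have "ennreal A = (\<integral>\<^sup>+y. ennreal (?F y) \<partial>lborel)"
    unfolding A_def by (rule nn_integral_eq_integral[symmetric]) (use talenti in auto)
  also have "\<dots> = ball_int (\<lambda>x. ?F (radial_map \<phi> x) * (\<phi> (norm x) / norm x) powr (n + \<alpha>))"
    by (rule nn_integral_\<phi>[OF dim]) auto
  also have "\<dots> = ball_int lhs_profile"
  proof (rule ball_int_cong)
    fix x :: "real ^ 'n" assume x: "0 < norm x" "norm x < R"
    have "- \<alpha> * - e = n + \<alpha>" using \<alpha>_e by simp
    then have "w (norm x) powr (- e) = (\<phi> (norm x) / norm x) powr (n + \<alpha>)"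
      unfolding w_\<phi>[OF x] powr_powr by (simp only:)
    moreover have "norm (radial_map \<phi> x) = \<phi> (norm x)"
      using x \<phi>_pos[OF x] by (auto simp: norm_radial_map)
    ultimately show "?F (radial_map \<phi> x) * (\<phi> (norm x) / norm x) powr (n + \<alpha>) = lhs_profile x"
      unfolding lhs_profile_def \<eta>_def using \<zeta>_powr_ps[OF ab \<phi>_pos[OF x]] by simp
  qed
  finally show ?thesis by simp
qed

lemma ball_int_rhs_profile: "ball_int rhs_profile = ennreal ((b * \<alpha>) powr p * C)"
proof -
  let ?F = "\<lambda>y :: real ^ 'n. (b * \<alpha>) powr p * (norm y powr q * (a + b * norm y powr q) powr (- n))"
  have "ennreal ((b * \<alpha>) powr p * C) = (\<integral>\<^sup>+y. ennreal (?F y) \<partial>lborel)"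
    unfolding C_def integral_mult_right_zero[symmetric]
    by (rule nn_integral_eq_integral[symmetric]) (use talenti in auto)
  also have "\<dots> = ball_int (\<lambda>x. ?F (radial_map \<phi> x) * (\<phi> (norm x) / norm x) powr (n + \<alpha>))"
    by (rule nn_integral_\<phi>[OF dim]) auto
  also have "\<dots> = ball_int rhs_profile"
  proof (rule ball_int_cong)
    fix x :: "real ^ 'n" assume x: "0 < norm x" "norm x < R"
    have N: "norm (radial_map \<phi> x) = \<phi> (norm x)"
      using x \<phi>_pos[OF x] by (auto simp: norm_radial_map)
    have "rhs_profile x = \<bar>\<zeta>' a b (\<phi> (norm x))\<bar> powr p * ((\<phi> (norm x) / norm x) powr (\<alpha> + 1)) powr p"
      by (simp add: rhs_profile_def \<eta>'_def abs_mult powr_mult)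
    also have "\<dots> = ?F (radial_map \<phi> x) * (\<phi> (norm x) / norm x) powr (n + \<alpha>)"
      unfolding N \<zeta>'_powr_p[OF ab \<phi>_pos[OF x]] powr_powr \<alpha>_p by simp
    finally show "?F (radial_map \<phi> x) * (\<phi> (norm x) / norm x) powr (n + \<alpha>) = rhs_profile x" by simp
  qed
  finally show ?thesis by simp
qed

text \<open>Integrability is established along with the values: an integral that does not exist is 0
  by convention, so equality of the norms alone would not exclude a degenerate reading.\<close>

theorem extremal_function:
  defines "U \<equiv> U_fun p R a b :: real ^ 'n \<Rightarrow> real"
  shows "set_integrable lebesgue (ball 0 R) (lhs_integrand p ps R U)"
    and "set_integrable lebesgue (ball 0 R) (rhs_integrand p R U)"
    and "lhs_norm p ps R U = (\<alpha> powr e * A) powr (1 / ps)"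
    and "rhs_norm p R U = b * \<alpha> * C powr (1 / p)"
proof -
  have l: "\<bar>U x\<bar> powr ps * w (norm x) powr (- e) = lhs_profile x" if "0 < norm x" "norm x < R" for x
    by (simp add: U_def U_fun_eq[OF that] lhs_profile_def)
  have r: "norm (Lp p R U x) powr p = rhs_profile x" if "0 < norm x" "norm x < R" for x
    using norm_Lp_radial[OF that \<eta>_deriv[OF ab that], of U] by (simp add: U_def U_fun_eq rhs_profile_def)
  note L = lhs_norm_eq[OF dim _ l] and Rr = rhs_norm_eq[OF dim _ r]
  show "set_integrable lebesgue (ball 0 R) (lhs_integrand p ps R U)"
    by (rule L(2)) (auto simp: ball_int_lhs_profile)
  show "set_integrable lebesgue (ball 0 R) (rhs_integrand p R U)"
    by (rule Rr(2)) (auto simp: ball_int_rhs_profile)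
  show "lhs_norm p ps R U = (\<alpha> powr e * A) powr (1 / ps)"
    using L(1) talenti by (simp add: ball_int_lhs_profile)
  have "rhs_norm p R U = ((b * \<alpha>) powr p * C) powr (1 / p)"
    using Rr(1) talenti by (simp add: ball_int_rhs_profile)
  then show "rhs_norm p R U = b * \<alpha> * C powr (1 / p)"
    using talenti(4) p ab \<alpha>_pos by (simp add: powr_mult powr_powr)
qed

theorem extremal_equality:
  "sobolev_const n p * \<alpha> powr (- ((n - 1) / n)) * lhs_norm p ps R (U_fun p R a b :: real ^ 'n \<Rightarrow> real)
    = rhs_norm p R (U_fun p R a b :: real ^ 'n \<Rightarrow> real)"
  using sobolev_const_factor[of A "sobolev_const n p"] talenti by (simp add: extremal_function)

text \<open>\<open>M\<close> is the limit of the extremal function at the origin, and the function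
  decreases to 0 at the boundary. The truncation is thus constant where the function exceeds
  \<open>M - \<epsilon>\<close>, near the origin, and zero where it is below \<epsilon>, near the
  boundary; in between it is a composition of smooth functions.\<close>

lemma truncated_extremal_is_test_function:
  fixes H h :: "real \<Rightarrow> real"
  defines "M \<equiv> a powr (1 - n / p)"
  assumes H: "\<And>j. Dk j {0<..} H" and \<epsilon>: "0 < \<epsilon>" "\<epsilon> < M - \<epsilon>"
    and low: "\<And>t. t \<le> \<epsilon> \<Longrightarrow> H t = 0" and high: "\<And>t. M - \<epsilon> \<le> t \<Longrightarrow> H t = H M"
  obtains u :: "real ^ 'n \<Rightarrow> real" where "u \<in> test_functions R"
    "\<And>x. 0 < norm x \<Longrightarrow> norm x < R \<Longrightarrow> u x = H (\<eta> a b (norm x))"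
proof -
  \<comment> \<open>Here \<tau> stands for the square of the norm. Negative \<tau> are included
    because \<open>smooth_radial\<close> asks for smoothness on the whole line.\<close>
  define g where "g \<tau> = (if \<tau> \<le> 0 then H M else if \<tau> < R\<^sup>2 then H (\<eta> a b (\<tau> powr (1 / 2))) else 0)" for \<tau>
  define u where "u x = g (x \<bullet> x)" for x :: "real ^ 'n"
  have M: "M - \<epsilon> < M" "0 < M - \<epsilon>" "\<epsilon> < M" using \<epsilon> by auto
  have \<eta>_anti: "\<eta> a b r \<le> \<eta> a b r'" if "0 < r'" "r' \<le> r" "r < R" for r r'
  proof -
    have r': "r' < R" using that by simp
    have "mono_on {0<..<R} \<phi>" using diffeo_\<phi> by (simp add: increasing_diffeo_def)
    then have "\<phi> r' \<le> \<phi> r" using that by (auto simp: mono_on_def)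
    then show ?thesis unfolding \<eta>_def by (rule \<zeta>_mono[OF ab \<phi>_pos[OF that(1) r']])
  qed
  have \<eta>_value: "\<exists>r. 0 < r \<and> r < R \<and> \<eta> a b r = t" if t: "0 < t" "t < M" for t
  proof -
    obtain s where s: "0 < s" "\<zeta> a b s = t" using \<zeta>_surj[OF ab] t by (auto simp: M_def)
    have "\<phi> ` {0<..<R} = {0<..}" using diffeo_\<phi> by (simp add: increasing_diffeo_def)
    then obtain r where "r \<in> {0<..<R}" "\<phi> r = s" using s(1) by (metis greaterThan_iff imageE)
    then show ?thesis using s by (auto simp: \<eta>_def)
  qed
  obtain r1 where r1: "0 < r1" "r1 < R" "\<eta> a b r1 = M - \<epsilon>" using \<eta>_value[of "M - \<epsilon>"] M by auto
  obtain r2 where r2: "0 < r2" "r2 < R" "\<eta> a b r2 = \<epsilon>" using \<eta>_value[of \<epsilon>] M \<epsilon> by auto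
  have sq: "0 < \<tau> powr (1 / 2)" "\<tau> powr (1 / 2) < R" if "0 < \<tau>" "\<tau> < R\<^sup>2" for \<tau>
    using that R by (auto simp: powr_half_sqrt real_less_lsqrt)
  have g_mid: "g \<tau> = H (\<eta> a b (\<tau> powr (1 / 2)))" if "0 < \<tau>" "\<tau> < R\<^sup>2" for \<tau>
    using that by (simp add: g_def)
  have g_low: "g \<tau> = H M" if "\<tau> < r1\<^sup>2" for \<tau>
  proof (cases "\<tau> \<le> 0")
    case False
    have "r1\<^sup>2 < R\<^sup>2" using r1 by (intro power_strict_mono) auto
    then have t: "0 < \<tau>" "\<tau> < R\<^sup>2" using False that by auto
    have "\<tau> powr (1 / 2) \<le> r1"
      using t that r1 by (simp add: powr_half_sqrt real_le_lsqrt)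
    then have "M - \<epsilon> \<le> \<eta> a b (\<tau> powr (1 / 2))"
      using \<eta>_anti[of "\<tau> powr (1 / 2)" r1] sq[OF t] r1 by simp
    then show ?thesis using g_mid[OF t] high by simp
  qed (simp add: g_def)
  have g_high: "g \<tau> = 0" if "r2\<^sup>2 < \<tau>" for \<tau>
  proof (cases "\<tau> < R\<^sup>2")
    case True
    have "0 \<le> r2\<^sup>2" by simp
    then have t: "0 < \<tau>" using that by linarith
    have "r2 \<le> \<tau> powr (1 / 2)"
      using t that r2 by (simp add: powr_half_sqrt real_le_rsqrt)
    then have "\<eta> a b (\<tau> powr (1 / 2)) \<le> \<epsilon>"
      using \<eta>_anti[of r2 "\<tau> powr (1 / 2)"] sq[OF t True] r2 by simp
    then show ?thesis using g_mid[OF t True] low by simp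
  next
    case False
    have "0 < R\<^sup>2" using R by simp
    then have "0 < \<tau>" using False by linarith
    then show ?thesis using False by (simp add: g_def)
  qed
  have Dg: "Dk k UNIV g" for k
  proof -
    \<comment> \<open>Three open sets that overlap and cover the line, so smoothness is a matter of
      each piece.\<close>
    let ?S1 = "{..<r1\<^sup>2}" and ?S2 = "{0<..<R\<^sup>2}" and ?S3 = "{r2\<^sup>2<..}"
    have 1: "Dk k ?S1 g" by (rule Dk_cong[OF _ Dk_const[where c = "H M"]]) (auto simp: g_low)
    have 3: "Dk k ?S3 g" by (rule Dk_cong[OF _ Dk_const[where c = 0]]) (auto simp: g_high)
    let ?d = "\<lambda>\<tau>. (\<tau> powr (1 / 2)) powr (- \<alpha>) + - (R powr (- \<alpha>))"
    have arg: "0 < ?d \<tau>" if "\<tau> \<in> ?S2" for \<tau>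
      using powr_less[of "\<tau> powr (1 / 2)"] sq[of \<tau>] that by auto
    have "Dk k ?S2 ?d"
      by (intro Dk_add Dk_const Dk_compose[OF Dk_powr[where c = "- \<alpha>"]] Dk_subset[OF Dk_powr]) auto
    then have "Dk k ?S2 (\<lambda>\<tau>. \<phi> (\<tau> powr (1 / 2)))"
      unfolding \<phi>_def affine_conj_def mult_1 using arg by (intro Dk_compose[OF Dk_powr]) auto
    moreover have \<phi>S: "0 < \<phi> (\<tau> powr (1 / 2))" if "\<tau> \<in> ?S2" for \<tau>
      using sq[of \<tau>] that by (intro \<phi>_pos) auto
    ultimately have "Dk k ?S2 (\<lambda>\<tau>. a + b * \<phi> (\<tau> powr (1 / 2)) powr q)"
      by (intro Dk_add Dk_mult Dk_const Dk_compose[OF Dk_powr[where c = q]]) auto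
    moreover have "0 < a + b * \<phi> (\<tau> powr (1 / 2)) powr q" for \<tau>
      using ab by (intro add_pos_nonneg) auto
    ultimately have "Dk k ?S2 (\<lambda>\<tau>. \<eta> a b (\<tau> powr (1 / 2)))"
      unfolding \<eta>_def \<zeta>_def by (intro Dk_compose[OF Dk_powr]) auto
    then have "Dk k ?S2 (\<lambda>\<tau>. H (\<eta> a b (\<tau> powr (1 / 2))))"
      using sq \<eta>_bounds(1)[OF ab] by (intro Dk_compose[OF H]) auto
    then have 2: "Dk k ?S2 g" by (rule Dk_cong[rotated]) (auto simp: g_mid)
    have "Dk k (?S1 \<union> ?S2 \<union> ?S3) g" by (intro Dk_Un 1 2 3) auto
    moreover have "?S1 \<union> ?S2 \<union> ?S3 = UNIV"
    proof -
      have "0 < r1\<^sup>2" "r2\<^sup>2 < R\<^sup>2" using r1 r2 by (auto intro: power_strict_mono)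
      then have "\<tau> < r1\<^sup>2 \<or> (0 < \<tau> \<and> \<tau> < R\<^sup>2) \<or> r2\<^sup>2 < \<tau>" for \<tau> by linarith
      then have "\<tau> \<in> ?S1 \<union> ?S2 \<union> ?S3" for \<tau> by (simp add: disj_assoc)
      then show ?thesis by blast
    qed
    ultimately show ?thesis by simp
  qed
  have supp: "{x. u x \<noteq> 0} \<subseteq> cball 0 r2"
  proof
    fix x assume "x \<in> {x. u x \<noteq> 0}"
    then have "\<not> r2\<^sup>2 < x \<bullet> x" using g_high by (auto simp: u_def)
    then have "(norm x)\<^sup>2 \<le> r2\<^sup>2" by (simp add: power2_norm_eq_inner)
    then show "x \<in> cball 0 r2" using r2 by (simp add: power2_le_iff_abs_le abs_le_square_iff[symmetric])
  qed
  then have cl: "closure {x. u x \<noteq> 0} \<subseteq> cball 0 r2" by (rule closure_minimal) simp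
  have "compact (closure {x. u x \<noteq> 0})"
    using bounded_subset[OF bounded_cball cl] by (simp add: compact_eq_bounded_closed)
  moreover have "closure {x. u x \<noteq> 0} \<subseteq> ball 0 R" using cl r2 by auto
  moreover have "smooth u" unfolding u_def by (rule smooth_radial[OF Dg])
  ultimately have "u \<in> test_functions R" by (simp add: test_functions_def)
  moreover have "u x = H (\<eta> a b (norm x))" if "0 < norm x" "norm x < R" for x
  proof -
    have xx: "x \<bullet> x = (norm x)\<^sup>2" by (simp add: power2_norm_eq_inner)
    have "0 < x \<bullet> x" "x \<bullet> x < R\<^sup>2" unfolding xx using that by (auto intro: power_strict_mono)
    then show ?thesis using that by (simp add: u_def g_mid) (simp add: xx powr_half_sqrt)
  qed
  ultimately show thesis by (rule that)
qed

end

end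

end

context sobolev_ball
begin

context
  assumes dim: "n = real CARD('n::finite)"
begin

text \<open>Since \<open>0 \<le> H k t \<le> t\<close> and the derivatives of the truncations lie
  between 0 and 1, the integrands of the extremal function itself dominate, and both norms converge.
  In the limit \<open>c\<close> is tested on the extremal function, whose left-hand norm is
  positive.\<close>

theorem constant_optimal:
  fixes c :: real
  assumes c: "\<And>u :: real ^ 'n \<Rightarrow> real. u \<in> test_functions R \<Longrightarrow> c * lhs_norm p ps R u \<le> rhs_norm p R u"
  shows "c \<le> sobolev_const n p * \<alpha> powr (- ((n - 1) / n))"
proof -
  have ab: "0 < (1::real)" "0 < (1::real)" by auto
  let ?\<eta> = "\<eta> 1 1" and ?\<eta>' = "\<eta>' 1 1"
  let ?L = "lhs_profile 1 1 :: real ^ 'n \<Rightarrow> real" and ?P = "rhs_profile 1 1 :: real ^ 'n \<Rightarrow> real"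
  note [measurable] = borel_measurable_profile[OF dim ab]
  show ?thesis
  \<comment> \<open>The level \<open>M = 1\<close> is the value \<open>a powr (1 - n / p)\<close>
    for \<open>a = 1\<close>.\<close>
  proof (rule smooth_truncations[OF zero_less_one])
    fix H h :: "nat \<Rightarrow> real \<Rightarrow> real" and \<epsilon> :: "nat \<Rightarrow> real"
    assume H: "\<And>k t. 0 < t \<Longrightarrow> DERIV (H k) t :> h k t" "\<And>k t. 0 \<le> h k t" "\<And>k t. h k t \<le> 1"
      "\<And>k t. 0 \<le> t \<Longrightarrow> 0 \<le> H k t" "\<And>k t. 0 \<le> t \<Longrightarrow> H k t \<le> t" "\<And>k j. Dk j {0<..} (H k)"
      and \<epsilon>: "\<And>k. 0 < \<epsilon> k" "\<And>k. \<epsilon> k < 1 - \<epsilon> k" "\<And>k t. t \<le> \<epsilon> k \<Longrightarrow> H k t = 0" "\<And>k t. 1 - \<epsilon> k \<le> t \<Longrightarrow> H k t = H k 1"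
      and lim: "\<And>t. 0 < t \<Longrightarrow> t < 1 \<Longrightarrow> (\<lambda>k. h k t) \<longlonglongrightarrow> 1" "\<And>t. 0 < t \<Longrightarrow> t < 1 \<Longrightarrow> (\<lambda>k. H k t) \<longlonglongrightarrow> t"
      and hm: "\<And>k. h k \<in> borel_measurable borel"
    have [measurable]: "h k \<in> borel_measurable borel" for k by (rule hm)
    have \<eta>b: "0 < ?\<eta> r" "?\<eta> r < 1" if "0 < r" "r < R" for r
      using \<eta>_bounds[OF ab that] by auto
    have "\<exists>u. u \<in> test_functions R \<and> (\<forall>x :: real ^ 'n. 0 < norm x \<longrightarrow> norm x < R \<longrightarrow> u x = H k (?\<eta> (norm x)))" for k
      by (rule truncated_extremal_is_test_function[OF dim ab H(6) \<epsilon>(1), of k k])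
        (use \<epsilon>(2)[of k] in \<open>auto intro: \<epsilon>(3) \<epsilon>(4)\<close>)
    then obtain u :: "nat \<Rightarrow> real ^ 'n \<Rightarrow> real" where u: "\<And>k. u k \<in> test_functions R"
      "\<And>k x. 0 < norm x \<Longrightarrow> norm x < R \<Longrightarrow> u k x = H k (?\<eta> (norm x))" by metis
    have um [measurable]: "u k \<in> borel_measurable borel" for k
      by (intro borel_measurable_continuous_onI continuous_at_imp_continuous_on ballI
          has_derivative_continuous[OF test_functions_has_derivative[OF u(1) R]])
    define Lk where "Lk k x = \<bar>u k x\<bar> powr ps * w (norm x) powr (- e)" for k x
    define Pk where "Pk k x = \<bar>h k (?\<eta> (norm x)) * ?\<eta>' (norm x)\<bar> powr p" for k and x :: "real ^ 'n"
    have [measurable]: "Lk k \<in> borel_measurable borel" "Pk k \<in> borel_measurable borel" for k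
      unfolding Lk_def[abs_def] Pk_def[abs_def] by measurable
    have "(\<lambda>k. ball_int (Lk k)) \<longlonglongrightarrow> ball_int ?L"
      unfolding ball_int_def
    proof (rule nn_integral_dominated_convergence[where w = "\<lambda>x. ennreal (?L x) * indicator {0<..<R} (norm x)"])
      show "AE x in lborel. ennreal (Lk k x) * indicator {0<..<R} (norm x) \<le> ennreal (?L x) * indicator {0<..<R} (norm x)" for k
      proof (intro AE_I2)
        fix x :: "real ^ 'n"
        have "Lk k x \<le> ?L x" if x: "0 < norm x" "norm x < R"
          unfolding Lk_def lhs_profile_def[OF dim ab] u(2)[OF x] using \<eta>b[OF x] H(4,5) ps_pos
          by (intro mult_right_mono powr_mono2) auto
        then show "ennreal (Lk k x) * indicator {0<..<R} (norm x) \<le> ennreal (?L x) * indicator {0<..<R} (norm x)"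
          by (auto simp: indicator_def intro: ennreal_leI)
      qed
      show "(\<integral>\<^sup>+x. ennreal (?L x) * indicator {0<..<R} (norm x) \<partial>lborel) < \<infinity>"
        using ball_int_lhs_profile[OF dim ab] unfolding ball_int_def by simp
      show "AE x in lborel. (\<lambda>k. ennreal (Lk k x) * indicator {0<..<R} (norm x)) \<longlonglongrightarrow> ennreal (?L x) * indicator {0<..<R} (norm x)"
      proof (intro AE_I2)
        fix x :: "real ^ 'n"
        have "(\<lambda>k. Lk k x) \<longlonglongrightarrow> ?L x" if x: "0 < norm x" "norm x < R"
          unfolding Lk_def lhs_profile_def[OF dim ab] u(2)[OF x] using \<eta>b[OF x] ps_pos
          by (intro tendsto_mult tendsto_const tendsto_powr' tendsto_rabs lim) auto
        then show "(\<lambda>k. ennreal (Lk k x) * indicator {0<..<R} (norm x)) \<longlonglongrightarrow> ennreal (?L x) * indicator {0<..<R} (norm x)"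
          by (auto simp: indicator_def)
      qed
    qed measurable
    then have "(\<lambda>k. enn2real (ball_int (Lk k))) \<longlonglongrightarrow> enn2real (ball_int ?L)"
      by (intro tendsto_enn2real) (simp_all add: ball_int_lhs_profile[OF dim ab])
    moreover have "enn2real (ball_int ?L) = A TYPE('n) 1 1"
      using talenti(3)[OF dim ab] by (simp add: ball_int_lhs_profile[OF dim ab])
    ultimately have limL: "(\<lambda>k. enn2real (ball_int (Lk k))) \<longlonglongrightarrow> A TYPE('n) 1 1" by simp
    have "(\<lambda>k. ball_int (Pk k)) \<longlonglongrightarrow> ball_int ?P"
      unfolding ball_int_def
    proof (rule nn_integral_dominated_convergence[where w = "\<lambda>x. ennreal (?P x) * indicator {0<..<R} (norm x)"])
      show "AE x in lborel. ennreal (Pk k x) * indicator {0<..<R} (norm x) \<le> ennreal (?P x) * indicator {0<..<R} (norm x)" for k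
      proof (intro AE_I2 mult_right_mono ennreal_leI)
        fix x :: "real ^ 'n"
        have "\<bar>h k (?\<eta> (norm x)) * ?\<eta>' (norm x)\<bar> \<le> 1 * \<bar>?\<eta>' (norm x)\<bar>"
          unfolding abs_mult using H(2,3) by (intro mult_right_mono) auto
        then show "Pk k x \<le> ?P x"
          unfolding Pk_def rhs_profile_def[OF dim ab] using p by (intro powr_mono2) auto
      qed auto
      show "(\<integral>\<^sup>+x. ennreal (?P x) * indicator {0<..<R} (norm x) \<partial>lborel) < \<infinity>"
        using ball_int_rhs_profile[OF dim ab] unfolding ball_int_def by simp
      show "AE x in lborel. (\<lambda>k. ennreal (Pk k x) * indicator {0<..<R} (norm x)) \<longlonglongrightarrow> ennreal (?P x) * indicator {0<..<R} (norm x)"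
      proof (intro AE_I2)
        fix x :: "real ^ 'n"
        have "(\<lambda>k. Pk k x) \<longlonglongrightarrow> ?P x" if x: "0 < norm x" "norm x < R"
        proof -
          have "(\<lambda>k. Pk k x) \<longlonglongrightarrow> \<bar>1 * ?\<eta>' (norm x)\<bar> powr p"
            unfolding Pk_def using \<eta>b[OF x] p
            by (intro tendsto_mult tendsto_const tendsto_powr' tendsto_rabs lim) auto
          then show ?thesis by (simp add: rhs_profile_def[OF dim ab])
        qed
        then show "(\<lambda>k. ennreal (Pk k x) * indicator {0<..<R} (norm x)) \<longlonglongrightarrow> ennreal (?P x) * indicator {0<..<R} (norm x)"
          by (auto simp: indicator_def)
      qed
    qed measurable
    then have "(\<lambda>k. enn2real (ball_int (Pk k))) \<longlonglongrightarrow> enn2real (ball_int ?P)"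
      by (intro tendsto_enn2real) (simp_all add: ball_int_rhs_profile[OF dim ab])
    moreover have "0 \<le> enn2real (ball_int ?P)" by simp
    ultimately have limP: "(\<lambda>k. enn2real (ball_int (Pk k)) powr (1 / p)) \<longlonglongrightarrow> enn2real (ball_int ?P) powr (1 / p)"
      using p by (intro tendsto_powr' tendsto_const) auto
    let ?U = "U_fun p R 1 1 :: real ^ 'n \<Rightarrow> real"
    have lU: "lhs_norm p ps R ?U = (\<alpha> powr e * A TYPE('n) 1 1) powr (1 / ps)"
      by (rule extremal_function[OF dim ab])
    have rU: "rhs_norm p R ?U = enn2real (ball_int ?P) powr (1 / p)"
    proof (rule rhs_norm_eq(1)[OF dim])
      fix x :: "real ^ 'n" assume x: "0 < norm x" "norm x < R"
      show "norm (Lp p R ?U x) powr p = ?P x"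
        using norm_Lp_radial[OF dim x \<eta>_deriv[OF ab x], of ?U] U_fun_eq[OF dim]
        by (simp add: rhs_profile_def[OF dim ab])
    qed measurable
    have limL': "(\<lambda>k. lhs_norm p ps R (u k)) \<longlonglongrightarrow> lhs_norm p ps R ?U"
    proof -
      have "lhs_norm p ps R (u k) = (\<alpha> powr e * enn2real (ball_int (Lk k))) powr (1 / ps)" for k
        by (rule lhs_norm_eq(1)[OF dim]) (auto simp: Lk_def)
      moreover have "\<alpha> powr e * A TYPE('n) 1 1 \<noteq> 0" using talenti(3)[OF dim ab] \<alpha>_pos by simp
      ultimately show ?thesis
        unfolding lU by (simp only:) (intro tendsto_powr tendsto_mult tendsto_const limL)
    qed
    have limP': "(\<lambda>k. rhs_norm p R (u k)) \<longlonglongrightarrow> rhs_norm p R ?U"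
    proof -
      have "rhs_norm p R (u k) = enn2real (ball_int (Pk k)) powr (1 / p)" for k
      proof (rule rhs_norm_eq(1)[OF dim])
        fix x :: "real ^ 'n" assume x: "0 < norm x" "norm x < R"
        have "DERIV (\<lambda>r. H k (?\<eta> r)) (norm x) :> h k (?\<eta> (norm x)) * ?\<eta>' (norm x)"
          by (rule DERIV_chain2[OF H(1)[OF \<eta>b(1)[OF x]] \<eta>_deriv[OF ab x]])
        from norm_Lp_radial[OF dim x this u(2)]
        show "norm (Lp p R (u k) x) powr p = Pk k x" by (simp add: Pk_def)
      qed measurable
      then show ?thesis unfolding rU using limP by simp
    qed
    have "c * lhs_norm p ps R ?U \<le> rhs_norm p R ?U"
      by (rule LIMSEQ_le[OF tendsto_mult_left[OF limL'] limP']) (use c u(1) in auto)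
    also have "\<dots> = sobolev_const n p * \<alpha> powr (- ((n - 1) / n)) * lhs_norm p ps R ?U"
      by (rule extremal_equality[OF dim ab, symmetric])
    finally have "c * lhs_norm p ps R ?U \<le> sobolev_const n p * \<alpha> powr (- ((n - 1) / n)) * lhs_norm p ps R ?U" .
    moreover have "0 < lhs_norm p ps R ?U"
      unfolding lU using talenti(3)[OF dim ab] \<alpha>_pos by simp
    ultimately show ?thesis by simp
  qed
qed

end

end

theorem theorem1p2:
  fixes n :: nat and p pstar R K :: real
  assumes dim: "n = CARD('n::finite)"
    and n: "2 \<le> n"
    and p: "1 < p" "p < real n"
    and pstar: "1 / pstar = 1 / p - 1 / real n"
    and R: "0 < R"
    and K: "K = sobolev_const (real n) p
                  * ((real n - p) / (p - 1)) powr (- ((real n - 1) / real n))"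
  shows "(\<forall>u :: real ^ 'n \<Rightarrow> real. u \<in> test_functions R \<longrightarrow>
            K * lhs_norm p pstar R u \<le> rhs_norm p R u)
    \<and> (\<forall>C. (\<forall>u :: real ^ 'n \<Rightarrow> real. u \<in> test_functions R \<longrightarrow>
            C * lhs_norm p pstar R u \<le> rhs_norm p R u) \<longrightarrow> C \<le> K)
    \<and> (\<forall>a b. 0 < a \<longrightarrow> 0 < b \<longrightarrow>
          (let U = U_fun p R a b :: real ^ 'n \<Rightarrow> real in
            set_integrable lebesgue (ball 0 R) (lhs_integrand p pstar R U)
            \<and> set_integrable lebesgue (ball 0 R) (rhs_integrand p R U)
            \<and> K * lhs_norm p pstar R U = rhs_norm p R U))
    \<and> (\<forall>u :: real ^ 'n \<Rightarrow> real. u \<in> test_functions R \<longrightarrow> (\<forall>l>0.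
          lhs_norm p pstar R (scale_fun p R l u) = lhs_norm p pstar R u
          \<and> rhs_norm p R (scale_fun p R l u) = rhs_norm p R u))"
proof -
  interpret sobolev_ball "real n" p R
    by (rule sobolev_ball.intro) (use p R in auto)
  have d: "real n = real CARD('n)" by (simp add: dim)
  \<comment> \<open>The hypothesis fixes the reciprocal of \<open>pstar\<close>, and a real number
    is determined by its reciprocal.\<close>
  have "1 / pstar = 1 / ps" unfolding pstar ps_def using p by (simp add: field_simps)
  then have ps: "pstar = ps" by simp
  have K': "K = sobolev_const (real n) p * \<alpha> powr (- ((real n - 1) / real n))"
    unfolding K \<alpha>_def ..
  show ?thesis
    unfolding ps K' Let_def
  proof (intro conjI allI impI)
    fix u :: "real ^ 'n \<Rightarrow> real" assume u: "u \<in> test_functions R"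
    show "sobolev_const (real n) p * \<alpha> powr (- ((real n - 1) / real n)) * lhs_norm p ps R u \<le> rhs_norm p R u"
      by (rule sobolev_ball_inequality[OF d u])
    fix l :: real assume l: "0 < l"
    show "lhs_norm p ps R (scale_fun p R l u) = lhs_norm p ps R u"
      "rhs_norm p R (scale_fun p R l u) = rhs_norm p R u"
      by (rule scaling_invariance[OF d u l])+
  next
    fix C assume "\<forall>u :: real ^ 'n \<Rightarrow> real. u \<in> test_functions R \<longrightarrow> C * lhs_norm p ps R u \<le> rhs_norm p R u"
    then show "C \<le> sobolev_const (real n) p * \<alpha> powr (- ((real n - 1) / real n))"
      by (intro constant_optimal[OF d]) auto
  next
    fix a b :: real assume ab: "0 < a" "0 < b"
    let ?U = "U_fun p R a b :: real ^ 'n \<Rightarrow> real"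
    show "set_integrable lebesgue (ball 0 R) (lhs_integrand p ps R ?U)"
      "set_integrable lebesgue (ball 0 R) (rhs_integrand p R ?U)"
      by (rule extremal_function[OF d ab])+
    show "sobolev_const (real n) p * \<alpha> powr (- ((real n - 1) / real n)) * lhs_norm p ps R ?U = rhs_norm p R ?U"
      by (rule extremal_equality[OF d ab])
  qed
qed

end
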